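(* Let $n\ge 2$, let $\gamma$ be the standard Gaussian measure on $\mathbb{R}^n$, and let $\mu$ be a Borel probability measure on $\mathbb{R}^n$ satisfying the moment assumption. Then $C_{PK}(\mu)\geq C_{PK}(\gamma)$, with equality only if $\mu=\gamma$.
   Context: Throughout $n\ge 2$. The standard Gaussian measure is $d\gamma(x) = (2\pi)^{-n/2}e^{-|x|^2/2}dx$ on $\mathbb{R}^n$. Moment assumption. A Borel probability measure $\mu$ on $\mathbb{R}^n$ satisfies the moment assumption if, for all $1\le i,j,k\le n$, the following integrals exist and $$\int x_i\, d\mu = 0,\qquad \int x_i x_j\, d\mu = \delta_{ij},\qquad \int x_i x_j x_k\, d\mu = 0,$$ and, whenever $i\ne j$, $\int (x_i^2+x_j^2)x_j^2\, d\mu = 4$. (These are the values of the same integrals under $\gamma$.) Poincaré–Korn constant. Let $\mu$ be a centered Borel probability measure on $\mathbb{R}^n$ (i.e. $\int x\,d\mu=0$). Let $\mathcal{A} := \{x\mapsto Ax : A\in M_{n\times n}(\mathbb{R}),\ A=-A^T\}$. For differentiable $u=(u_1,\dots,u_n):\mathbb{R}^n\to\mathbb{R}^n$, let $\nabla_s u := \frac12\big((\nabla u)+(\nabla u)^T\big)$ be the symmetrized gradient, i.e. $[\nabla_s u]_{k\ell}=\frac12(\partial_k u_\ell+\partial_\ell u_k)$. For vector-valued $u$, $\|u\|_{L^2(\mu)}^2:=\int |u|^2d\mu$ with $|\cdot|$ the Euclidean norm; for matrix-valued $U$, $\|U\|_{L^2(\mu)}^2:=\int\sum_{i,j}[U]_{ij}^2\,d\mu$.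 Let $$\mathcal{C}:=\{u:\mathbb{R}^n\to\mathbb{R}^n : u \text{ differentiable},\ \textstyle\int u\,d\mu=0,\ \|\nabla_s u\|_{L^2(\mu)}^2<\infty\}.$$ The Poincaré–Korn constant $C_{PK}(\mu)$ is the smallest constant $C$ such that $$\inf_{a\in\mathcal{A}}\|u-a\|_{L^2(\mu)}^2\le 2C\,\|\nabla_s u\|_{L^2(\mu)}^2\quad\text{for all } u\in\mathcal{C},$$ with $C_{PK}(\mu)=+\infty$ if there is no such finite constant. The factor 2 is a normalization chosen so that $C_{PK}(\gamma)=1$, a fact known from earlier work (Carrapatoso et al.). *)

theory Defs
  imports "HOL-Probability.Probability"
begin

definition std_gaussian :: "(real ^ 'n) measure" where
  "std_gaussian = density lborel
     (\<lambda>x. ennreal ((2 * pi) powr (- real CARD('n) / 2) * exp (- (norm x)\<^sup>2 / 2)))"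

text \<open>The predicate \<open>has_bochner_integral\<close> states both that the integral exists
  and that it has the given value.\<close>

definition moment_assumption :: "(real ^ 'n) measure \<Rightarrow> bool" where
  "moment_assumption \<mu> \<longleftrightarrow>
     (\<forall>i. has_bochner_integral \<mu> (\<lambda>x. x $ i) 0) \<and>
     (\<forall>i j. has_bochner_integral \<mu> (\<lambda>x. x $ i * x $ j) (if i = j then 1 else 0)) \<and>
     (\<forall>i j k. has_bochner_integral \<mu> (\<lambda>x. x $ i * x $ j * x $ k) 0) \<and>
     (\<forall>i j. i \<noteq> j \<longrightarrow>
        has_bochner_integral \<mu> (\<lambda>x. ((x $ i)\<^sup>2 + (x $ j)\<^sup>2) * (x $ j)\<^sup>2) 4)"

definition skew_maps :: "(real ^ 'n \<Rightarrow> real ^ 'n) set" where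
  "skew_maps = {(\<lambda>x. A *v x) | A :: real ^ 'n ^ 'n. A = - transpose A}"

definition sym_grad :: "(real ^ 'n \<Rightarrow> real ^ 'n) \<Rightarrow> real ^ 'n \<Rightarrow> real ^ 'n ^ 'n" where
  "sym_grad u x = (1 / 2) *\<^sub>R (jacobian u (at x) + transpose (jacobian u (at x)))"

definition L2_sq_vec :: "(real ^ 'n) measure \<Rightarrow> (real ^ 'n \<Rightarrow> real ^ 'n) \<Rightarrow> ennreal" where
  "L2_sq_vec \<mu> u = (\<integral>\<^sup>+x. ennreal ((norm (u x))\<^sup>2) \<partial>\<mu>)"

definition L2_sq_mat :: "(real ^ 'n) measure \<Rightarrow> (real ^ 'n \<Rightarrow> real ^ 'n ^ 'n) \<Rightarrow> ennreal" where
  "L2_sq_mat \<mu> U = (\<integral>\<^sup>+x. ennreal (\<Sum>i\<in>UNIV. \<Sum>j\<in>UNIV. (U x $ i $ j)\<^sup>2) \<partial>\<mu>)"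

definition PK_class :: "(real ^ 'n) measure \<Rightarrow> (real ^ 'n \<Rightarrow> real ^ 'n) set" where
  "PK_class \<mu> = {u. (\<forall>x. u differentiable (at x)) \<and> has_bochner_integral \<mu> u 0 \<and>
                     L2_sq_mat \<mu> (sym_grad u) < \<infinity>}"

text \<open>Only nonnegative \<open>C\<close> need be considered: for centered \<open>\<mu>\<close> the identity belongs to
  \<open>PK_class \<mu>\<close> and its symmetrized gradient has positive norm, which rules out negative \<open>C\<close>.
  The set of admissible \<open>C\<close> is closed, so its infimum is its smallest element if it is nonempty;
  if it is empty, the infimum is \<open>\<infinity>\<close>.\<close>

definition C_PK :: "(real ^ 'n) measure \<Rightarrow> ennreal" where
  "C_PK \<mu> = Inf {ennreal C | C :: real. 0 \<le> C \<and>
     (\<forall>u\<in>PK_class \<mu>. (INF a\<in>skew_maps. L2_sq_vec \<mu> (\<lambda>x. u x - a x))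
                       \<le> ennreal (2 * C) * L2_sq_mat \<mu> (sym_grad u))}"

end

theory Submission
  imports Defs
begin

text \<open>
  \<^emph>\<open>Upper bound for the Gaussian.\<close> Let \<open>\<delta>\<^sub>k = x\<^sub>k - \<partial>\<^sub>k\<close> be the adjoint of \<open>\<partial>\<^sub>k\<close> in \<open>L\<^sup>2(\<gamma>)\<close>. The commutation
  relation \<open>\<partial>\<^sub>l \<delta>\<^sub>k = \<delta>\<^sub>k \<partial>\<^sub>l + [k = l]\<close> gives \<open>2 |\<nabla>\<^sub>s u|\<^sup>2 = |\<nabla>u|\<^sup>2 - |u|\<^sup>2 + |\<Sum>\<^sub>k \<delta>\<^sub>k u\<^sub>k|\<^sup>2\<close> (norms in \<open>L\<^sup>2(\<gamma>)\<close>).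
  On the Hermite component of degree \<open>m \<ge> 2\<close> one has \<open>|\<nabla>u|\<^sup>2 = m |u|\<^sup>2 \<ge> 2 |u|\<^sup>2\<close>, and linear fields are
  handled directly. A merely differentiable \<open>u\<close> is only tested against polynomials, which needs
  \<open>u \<in> L\<^sup>2(\<gamma>)\<close>. The identity \<open>(x - y) \<cdot> (u(x) - u(y)) = \<integral>\<^sub>0\<^sup>1 (x - y) \<cdot> \<nabla>\<^sub>s u(y + t (x - y)) (x - y) dt\<close> for
  \<open>y\<close> and \<open>y + e\<^sub>1, \<dots>, y + e\<^sub>n\<close> recovers \<open>u(x)\<close> and yields this for the dilations \<open>x \<mapsto> u(\<sigma>x)\<close>,
  \<open>\<sigma> < 1\<close>; then \<open>\<sigma>\<close> tends to \<open>1\<close>.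

  \<^emph>\<open>Lower bound and rigidity.\<close> By the moment assumption the field \<open>u\<^sub>0 = x\<^sub>i x\<^sub>j e\<^sub>i + (1 - x\<^sub>i\<^sup>2) e\<^sub>j\<close> is
  orthogonal to constants and to skew maps, and \<open>|u\<^sub>0|\<^sup>2 = 3 = 2 |\<nabla>\<^sub>s u\<^sub>0|\<^sup>2\<close> in \<open>L\<^sup>2(\<mu>)\<close>. Hence the
  constant of \<open>\<mu>\<close> is at least \<open>1\<close>. If it equals \<open>1\<close>, then \<open>u\<^sub>0\<close> is extremal, and the first variation
  in the directions \<open>cos (\<eta> \<cdot> x + \<theta>) e\<^sub>m\<close> gives \<open>\<integral> x\<^sub>i \<partial>\<^sub>k f d\<mu> = \<integral> (x\<^sub>i x\<^sub>k - [i = k]) f d\<mu>\<close> for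
  trigonometric \<open>f\<close>, which forces the characteristic function of \<open>\<mu>\<close> to be that of \<open>\<gamma>\<close>.
\<close>

section \<open>Integration by parts for the Gaussian measure\<close>

text \<open>The field of the lower bound is dictated by equality in the Gaussian argument: its
  components are Hermite polynomials of degree exactly 2, and \<delta>_i (x_i x_j) + \<delta>_j (1 -
  x_i^2) = 0, so the spectral inequality and the omission of the divergence square are both sharp on
  it. The fourth moments in the moment assumption are those that occur in its squared norm. The
  obstacle in the upper bound is that only the symmetric part of a possibly discontinuous derivative
  is square integrable. A single partial derivative cannot be integrated by parts; only u . e,
  differentiated along e, can. A polynomial close to u need not have derivatives close to those of
  u. The orthogonal projection of u to degree at most M does better: \<delta>_l \<partial>_j
  preserves this degree, so the symmetrized gradient of the projection is dominated by that of u.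
  Averaging over chords yields square integrability of u only for weights exp (-a |x|^2) with a >
  1/2. The dilation by \<sigma> compensates exactly this loss, with a = 1 / (2 \<sigma>^2). The
  number 1 separates the two constants, and equality places that of \<mu> at most at 1, where the
  first variation applies.\<close>

lemma nn_integral_exp_neg_square:
  fixes a :: real
  assumes "a > 0"
  shows "(\<integral>\<^sup>+t. ennreal (exp (- a * t\<^sup>2)) \<partial>lborel) = ennreal (sqrt (pi / a))"
proof -
  define s where "s = sqrt (1 / (2 * a))"
  have s: "s > 0" "s\<^sup>2 = 1 / (2 * a)" using assms by (auto simp: s_def)
  have nd: "exp (- a * t\<^sup>2) = sqrt (pi / a) * normal_density 0 s t" for t
    using assms by (simp add: normal_density_def s field_simps real_sqrt_mult real_sqrt_divide)
  have "(\<integral>\<^sup>+t. ennreal (normal_density 0 s t) \<partial>lborel) = 1"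
    using s by (subst nn_integral_eq_integral) auto
  then show ?thesis
    unfolding nd using assms by (simp add: ennreal_mult nn_integral_cmult)
qed

lemma nn_integral_gauss:
  fixes a :: real
  assumes "a > 0"
  shows "(\<integral>\<^sup>+x. ennreal (exp (- a * (norm x)\<^sup>2)) \<partial>(lborel :: 'a::euclidean_space measure))
    = ennreal (sqrt (pi / a) ^ DIM('a))"
proof -
  have "(norm x)\<^sup>2 = (\<Sum>b\<in>Basis. (x \<bullet> b)\<^sup>2)" for x :: 'a
    unfolding power2_norm_eq_inner by (subst euclidean_inner) (simp add: power2_eq_square)
  then have "exp (- a * (norm x)\<^sup>2) = (\<Prod>b\<in>Basis. exp (- a * (x \<bullet> b)\<^sup>2))" for x :: 'a
    by (simp add: exp_sum[symmetric] sum_distrib_left sum_negf)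
  then have "(\<integral>\<^sup>+x. ennreal (exp (- a * (norm x)\<^sup>2)) \<partial>(lborel :: 'a measure))
    = (\<integral>\<^sup>+x. (\<Prod>b\<in>Basis. ennreal (exp (- a * (x \<bullet> b)\<^sup>2))) \<partial>(lborel :: 'a measure))"
    by (simp add: prod_ennreal)
  also have "\<dots> = (\<Prod>b\<in>(Basis::'a set). (\<integral>\<^sup>+t. ennreal (exp (- a * t\<^sup>2)) \<partial>lborel))"
    by (rule nn_integral_lborel_prod) auto
  also have "\<dots> = ennreal (sqrt (pi / a) ^ DIM('a))"
    using assms by (subst nn_integral_exp_neg_square[OF assms]) (simp add: ennreal_power)
  finally show ?thesis .
qed

lemma integrable_gauss:
  fixes a :: real
  assumes "a > 0"
  shows "integrable (lborel :: 'a::euclidean_space measure) (\<lambda>x. exp (- a * (norm x)\<^sup>2))"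
  using nn_integral_gauss[OF assms, where 'a='a] by (intro integrableI_nonneg) auto

lemma sets_std_gaussian [measurable_cong, simp]: "sets std_gaussian = sets borel"
  and space_std_gaussian [simp]: "space std_gaussian = UNIV"
  by (auto simp: std_gaussian_def)

definition gauss_density :: "real ^ 'n \<Rightarrow> real" where
  "gauss_density x = (2 * pi) powr (- real CARD('n) / 2) * exp (- (norm x)\<^sup>2 / 2)"

lemma gauss_density_pos: "gauss_density x > 0"
  by (simp add: gauss_density_def)

lemma gauss_density_measurable [measurable]: "gauss_density \<in> borel_measurable borel"
  unfolding gauss_density_def[abs_def] by measurable

lemma std_gaussian_eq: "std_gaussian = density lborel (\<lambda>x. ennreal (gauss_density x))"
  by (simp add: std_gaussian_def gauss_density_def)

lemma nn_integral_std_gaussian: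
  "f \<in> borel_measurable borel \<Longrightarrow>
   (\<integral>\<^sup>+x. f x \<partial>std_gaussian) = (\<integral>\<^sup>+x. ennreal (gauss_density x) * f x \<partial>lborel)"
  unfolding std_gaussian_eq by (subst nn_integral_density) auto

lemma integrable_std_gaussian:
  fixes f :: "real ^ 'n \<Rightarrow> real"
  shows "f \<in> borel_measurable borel \<Longrightarrow>
   integrable std_gaussian f \<longleftrightarrow> integrable lborel (\<lambda>x. gauss_density x * f x)"
  unfolding std_gaussian_eq by (subst integrable_density) (auto intro: less_imp_le gauss_density_pos)

lemma integral_std_gaussian:
  fixes f :: "real ^ 'n \<Rightarrow> real"
  shows "f \<in> borel_measurable borel \<Longrightarrow>
   (LINT x|std_gaussian. f x) = (LINT x|lborel. gauss_density x * f x)"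
  unfolding std_gaussian_eq by (subst integral_density) (auto intro: less_imp_le gauss_density_pos)

lemma prob_space_std_gaussian: "prob_space (std_gaussian :: (real ^ 'n) measure)"
proof
  have "emeasure (std_gaussian :: (real ^ 'n) measure) (space std_gaussian) =
      ennreal ((2 * pi) powr (- real CARD('n) / 2)) *
        (\<integral>\<^sup>+x. ennreal (exp (- (1/2) * (norm x)\<^sup>2)) \<partial>(lborel :: (real ^ 'n) measure))"
    unfolding std_gaussian_eq
    by (subst emeasure_density) (auto simp: gauss_density_def ennreal_mult nn_integral_cmult[symmetric])
  also have "\<dots> = ennreal ((2 * pi) powr (- real CARD('n) / 2)) * ennreal (sqrt (2 * pi) ^ CARD('n))"
    by (subst nn_integral_gauss) (auto simp: mult.commute)
  also have "\<dots> = ennreal ((2 * pi) powr (- real CARD('n) / 2) * (2 * pi) powr (real CARD('n) / 2))"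
    by (simp add: ennreal_mult powr_half_sqrt[symmetric] powr_realpow[symmetric] powr_powr)
  also have "\<dots> = 1"
    by (simp add: powr_add[symmetric])
  finally show "emeasure (std_gaussian :: (real ^ 'n) measure) (space std_gaussian) = 1" .
qed

interpretation std_gaussian: prob_space "std_gaussian :: (real ^ 'n) measure"
  by (rule prob_space_std_gaussian)

text \<open>Completing the square: half of the Gaussian exponent absorbs exponential growth of any
  rate, the other half remains for integrability.\<close>

lemma exp_linear_le_gauss:
  fixes c r :: real
  shows "exp (c * r) * exp (- r\<^sup>2 / 2) \<le> exp (c\<^sup>2) * exp (- (1/4) * r\<^sup>2)"
proof -
  have "0 \<le> (c - r / 2)\<^sup>2" by simp
  then have "c * r + - r\<^sup>2 / 2 \<le> c\<^sup>2 + - (1/4) * r\<^sup>2"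
    by (simp add: power2_eq_square field_simps)
  then show ?thesis by (simp only: exp_add[symmetric] exp_le_cancel_iff)
qed

text \<open>Exponential growth is the class of choice because it contains the polynomials, is closed
  under products, and also contains a common bound for all Taylor polynomials of a cosine.\<close>

lemma integrable_std_gaussian_exp_bound:
  fixes f :: "real ^ 'n \<Rightarrow> real"
  assumes [measurable]: "f \<in> borel_measurable borel"
    and bound: "\<And>x. \<bar>f x\<bar> \<le> C * exp (c * norm x)"
  shows "integrable std_gaussian f"
proof -
  define K where "K = (2 * pi) powr (- real CARD('n) / 2)"
  have K: "K > 0" by (simp add: K_def)
  have C: "C \<ge> 0" using bound[of 0] by simp
  have "integrable lborel (\<lambda>x. gauss_density x * f x)"
  proof (rule Bochner_Integration.integrable_bound)
    show "integrable lborel (\<lambda>x :: real ^ 'n. K * C * exp (c\<^sup>2) * exp (- (1/4) * (norm x)\<^sup>2))"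
      by (intro integrable_mult_right integrable_gauss) simp
    have "\<bar>gauss_density x * f x\<bar> \<le> K * C * exp (c\<^sup>2) * exp (- (1/4) * (norm x)\<^sup>2)" for x
    proof -
      have "\<bar>gauss_density x * f x\<bar> = K * exp (- (norm x)\<^sup>2 / 2) * \<bar>f x\<bar>"
        using K by (simp add: gauss_density_def K_def abs_mult)
      also have "\<dots> \<le> K * exp (- (norm x)\<^sup>2 / 2) * (C * exp (c * norm x))"
        using K bound by (intro mult_left_mono) auto
      also have "\<dots> = K * C * (exp (c * norm x) * exp (- (norm x)\<^sup>2 / 2))" by simp
      also have "\<dots> \<le> K * C * (exp (c\<^sup>2) * exp (- (1/4) * (norm x)\<^sup>2))"
        using K C exp_linear_le_gauss by (intro mult_left_mono) auto
      finally show ?thesis by simp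
    qed
    then show "AE x in lborel. norm (gauss_density x * f x) \<le>
        norm (K * C * exp (c\<^sup>2) * exp (- (1/4) * (norm x)\<^sup>2))"
      using K C by (auto simp: abs_mult)
  qed simp
  then show ?thesis by (subst integrable_std_gaussian) auto
qed

section \<open>Translations, dilations and the vanishing integral of a directional
  derivative\<close>

lemma nn_integral_lborel_shift:
  fixes f :: "'a::euclidean_space \<Rightarrow> ennreal"
  assumes [measurable]: "f \<in> borel_measurable borel"
  shows "(\<integral>\<^sup>+x. f (x + c) \<partial>lborel) = (\<integral>\<^sup>+x. f x \<partial>lborel)"
proof -
  have "(\<integral>\<^sup>+x. f x \<partial>lborel) = (\<integral>\<^sup>+x. f x \<partial>distr lborel borel ((+) c))"
    by (simp add: lborel_distr_plus)
  also have "\<dots> = (\<integral>\<^sup>+x. f (c + x) \<partial>lborel)"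
    by (subst nn_integral_distr) auto
  finally show ?thesis by (simp add: add.commute)
qed

lemma nn_integral_lborel_affine:
  fixes f :: "'a::euclidean_space \<Rightarrow> ennreal"
  assumes [measurable]: "f \<in> borel_measurable borel" and "t \<noteq> 0"
  shows "(\<integral>\<^sup>+x. f (c + t *\<^sub>R x) \<partial>lborel) = ennreal (1 / \<bar>t\<bar> ^ DIM('a)) * (\<integral>\<^sup>+x. f x \<partial>lborel)"
proof -
  have "(\<integral>\<^sup>+x. f x \<partial>lborel) = ennreal (\<bar>t\<bar> ^ DIM('a)) * (\<integral>\<^sup>+x. f (c + t *\<^sub>R x) \<partial>lborel)"
    by (subst lborel_affine[OF assms(2), of c])
       (simp add: nn_integral_density nn_integral_distr nn_integral_cmult)
  then show ?thesis using assms(2)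
    by (simp add: mult.assoc[symmetric] ennreal_mult[symmetric])
qed

lemma integral_lborel_shift:
  fixes f :: "'a::euclidean_space \<Rightarrow> real"
  assumes [measurable]: "f \<in> borel_measurable borel"
  shows "(LINT x|lborel. f (x + c)) = (LINT x|lborel. f x)"
    and "integrable lborel (\<lambda>x. f (x + c)) \<longleftrightarrow> integrable lborel f"
proof -
  have "(LINT x|lborel. f x) = (LINT x|distr lborel borel ((+) c). f x)"
    by (simp add: lborel_distr_plus)
  also have "\<dots> = (LINT x|lborel. f (c + x))"
    by (subst integral_distr) auto
  finally show "(LINT x|lborel. f (x + c)) = (LINT x|lborel. f x)" by (simp add: add.commute)
  have "integrable lborel f \<longleftrightarrow> integrable (distr lborel borel ((+) c)) f"
    by (simp add: lborel_distr_plus)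
  also have "\<dots> \<longleftrightarrow> integrable lborel (\<lambda>x. f (c + x))"
    by (subst integrable_distr_eq) auto
  finally show "integrable lborel (\<lambda>x. f (x + c)) \<longleftrightarrow> integrable lborel f" by (simp add: add.commute)
qed

lemma integral_01_derivative:
  fixes f f' :: "real \<Rightarrow> real"
  assumes "\<And>s. (f has_real_derivative f' s) (at s)"
    and "integrable lborel (\<lambda>s. indicator {0..1} s * f' s)"
  shows "(LINT s|lborel. indicator {0..1} s * f' s) = f 1 - f 0"
proof -
  \<comment> \<open>For the gauge integral the fundamental theorem asks for no continuity of
    \<open>f'\<close>; Lebesgue integrability then identifies the two integrals.\<close>
  have "(f' has_integral f 1 - f 0) {0..1}"
    using assms(1) by (intro fundamental_theorem_of_calculus)
      (auto simp: has_real_derivative_iff_has_vector_derivative intro: has_vector_derivative_at_within)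
  then have "integral {0..1} f' = f 1 - f 0" by (rule integral_unique)
  moreover have "set_integrable lborel {0..1} f'"
    using assms(2) by (simp add: set_integrable_def)
  ultimately show ?thesis
    using set_borel_integral_eq_integral(2)[of "{0..1}" f'] by (simp add: set_lebesgue_integral_def)
qed

text \<open>Integrate \<open>F (x + e) - F x = \<integral>\<^sub>0\<^sup>1 D (x + s e) ds\<close> over \<open>x\<close> and use translation invariance.\<close>

theorem integral_directional_derivative_eq_0:
  fixes F D :: "'a::euclidean_space \<Rightarrow> real"
  assumes F: "integrable lborel F" and D: "integrable lborel D"
    and der: "\<And>x. ((\<lambda>s. F (x + s *\<^sub>R e)) has_real_derivative D x) (at 0)"
  shows "(LINT x|lborel. D x) = 0"
proof -
  have [measurable]: "F \<in> borel_measurable borel" "D \<in> borel_measurable borel"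
    using F D by (auto dest: borel_measurable_integrable)
  have der': "((\<lambda>s. F (x + s *\<^sub>R e)) has_real_derivative D (x + s *\<^sub>R e)) (at s)" for x s
  proof -
    have "((\<lambda>r. F ((x + s *\<^sub>R e) + r *\<^sub>R e)) has_real_derivative D (x + s *\<^sub>R e)) (at 0)"
      by (rule der)
    then have "((\<lambda>r. F (x + (r + s) *\<^sub>R e)) has_real_derivative D (x + s *\<^sub>R e)) (at 0)"
      by (simp add: algebra_simps)
    then show ?thesis
      using DERIV_shift[of "\<lambda>s. F (x + s *\<^sub>R e)" "D (x + s *\<^sub>R e)" 0 s] by simp
  qed
  define G where "G = (\<lambda>(s::real, x). indicator {0..1} s * D (x + s *\<^sub>R e))"
  have [measurable]: "G \<in> borel_measurable (lborel \<Otimes>\<^sub>M lborel)"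
    unfolding G_def by measurable
  have "(\<integral>\<^sup>+s. (\<integral>\<^sup>+x. ennreal (norm (G (s, x))) \<partial>lborel) \<partial>lborel)
      = (\<integral>\<^sup>+s. indicator {0..1::real} s * (\<integral>\<^sup>+x. ennreal \<bar>D x\<bar> \<partial>lborel) \<partial>lborel)"
  proof (rule nn_integral_cong)
    fix s :: real
    show "(\<integral>\<^sup>+x. ennreal (norm (G (s, x))) \<partial>lborel) = indicator {0..1} s * (\<integral>\<^sup>+x. ennreal \<bar>D x\<bar> \<partial>lborel)"
      using nn_integral_lborel_shift[of "\<lambda>x. ennreal \<bar>D x\<bar>" "s *\<^sub>R e"]
      by (simp add: G_def indicator_def)
  qed
  also have "\<dots> = (\<integral>\<^sup>+x. ennreal \<bar>D x\<bar> \<partial>lborel)"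
    by (simp add: nn_integral_multc)
  also have "\<dots> < \<infinity>" using D by (simp add: integrable_iff_bounded)
  finally have intG: "integrable (lborel \<Otimes>\<^sub>M lborel) G"
    by (intro integrableI_bounded) (simp_all add: lborel.nn_integral_fst[symmetric])
  have "(LINT x|lborel. (LINT s|lborel. G (s, x))) = (LINT s|lborel. (LINT x|lborel. G (s, x)))"
    using lborel_pair.Fubini_integral[of "\<lambda>s x. G (s, x)"] intG by simp
  also have "\<dots> = (LINT s|lborel. indicator {0..1::real} s * (LINT x|lborel. D x))"
    by (intro Bochner_Integration.integral_cong) (simp_all add: G_def integral_lborel_shift)
  also have "\<dots> = (LINT x|lborel. D x)" by simp
  finally have 1: "(LINT x|lborel. (LINT s|lborel. G (s, x))) = (LINT x|lborel. D x)" .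
  \<comment> \<open>Fubini provides integrable slices only for almost every \<open>x\<close>, and
    the fundamental theorem is applied just there.\<close>
  have AE: "AE x in lborel. integrable lborel (\<lambda>s. G (s, x))"
    using lborel_pair.AE_integrable_snd[of "\<lambda>s x. G (s, x)"] intG by simp
  have "(LINT x|lborel. (LINT s|lborel. G (s, x))) = (LINT x|lborel. F (x + e) - F x)"
  proof (rule integral_cong_AE)
    show "AE x in lborel. (LINT s|lborel. G (s, x)) = F (x + e) - F x"
      using AE
    proof eventually_elim
      case (elim x)
      then show ?case
        using integral_01_derivative[OF der', of x] by (simp add: G_def)
    qed
  qed measurable
  also have "\<dots> = 0"
    using F by (simp add: integral_lborel_shift Bochner_Integration.integral_diff)
  finally show ?thesis using 1 by simp
qed

section \<open>Square integrability from the symmetrized gradient\<close>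

lemma borel_measurable_vec_nth [measurable (raw)]:
  fixes f :: "'a \<Rightarrow> real ^ 'n"
  assumes "f \<in> borel_measurable M"
  shows "(\<lambda>x. f x $ k) \<in> borel_measurable M"
  using borel_measurable_inner[OF assms borel_measurable_const[of "axis k 1"]]
  by (simp add: inner_axis)

lemma sum_squares_matrix: "(\<Sum>i\<in>UNIV. \<Sum>j\<in>UNIV. (A $ i $ j)\<^sup>2) = (norm (A :: real ^ 'n ^ 'm))\<^sup>2"
  by (simp add: norm_vec_def L2_set_def sum_nonneg)

lemma norm_matrix_vector_mult_le: "norm (A *v x) \<le> norm (A :: real ^ 'n ^ 'm) * norm x"
proof -
  have "norm (A *v x) = L2_set (\<lambda>i. \<bar>A $ i \<bullet> x\<bar>) UNIV"
    by (simp add: norm_vec_def matrix_vector_mult_def inner_vec_def L2_set_def)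
  also have "\<dots> \<le> L2_set (\<lambda>i. norm (A $ i) * norm x) UNIV"
    by (rule L2_set_mono) (auto simp: Cauchy_Schwarz_ineq2)
  also have "\<dots> = norm A * norm x"
    by (simp add: L2_set_left_distrib[symmetric] norm_vec_def[of A])
  finally show ?thesis .
qed

text \<open>A quadratic form does not see the antisymmetric part of its matrix. Hence the component
  of \<open>u\<close> along \<open>e\<close>, restricted to a line with direction \<open>e\<close>,
  is governed by \<open>sym_grad\<close> alone.\<close>

lemma inner_sym_grad:
  fixes u :: "real ^ 'n \<Rightarrow> real ^ 'n"
  shows   "(sym_grad u x *v e) \<bullet> e = (jacobian u (at x) *v e) \<bullet> e"
proof -
  let ?J = "jacobian u (at x)"
  have "(transpose ?J *v e) \<bullet> e = (?J *v e) \<bullet> e"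
    using dot_lmul_matrix[of e ?J e] by (simp add: transpose_matrix_vector inner_commute)
  then show ?thesis
    by (simp add: sym_grad_def scaleR_matrix_vector_assoc[symmetric] matrix_vector_mult_add_rdistrib
        inner_add_left)
qed

lemma has_derivative_jacobian:
  fixes u :: "real ^ 'n \<Rightarrow> real ^ 'm"
  assumes "u differentiable (at x)"
  shows "(u has_derivative (\<lambda>h. jacobian u (at x) *v h)) (at x)"
  using assms jacobian_works by blast

lemma has_vector_derivative_along:
  fixes u :: "real ^ 'n \<Rightarrow> real ^ 'm"
  assumes "u differentiable (at (x + s *\<^sub>R e))"
  shows "((\<lambda>r. u (x + r *\<^sub>R e)) has_vector_derivative (jacobian u (at (x + s *\<^sub>R e)) *v e)) (at s)"
proof -
  have "((\<lambda>r. x + r *\<^sub>R e) has_derivative (\<lambda>r. r *\<^sub>R e)) (at s)"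
    by (auto intro!: derivative_eq_intros)
  from has_derivative_compose[OF this has_derivative_jacobian[OF assms]]
  show ?thesis
    by (simp add: has_vector_derivative_def linear_scale[OF matrix_vector_mul_linear])
qed

lemma inner_has_real_derivative_along:
  fixes u :: "real ^ 'n \<Rightarrow> real ^ 'n"
  assumes "u differentiable (at (x + s *\<^sub>R e))"
  shows "((\<lambda>r. u (x + r *\<^sub>R e) \<bullet> e) has_real_derivative (sym_grad u (x + s *\<^sub>R e) *v e) \<bullet> e) (at s)"
  unfolding inner_sym_grad has_real_derivative_iff_has_vector_derivative
  using has_vector_derivative_along[OF assms]
  by (rule bounded_linear.has_vector_derivative[OF bounded_linear_inner_left])

lemma differentiable_imp_measurable:
  fixes u :: "real ^ 'n \<Rightarrow> real ^ 'n"
  assumes "\<And>x. u differentiable (at x)"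
  shows "u \<in> borel_measurable borel"
  using assms by (intro borel_measurable_continuous_onI)
    (auto simp: continuous_on_eq_continuous_at differentiable_imp_continuous_within)

text \<open>The derivative need not be continuous, but its entries are pointwise limits of
  difference quotients of the continuous \<open>u\<close>.\<close>

lemma borel_measurable_jacobian:
  fixes u :: "real ^ 'n \<Rightarrow> real ^ 'n"
  assumes d: "\<And>x. u differentiable (at x)"
  shows "(\<lambda>x. jacobian u (at x) $ k $ l) \<in> borel_measurable borel"
proof (rule borel_measurable_LIMSEQ_real)
  have [measurable]: "u \<in> borel_measurable borel"
    by (rule differentiable_imp_measurable[OF d])
  let ?h = "\<lambda>n. inverse (real (Suc n))"
  show "(\<lambda>x. (u (x + ?h n *\<^sub>R axis l 1) $ k - u x $ k) / ?h n) \<in> borel_measurable borel" for n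
    by measurable
  fix x :: "real ^ 'n"
  have "((\<lambda>r. u (x + r *\<^sub>R axis l 1)) has_vector_derivative (jacobian u (at x) *v axis l 1)) (at 0)"
    using has_vector_derivative_along[of u x 0 "axis l 1"] d by simp
  then have "((\<lambda>r. u (x + r *\<^sub>R axis l 1) $ k) has_vector_derivative (jacobian u (at x) *v axis l 1) $ k) (at 0)"
    by (rule bounded_linear.has_vector_derivative[OF bounded_linear_vec_nth])
  then have "((\<lambda>r. u (x + r *\<^sub>R axis l 1) $ k) has_real_derivative jacobian u (at x) $ k $ l) (at 0)"
    by (simp add: has_real_derivative_iff_has_vector_derivative matrix_vector_mult_basis column_def)
  then have "((\<lambda>h. (u (x + h *\<^sub>R axis l 1) $ k - u x $ k) / h) \<longlongrightarrow> jacobian u (at x) $ k $ l) (at 0)"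
    by (simp add: DERIV_def)
  moreover have "filterlim ?h (at 0) sequentially"
    using LIMSEQ_inverse_real_of_nat by (auto simp: filterlim_at)
  ultimately show "(\<lambda>n. (u (x + ?h n *\<^sub>R axis l 1) $ k - u x $ k) / ?h n) \<longlonglongrightarrow> jacobian u (at x) $ k $ l"
    by (rule filterlim_compose)
qed

lemma sym_grad_nth:
  "sym_grad u x $ k $ l = (jacobian u (at x) $ k $ l + jacobian u (at x) $ l $ k) / 2"
  by (simp add: sym_grad_def transpose_def)

lemma sym_grad_sym: "sym_grad u x $ k $ l = sym_grad u x $ l $ k"
  by (simp add: sym_grad_nth)

lemma borel_measurable_sym_grad_nth:
  fixes u :: "real ^ 'n \<Rightarrow> real ^ 'n"
  assumes d: "\<And>x. u differentiable (at x)"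
  shows "(\<lambda>x. sym_grad u x $ k $ l) \<in> borel_measurable borel"
  unfolding sym_grad_nth using borel_measurable_jacobian[OF d] by measurable

lemma borel_measurable_norm_sym_grad:
  fixes u :: "real ^ 'n \<Rightarrow> real ^ 'n"
  assumes d: "\<And>x. u differentiable (at x)"
  shows "(\<lambda>x. (norm (sym_grad u x))\<^sup>2) \<in> borel_measurable borel"
  unfolding sum_squares_matrix[symmetric] using borel_measurable_sym_grad_nth[OF d] by measurable

section \<open>Increments along chords\<close>

lemma square_integral_01_le:
  fixes f :: "real \<Rightarrow> real"
  assumes f: "integrable lborel (\<lambda>t. indicator {0..1} t * f t)"
    and f2: "integrable lborel (\<lambda>t. indicator {0..1} t * (f t)\<^sup>2)"
  shows "(LINT t|lborel. indicator {0..1} t * f t)\<^sup>2 \<le> (LINT t|lborel. indicator {0..1} t * (f t)\<^sup>2)"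
proof -
  define m where "m = (LINT t|lborel. indicator {0..1} t * f t)"
  have eq: "indicator {0..1} t * (f t - m)\<^sup>2 =
      indicator {0..1} t * (f t)\<^sup>2 - 2 * m * (indicator {0..1} t * f t) + m\<^sup>2 * indicator {0..1} t" for t :: real
    by (simp add: power2_eq_square algebra_simps)
  have "0 \<le> (LINT t|lborel. indicator {0..1} t * (f t - m)\<^sup>2)"
    by (rule integral_nonneg_AE) auto
  also have "\<dots> = (LINT t|lborel. indicator {0..1} t * (f t)\<^sup>2) - 2 * m * m + m\<^sup>2"
    unfolding eq using f f2 by (simp add: m_def)
  finally show ?thesis by (simp add: m_def power2_eq_square)
qed

text \<open>Fundamental theorem along the segment from \<open>y\<close> to \<open>x\<close>,
  followed by Jensen's inequality. The fourth power arises because \<open>e\<close> enters the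
  quadratic form twice and the result is squared.\<close>

lemma chord_bound:
  fixes u :: "real ^ 'n \<Rightarrow> real ^ 'n"
  assumes d: "\<And>x. u differentiable (at x)"
  shows "ennreal (((x - y) \<bullet> (u x - u y))\<^sup>2) \<le>
    (\<integral>\<^sup>+t. indicator {0..1} t * ennreal ((norm (x - y))^4 * (norm (sym_grad u (y + t *\<^sub>R (x - y))))\<^sup>2) \<partial>lborel)"
    (is "_ \<le> ?I")
\<comment> \<open>An infinite right side is trivial; a finite one supplies the integrability that
  the fundamental theorem requires.\<close>
proof (cases "?I = \<infinity>")
  case False
  define e where "e = x - y"
  define q where "q t = (sym_grad u (y + t *\<^sub>R e) *v e) \<bullet> e" for t
  define h where "h t = (norm e)^4 * (norm (sym_grad u (y + t *\<^sub>R e)))\<^sup>2" for t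
  note [measurable] = borel_measurable_norm_sym_grad[OF d] borel_measurable_sym_grad_nth[OF d]
  have [measurable]: "h \<in> borel_measurable borel" unfolding h_def by measurable
  have [measurable]: "q \<in> borel_measurable borel"
    unfolding q_def inner_vec_def matrix_vector_mult_def by simp
  have qh: "(q t)\<^sup>2 \<le> h t" for t
  proof -
    have "\<bar>q t\<bar> \<le> norm (sym_grad u (y + t *\<^sub>R e) *v e) * norm e"
      unfolding q_def by (rule Cauchy_Schwarz_ineq2)
    also have "\<dots> \<le> norm (sym_grad u (y + t *\<^sub>R e)) * norm e * norm e"
      by (intro mult_right_mono norm_matrix_vector_mult_le) auto
    finally have "\<bar>q t\<bar>\<^sup>2 \<le> (norm (sym_grad u (y + t *\<^sub>R e)) * norm e * norm e)\<^sup>2"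
      by (rule power_mono) simp
    then show ?thesis by (simp add: h_def power_mult_distrib eval_nat_numeral mult_ac)
  qed
  have I: "?I = (\<integral>\<^sup>+t. ennreal (indicator {0..1} t * h t) \<partial>lborel)"
    by (intro nn_integral_cong) (simp add: h_def e_def indicator_def)
  have h: "integrable lborel (\<lambda>t. indicator {0..1} t * h t)"
    using False unfolding I by (intro integrableI_nonneg) (auto simp: h_def less_top)
  have q2: "integrable lborel (\<lambda>t. indicator {0..1} t * (q t)\<^sup>2)"
    by (rule Bochner_Integration.integrable_bound[OF h])
       (auto simp: indicator_def h_def[symmetric] intro!: order_trans[OF qh] )
  have "integrable lborel (\<lambda>t. indicator {0..1::real} t + indicator {0..1} t * (q t)\<^sup>2)"
    using q2 by simp
  then have q1: "integrable lborel (\<lambda>t. indicator {0..1} t * q t)"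
  proof (rule Bochner_Integration.integrable_bound)
    have "\<bar>q t\<bar> \<le> 1 + (q t)\<^sup>2" for t
    proof -
      have "0 \<le> (\<bar>q t\<bar> - 1)\<^sup>2" by simp
      then show ?thesis by (simp add: power2_eq_square algebra_simps)
    qed
    then show "AE t in lborel. norm (indicator {0..1} t * q t) \<le> norm (indicator {0..1::real} t + indicator {0..1} t * (q t)\<^sup>2)"
      by (auto simp: indicator_def)
  qed measurable
  have "(LINT t|lborel. indicator {0..1} t * q t) = u (y + 1 *\<^sub>R e) \<bullet> e - u (y + 0 *\<^sub>R e) \<bullet> e"
    using q1 unfolding q_def by (intro integral_01_derivative inner_has_real_derivative_along d) simp
  also have "\<dots> = (x - y) \<bullet> (u x - u y)"
    by (simp add: e_def inner_diff_left inner_diff_right inner_commute)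
  finally have "((x - y) \<bullet> (u x - u y))\<^sup>2 \<le> (LINT t|lborel. indicator {0..1} t * (q t)\<^sup>2)"
    using square_integral_01_le[OF q1 q2] by simp
  also have "\<dots> \<le> (LINT t|lborel. indicator {0..1} t * h t)"
    using q2 h qh by (intro integral_mono) (auto simp: indicator_def)
  finally have "ennreal (((x - y) \<bullet> (u x - u y))\<^sup>2) \<le> ennreal (LINT t|lborel. indicator {0..1} t * h t)"
    by (rule ennreal_leI)
  also have "\<dots> = ?I"
    unfolding I using h by (subst nn_integral_eq_integral) (auto simp: h_def)
  finally show ?thesis .
qed simp

text \<open>Substituting in \<open>x\<close> for \<open>t \<ge> 1 / 2\<close> and in \<open>y\<close> otherwise keeps the Jacobian bounded uniformly in \<open>t\<close>.\<close>

lemma nn_integral_chord_average: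
  fixes F :: "'a::euclidean_space \<Rightarrow> ennreal"
  assumes [measurable]: "F \<in> borel_measurable borel" and k: "k > 0" and t: "0 \<le> t" "t \<le> 1"
  shows "(\<integral>\<^sup>+x. (\<integral>\<^sup>+y. F (y + t *\<^sub>R (x - y)) * ennreal (exp (- k * (norm x)\<^sup>2) * exp (- k * (norm y)\<^sup>2)) \<partial>lborel) \<partial>lborel)
    \<le> ennreal (sqrt (pi / k) ^ DIM('a) * 2 ^ DIM('a)) * (\<integral>\<^sup>+x. F x \<partial>lborel)"
proof -
  have bound: "(\<integral>\<^sup>+x. (\<integral>\<^sup>+y. F (s *\<^sub>R x + r *\<^sub>R y) * ennreal (exp (- k * (norm x)\<^sup>2) * exp (- k * (norm y)\<^sup>2)) \<partial>lborel) \<partial>lborel)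
    \<le> ennreal (sqrt (pi / k) ^ DIM('a) * 2 ^ DIM('a)) * (\<integral>\<^sup>+x. F x \<partial>lborel)"
    if r: "r \<ge> 1 / 2" for r s :: real
  proof -
    have "(\<integral>\<^sup>+y. F (s *\<^sub>R x + r *\<^sub>R y) * ennreal (exp (- k * (norm x)\<^sup>2) * exp (- k * (norm y)\<^sup>2)) \<partial>lborel)
      \<le> ennreal (exp (- k * (norm x)\<^sup>2)) * (ennreal (2 ^ DIM('a)) * (\<integral>\<^sup>+x. F x \<partial>lborel))" for x
    proof -
      \<comment> \<open>Without its weight in \<open>y\<close> the inner integral is an affine
        substitution, and \<open>r \<ge> 1 / 2\<close> bounds the Jacobian factor by
        \<open>2 ^ DIM('a)\<close>.\<close>
      have "exp (- k * (norm x)\<^sup>2) * exp (- k * (norm y)\<^sup>2) \<le> exp (- k * (norm x)\<^sup>2)" for y :: 'a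
        using k by (intro mult_right_le_one_le) auto
      then have "(\<integral>\<^sup>+y. F (s *\<^sub>R x + r *\<^sub>R y) * ennreal (exp (- k * (norm x)\<^sup>2) * exp (- k * (norm y)\<^sup>2)) \<partial>lborel)
        \<le> (\<integral>\<^sup>+y. F (s *\<^sub>R x + r *\<^sub>R y) * ennreal (exp (- k * (norm x)\<^sup>2)) \<partial>lborel)"
        by (intro nn_integral_mono mult_left_mono ennreal_leI) auto
      also have "\<dots> = ennreal (exp (- k * (norm x)\<^sup>2)) * (\<integral>\<^sup>+y. F (s *\<^sub>R x + r *\<^sub>R y) \<partial>lborel)"
        by (subst nn_integral_multc) (auto simp: mult.commute)
      also have "(\<integral>\<^sup>+y. F (s *\<^sub>R x + r *\<^sub>R y) \<partial>lborel) = ennreal (1 / \<bar>r\<bar> ^ DIM('a)) * (\<integral>\<^sup>+x. F x \<partial>lborel)"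
        using r by (intro nn_integral_lborel_affine) auto
      also have "ennreal (1 / \<bar>r\<bar> ^ DIM('a)) \<le> ennreal (2 ^ DIM('a))"
      proof (rule ennreal_leI)
        have "(1 / r) ^ DIM('a) \<le> 2 ^ DIM('a)"
          using r by (intro power_mono) (auto simp: field_simps)
        then show "1 / \<bar>r\<bar> ^ DIM('a) \<le> 2 ^ DIM('a)" using r by (simp add: power_one_over)
      qed
      finally show ?thesis by (simp add: mult_left_mono mult_right_mono)
    qed
    then have "(\<integral>\<^sup>+x. (\<integral>\<^sup>+y. F (s *\<^sub>R x + r *\<^sub>R y) * ennreal (exp (- k * (norm x)\<^sup>2) * exp (- k * (norm y)\<^sup>2)) \<partial>lborel) \<partial>lborel)
      \<le> (\<integral>\<^sup>+x. ennreal (exp (- k * (norm x)\<^sup>2)) * (ennreal (2 ^ DIM('a)) * (\<integral>\<^sup>+x. F x \<partial>lborel)) \<partial>(lborel :: 'a measure))"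
      by (intro nn_integral_mono)
    also have "\<dots> = ennreal (sqrt (pi / k) ^ DIM('a)) * (ennreal (2 ^ DIM('a)) * (\<integral>\<^sup>+x. F x \<partial>lborel))"
      by (subst nn_integral_multc) (auto simp only: nn_integral_gauss[OF k], auto)
    finally show ?thesis using k by (simp add: ennreal_mult mult.assoc)
  qed
  have e: "y + t *\<^sub>R (x - y) = t *\<^sub>R x + (1 - t) *\<^sub>R y" for x y :: 'a
    by (simp add: algebra_simps)
  show ?thesis
  proof (cases "t \<le> 1 / 2")
    case True
    then show ?thesis unfolding e by (intro bound) simp
  next
    \<comment> \<open>Here the coefficient \<open>t\<close> of \<open>x\<close> is the large one, so
      \<open>x\<close> and \<open>y\<close> exchange their roles.\<close>
    case False
    have "(\<integral>\<^sup>+x. (\<integral>\<^sup>+y. F (t *\<^sub>R x + (1 - t) *\<^sub>R y) * ennreal (exp (- k * (norm x)\<^sup>2) * exp (- k * (norm y)\<^sup>2)) \<partial>lborel) \<partial>lborel)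
      = (\<integral>\<^sup>+y. (\<integral>\<^sup>+x. F (t *\<^sub>R x + (1 - t) *\<^sub>R y) * ennreal (exp (- k * (norm x)\<^sup>2) * exp (- k * (norm y)\<^sup>2)) \<partial>lborel) \<partial>lborel)"
      by (rule lborel_pair.Fubini'[symmetric]) measurable
    also have "\<dots> \<le> ennreal (sqrt (pi / k) ^ DIM('a) * 2 ^ DIM('a)) * (\<integral>\<^sup>+x. F x \<partial>lborel)"
      using bound[of t "1 - t"] False by (simp add: add.commute mult.commute)
    finally show ?thesis unfolding e .
  qed
qed

lemma power2_le_exp:
  fixes k r :: real
  assumes "k > 0" "r \<ge> 0"
  shows "r\<^sup>2 \<le> 2 / k\<^sup>2 * exp (k * r)"
proof -
  have "(k * r)\<^sup>2 / 2 \<le> exp (k * r)"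
    using exp_lower_Taylor_quadratic[of "k * r"] mult_nonneg_nonneg[of k r] assms by linarith
  then show ?thesis using assms by (simp add: field_simps power_mult_distrib)
qed

lemma norm_chord_le:
  fixes x y :: "'a::real_normed_vector"
  assumes "0 \<le> t" "t \<le> 1"
  shows "(norm (y + t *\<^sub>R (x - y)))\<^sup>2 \<le> (norm x)\<^sup>2 + (norm y)\<^sup>2"
proof -
  have "norm (y + t *\<^sub>R (x - y)) = norm ((1 - t) *\<^sub>R y + t *\<^sub>R x)"
    by (simp add: algebra_simps)
  also have "\<dots> \<le> (1 - t) * norm y + t * norm x"
    using assms norm_triangle_ineq[of "(1 - t) *\<^sub>R y" "t *\<^sub>R x"] by simp
  also have "\<dots> \<le> (1 - t) * max (norm x) (norm y) + t * max (norm x) (norm y)"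
    using assms by (intro add_mono mult_left_mono) auto
  also have "\<dots> = max (norm x) (norm y)" by (simp add: algebra_simps)
  finally have "(norm (y + t *\<^sub>R (x - y)))\<^sup>2 \<le> (max (norm x) (norm y))\<^sup>2"
    by (rule power_mono) simp
  also have "\<dots> \<le> (norm x)\<^sup>2 + (norm y)\<^sup>2" by (auto simp: max_def)
  finally show ?thesis .
qed

lemma AE_lborel_exists:
  assumes "AE x in (lborel :: 'a::euclidean_space measure). P x"
  shows "\<exists>x. P x"
proof (rule ccontr)
  assume "\<nexists>x. P x"
  then have "AE x in (lborel :: 'a measure). False" using assms by auto
  then have "emeasure (lborel :: 'a measure) (space lborel) = 0"
    using ae_filter_eq_bot_iff[of "lborel :: 'a measure"] trivial_limit_def by blast
  then show False by simp
qed

lemma AE_lborel_shift: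
  assumes "AE x in (lborel :: 'a::euclidean_space measure). P x" and [measurable]: "Measurable.pred borel P"
  shows "AE x in lborel. P (x + c)"
proof -
  have "AE x in distr lborel borel ((+) c). P x" unfolding lborel_distr_plus by (rule assms)
  then show ?thesis by (subst (asm) AE_distr_iff) (auto simp: add.commute)
qed

text \<open>The chord bound is averaged over both end points and over \<open>t\<close>; for each
  \<open>t\<close> the point on the chord is then distributed with a density bounded independently
  of \<open>t\<close>.\<close>

lemma nn_integral_chord_square_finite:
  fixes u :: "real ^ 'n \<Rightarrow> real ^ 'n"
  assumes d: "\<And>x. u differentiable (at x)"
    and fin: "(\<integral>\<^sup>+x. ennreal (exp (- (1/2) * (norm x)\<^sup>2) * (norm (sym_grad u x))\<^sup>2) \<partial>lborel) < \<infinity>"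
    and a: "a > 1 / 2"
  shows "(\<integral>\<^sup>+y. (\<integral>\<^sup>+x. ennreal (((x - y) \<bullet> (u x - u y))\<^sup>2 * exp (- a * (norm x)\<^sup>2) * exp (- a * (norm y)\<^sup>2)) \<partial>lborel) \<partial>lborel) < \<infinity>"
proof -
  note [measurable] = borel_measurable_norm_sym_grad[OF d] differentiable_imp_measurable[OF d]
  \<comment> \<open>The exponent \<open>a\<close> is split as \<open>1 / 2 + k + k\<close>. The part
    \<open>1 / 2\<close> passes to the point on the chord, whose squared norm is at most the sum of
    those of the end points; one \<open>k\<close> absorbs the fourth power of the length, the other
    keeps the double integral finite.\<close>
  define k where "k = (a - 1 / 2) / 2"
  have k: "k > 0" using a by (simp add: k_def)
  have a_eq: "a = 1 / 2 + k + k" by (simp add: k_def field_simps)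
  define F where "F z = exp (- (1/2) * (norm z)\<^sup>2) * (norm (sym_grad u z))\<^sup>2" for z
  have [measurable]: "F \<in> borel_measurable borel" unfolding F_def by measurable
  have F0: "F z \<ge> 0" for z by (simp add: F_def)
  let ?w = "\<lambda>a (x :: real ^ 'n) (y :: real ^ 'n). exp (- a * (norm x)\<^sup>2) * exp (- a * (norm y)\<^sup>2)"
  have pt: "(norm (x - y))^4 * (norm (sym_grad u (y + t *\<^sub>R (x - y))))\<^sup>2 * ?w a x y
      \<le> 8 / k\<^sup>2 * (F (y + t *\<^sub>R (x - y)) * ?w k x y)" if t: "0 \<le> t" "t \<le> 1" for x y t
  proof -
    define r where "r = (norm x)\<^sup>2 + (norm y)\<^sup>2"
    have r0: "r \<ge> 0" by (simp add: r_def)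
    define z where "z = y + t *\<^sub>R (x - y)"
    have w: "?w b x y = exp (- b * r)" for b
      by (simp add: r_def exp_add[symmetric] algebra_simps)
    have "norm (x - y) \<le> norm x + norm y" by (rule norm_triangle_ineq4)
    then have "(norm (x - y))\<^sup>2 \<le> (norm x + norm y)\<^sup>2" by (rule power_mono) simp
    also have "\<dots> \<le> 2 * r"
      using sum_squares_bound[of "norm x" "norm y"] by (simp add: r_def power2_sum)
    finally have "((norm (x - y))\<^sup>2)\<^sup>2 \<le> (2 * r)\<^sup>2" by (rule power_mono) simp
    also have "\<dots> \<le> 8 / k\<^sup>2 * exp (k * r)"
      using power2_le_exp[OF k, of r] by (simp add: r0 power_mult_distrib)
    finally have 1: "(norm (x - y))^4 \<le> 8 / k\<^sup>2 * exp (k * r)" by simp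
    have "exp (- (1/2) * r) \<le> exp (- (1/2) * (norm z)\<^sup>2)"
      using norm_chord_le[OF t, of y x] by (simp add: r_def z_def)
    then have 2: "exp (k * r) * exp (- a * r) \<le> exp (- (1/2) * (norm z)\<^sup>2) * exp (- k * r)"
      unfolding a_eq by (simp add: exp_add[symmetric] algebra_simps)
    have "(norm (x - y))^4 * (norm (sym_grad u z))\<^sup>2 * exp (- a * r)
      \<le> 8 / k\<^sup>2 * exp (k * r) * (norm (sym_grad u z))\<^sup>2 * exp (- a * r)"
      by (intro mult_right_mono 1) auto
    also have "\<dots> = 8 / k\<^sup>2 * (norm (sym_grad u z))\<^sup>2 * (exp (k * r) * exp (- a * r))" by simp
    also have "\<dots> \<le> 8 / k\<^sup>2 * (norm (sym_grad u z))\<^sup>2 * (exp (- (1/2) * (norm z)\<^sup>2) * exp (- k * r))"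
      by (intro mult_left_mono 2) auto
    finally show ?thesis unfolding w by (simp add: F_def z_def mult_ac)
  qed
  define C where "C = ennreal (8 / k\<^sup>2)"
  let ?G = "\<lambda>t x y. indicator {0..1::real} t * (C * (ennreal (F (y + t *\<^sub>R (x - y))) * ennreal (?w k x y)))"
  have "(\<integral>\<^sup>+y. (\<integral>\<^sup>+x. ennreal (((x - y) \<bullet> (u x - u y))\<^sup>2 * exp (- a * (norm x)\<^sup>2) * exp (- a * (norm y)\<^sup>2)) \<partial>lborel) \<partial>lborel)
    \<le> (\<integral>\<^sup>+y. (\<integral>\<^sup>+x. (\<integral>\<^sup>+t. ?G t x y \<partial>lborel) \<partial>lborel) \<partial>lborel)"
  proof (intro nn_integral_mono)
    fix y x :: "real ^ 'n"
    have "ennreal (((x - y) \<bullet> (u x - u y))\<^sup>2 * exp (- a * (norm x)\<^sup>2) * exp (- a * (norm y)\<^sup>2))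
      = ennreal (((x - y) \<bullet> (u x - u y))\<^sup>2) * ennreal (?w a x y)"
      by (simp add: ennreal_mult[symmetric] mult.assoc)
    also have "\<dots> \<le> (\<integral>\<^sup>+t. indicator {0..1} t * ennreal ((norm (x - y))^4 * (norm (sym_grad u (y + t *\<^sub>R (x - y))))\<^sup>2) \<partial>lborel) * ennreal (?w a x y)"
      by (intro mult_right_mono chord_bound d) simp
    also have "\<dots> = (\<integral>\<^sup>+t. indicator {0..1} t * ennreal ((norm (x - y))^4 * (norm (sym_grad u (y + t *\<^sub>R (x - y))))\<^sup>2) * ennreal (?w a x y) \<partial>lborel)"
      by (rule nn_integral_multc[symmetric]) measurable
    also have "\<dots> \<le> (\<integral>\<^sup>+t. ?G t x y \<partial>lborel)"
    proof (intro nn_integral_mono)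
      fix t :: real
      show "indicator {0..1} t * ennreal ((norm (x - y))^4 * (norm (sym_grad u (y + t *\<^sub>R (x - y))))\<^sup>2) * ennreal (?w a x y) \<le> ?G t x y"
        using pt[of t x y] F0 by (auto simp: indicator_def C_def ennreal_mult[symmetric] intro!: ennreal_leI)
    qed
    finally show "ennreal (((x - y) \<bullet> (u x - u y))\<^sup>2 * exp (- a * (norm x)\<^sup>2) * exp (- a * (norm y)\<^sup>2)) \<le> (\<integral>\<^sup>+t. ?G t x y \<partial>lborel)" .
  qed
  also have "\<dots> = (\<integral>\<^sup>+y. (\<integral>\<^sup>+t. (\<integral>\<^sup>+x. ?G t x y \<partial>lborel) \<partial>lborel) \<partial>lborel)"
    by (intro nn_integral_cong lborel_pair.Fubini') measurable
  also have "\<dots> = (\<integral>\<^sup>+t. (\<integral>\<^sup>+y. (\<integral>\<^sup>+x. ?G t x y \<partial>lborel) \<partial>lborel) \<partial>lborel)"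
    by (rule lborel_pair.Fubini') measurable
  also have "\<dots> = (\<integral>\<^sup>+t. (\<integral>\<^sup>+x. (\<integral>\<^sup>+y. ?G t x y \<partial>lborel) \<partial>lborel) \<partial>lborel)"
    by (intro nn_integral_cong lborel_pair.Fubini') measurable
  also have "\<dots> = (\<integral>\<^sup>+t. indicator {0..1::real} t * (C * (\<integral>\<^sup>+x. (\<integral>\<^sup>+y. ennreal (F (y + t *\<^sub>R (x - y))) * ennreal (?w k x y) \<partial>lborel) \<partial>lborel)) \<partial>lborel)"
    by (simp add: nn_integral_cmult)
  also have "\<dots> \<le> (\<integral>\<^sup>+t. indicator {0..1::real} t * (C * (ennreal (sqrt (pi / k) ^ DIM(real ^ 'n) * 2 ^ DIM(real ^ 'n)) * (\<integral>\<^sup>+x. ennreal (F x) \<partial>lborel))) \<partial>lborel)"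
  proof (intro nn_integral_mono)
    fix t :: real
    show "indicator {0..1::real} t * (C * (\<integral>\<^sup>+x. (\<integral>\<^sup>+y. ennreal (F (y + t *\<^sub>R (x - y))) * ennreal (?w k x y) \<partial>lborel) \<partial>lborel))
      \<le> indicator {0..1::real} t * (C * (ennreal (sqrt (pi / k) ^ DIM(real ^ 'n) * 2 ^ DIM(real ^ 'n)) * (\<integral>\<^sup>+x. ennreal (F x) \<partial>lborel)))"
    proof (cases "t \<in> {0..1}")
      case True
      then show ?thesis
        using nn_integral_chord_average[of "\<lambda>x. ennreal (F x)" k t] k
        by (auto intro!: mult_left_mono)
    qed simp
  qed
  also have "\<dots> = C * (ennreal (sqrt (pi / k) ^ DIM(real ^ 'n) * 2 ^ DIM(real ^ 'n)) * (\<integral>\<^sup>+x. ennreal (F x) \<partial>lborel))"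
    by (simp add: nn_integral_multc)
  also have "\<dots> < \<infinity>"
    using fin by (simp add: C_def F_def ennreal_mult_less_top)
  finally show ?thesis .
qed

lemma ennreal_linear3:
  assumes "a \<ge> 0" "b \<ge> 0" "c \<ge> 0" "p \<ge> 0" "q \<ge> 0" "r \<ge> 0"
  shows "ennreal (a * p + b * q + c * r) = (ennreal a * ennreal p + ennreal b * ennreal q) + ennreal c * ennreal r"
  using assms by (simp add: ennreal_mult)

text \<open>By Fubini almost every base point is good. Translates of null sets are null, so a single
  \<open>y\<close> can be good together with all its neighbours \<open>y + axis i 1\<close>.\<close>

lemma exists_chord_square_finite:
  fixes u :: "real ^ 'n \<Rightarrow> real ^ 'n"
  assumes d: "\<And>x. u differentiable (at x)"
    and fin: "(\<integral>\<^sup>+x. ennreal (exp (- (1/2) * (norm x)\<^sup>2) * (norm (sym_grad u x))\<^sup>2) \<partial>lborel) < \<infinity>"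
    and a: "a > 1 / 2"
  shows "\<exists>y. \<forall>h \<in> insert 0 (range (\<lambda>i. axis i 1)).
    (\<integral>\<^sup>+x. ennreal (((x - (y + h)) \<bullet> (u x - u (y + h)))\<^sup>2 * exp (- a * (norm x)\<^sup>2)) \<partial>lborel) < \<infinity>"
proof -
  note [measurable] = differentiable_imp_measurable[OF d]
  define I where "I y = (\<integral>\<^sup>+x. ennreal (((x - y) \<bullet> (u x - u y))\<^sup>2 * exp (- a * (norm x)\<^sup>2)) \<partial>lborel)" for y
  have [measurable]: "I \<in> borel_measurable borel" unfolding I_def by measurable
  have "(\<integral>\<^sup>+x. ennreal (((x - y) \<bullet> (u x - u y))\<^sup>2 * exp (- a * (norm x)\<^sup>2) * exp (- a * (norm y)\<^sup>2)) \<partial>lborel)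
     = I y * ennreal (exp (- a * (norm y)\<^sup>2))" for y
    unfolding I_def by (subst nn_integral_multc[symmetric]) (auto simp: ennreal_mult)
  then have "(\<integral>\<^sup>+y. I y * ennreal (exp (- a * (norm y)\<^sup>2)) \<partial>lborel) < \<infinity>"
    using nn_integral_chord_square_finite[OF d fin a] by simp
  then have "AE y in lborel. I y * ennreal (exp (- a * (norm y)\<^sup>2)) \<noteq> \<infinity>"
    by (intro nn_integral_noteq_infinite) auto
  then have AE: "AE y in lborel. I y < \<infinity>"
    by eventually_elim (auto simp: ennreal_mult_eq_top_iff less_top)
  have "finite (insert 0 (range (\<lambda>i :: 'n. axis i (1::real))))" by simp
  then have "AE y in lborel. \<forall>h \<in> insert 0 (range (\<lambda>i. axis i 1)). I (y + h) < \<infinity>"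
    using AE_lborel_shift[OF AE] by (subst AE_finite_all) auto
  then show ?thesis unfolding I_def by (rule AE_lborel_exists)
qed

lemma nn_integral_square_finite:
  fixes u :: "real ^ 'n \<Rightarrow> real ^ 'n"
  assumes d: "\<And>x. u differentiable (at x)"
    and fin: "(\<integral>\<^sup>+x. ennreal (exp (- (1/2) * (norm x)\<^sup>2) * (norm (sym_grad u x))\<^sup>2) \<partial>lborel) < \<infinity>"
    and a: "a > 1 / 2"
  shows "(\<integral>\<^sup>+x. ennreal ((u x $ i)\<^sup>2 * exp (- a * (norm x)\<^sup>2)) \<partial>lborel) < \<infinity>"
proof -
  note [measurable] = differentiable_imp_measurable[OF d]
  define R where "R y x = (x - y) \<bullet> (u x - u y)" for x y
  define w :: "real ^ 'n \<Rightarrow> real" where "w x = exp (- a * (norm x)\<^sup>2)" for x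
  have [measurable]: "R y \<in> borel_measurable borel" for y unfolding R_def[abs_def] by measurable
  have [measurable]: "w \<in> borel_measurable borel" unfolding w_def[abs_def] by measurable
  have w0: "w x \<ge> 0" for x by (simp add: w_def)
  define e :: "real ^ 'n" where "e = axis i 1"
  from exists_chord_square_finite[OF d fin a] obtain y where
    y: "(\<integral>\<^sup>+x. ennreal ((R y x)\<^sup>2 * w x) \<partial>lborel) < \<infinity>" and
    ye: "(\<integral>\<^sup>+x. ennreal ((R (y + e) x)\<^sup>2 * w x) \<partial>lborel) < \<infinity>"
    unfolding R_def w_def e_def by auto
  define A where "A = norm (y \<bullet> u y) + norm ((y + e) \<bullet> u (y + e))"
  define B where "B = norm (u y) + norm (u (y + e))"
  define L where "L x = (x - y) \<bullet> u y - (x - (y + e)) \<bullet> u (y + e)" for x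
  have [measurable]: "L \<in> borel_measurable borel" unfolding L_def[abs_def] by measurable
  \<comment> \<open>The term \<open>x \<bullet> u x\<close> occurs in both chord products and
    cancels; what is left is \<open>e \<bullet> u x\<close> and the affine function
    \<open>L\<close>.\<close>
  have ui: "u x $ i = R y x - R (y + e) x + L x" for x
    by (simp add: R_def L_def e_def inner_diff_left inner_diff_right inner_add_left inner_axis' algebra_simps)
  have L: "\<bar>L x\<bar> \<le> A + B * norm x" for x
  proof -
    have "L x = x \<bullet> u y - x \<bullet> u (y + e) - y \<bullet> u y + (y + e) \<bullet> u (y + e)"
      by (simp add: L_def inner_diff_left)
    moreover have "\<bar>x \<bullet> u y\<bar> \<le> norm x * norm (u y)" "\<bar>x \<bullet> u (y + e)\<bar> \<le> norm x * norm (u (y + e))"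
      by (rule Cauchy_Schwarz_ineq2)+
    ultimately show ?thesis unfolding A_def B_def by (simp add: algebra_simps)
  qed
  have L2: "(L x)\<^sup>2 \<le> 2 * A\<^sup>2 + 2 * B\<^sup>2 * (norm x)\<^sup>2" for x
  proof -
    have "\<bar>L x\<bar>\<^sup>2 \<le> (A + B * norm x)\<^sup>2" by (rule power_mono[OF L]) simp
    then show ?thesis
      using sum_squares_bound[of A "B * norm x"] by (simp add: power2_sum power_mult_distrib)
  qed
  have Lw: "(L x)\<^sup>2 * w x \<le> (2 * A\<^sup>2 + 4 * B\<^sup>2 / a) * exp (- (a/2) * (norm x)\<^sup>2)" for x
  proof -
    define r where "r = (norm x)\<^sup>2"
    have r: "r \<ge> 0" by (simp add: r_def)
    have "a / 2 * r \<le> exp (a / 2 * r)" using exp_ge_add_one_self[of "a / 2 * r"] by linarith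
    then have e1: "r \<le> 2 / a * exp (a / 2 * r)" using a by (simp add: field_simps)
    have e2: "1 \<le> exp (a / 2 * r)" using a r by simp
    have "(L x)\<^sup>2 \<le> 2 * A\<^sup>2 * 1 + 2 * B\<^sup>2 * r" using L2 by (simp add: r_def)
    also have "\<dots> \<le> 2 * A\<^sup>2 * exp (a / 2 * r) + 2 * B\<^sup>2 * (2 / a * exp (a / 2 * r))"
      by (intro add_mono mult_left_mono e1 e2) auto
    also have "\<dots> = (2 * A\<^sup>2 + 4 * B\<^sup>2 / a) * exp (a / 2 * r)" by (simp add: algebra_simps)
    finally have "(L x)\<^sup>2 * w x \<le> (2 * A\<^sup>2 + 4 * B\<^sup>2 / a) * exp (a / 2 * r) * w x"
      by (rule mult_right_mono) (rule w0)
    also have "\<dots> = (2 * A\<^sup>2 + 4 * B\<^sup>2 / a) * exp (- (a/2) * r)"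
      unfolding w_def r_def[symmetric] by (simp add: exp_add[symmetric] mult.assoc)
    finally show ?thesis by (simp add: r_def)
  qed
  have "(u x $ i)\<^sup>2 * w x \<le> 3 * ((R y x)\<^sup>2 * w x) + 3 * ((R (y + e) x)\<^sup>2 * w x)
      + 3 * (2 * A\<^sup>2 + 4 * B\<^sup>2 / a) * exp (- (a/2) * (norm x)\<^sup>2)" for x
  proof -
    have "(p - q + s)\<^sup>2 \<le> 3 * p\<^sup>2 + 3 * q\<^sup>2 + 3 * s\<^sup>2" for p q s :: real
    proof -
      have "0 \<le> (p + q)\<^sup>2 + (q + s)\<^sup>2 + (p - s)\<^sup>2" by simp
      then show ?thesis by (simp add: power2_eq_square algebra_simps)
    qed
    then have "(u x $ i)\<^sup>2 * w x \<le> (3 * (R y x)\<^sup>2 + 3 * (R (y + e) x)\<^sup>2 + 3 * (L x)\<^sup>2) * w x"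
      unfolding ui by (intro mult_right_mono w0)
    then show ?thesis using Lw[of x] by (simp add: algebra_simps)
  qed
  note pt = this
  have "(\<integral>\<^sup>+x. ennreal ((u x $ i)\<^sup>2 * w x) \<partial>lborel) \<le>
    (\<integral>\<^sup>+x. (ennreal 3 * ennreal ((R y x)\<^sup>2 * w x) + ennreal 3 * ennreal ((R (y + e) x)\<^sup>2 * w x)) +
      ennreal (3 * (2 * A\<^sup>2 + 4 * B\<^sup>2 / a)) * ennreal (exp (- (a/2) * (norm x)\<^sup>2)) \<partial>lborel)"
  proof (intro nn_integral_mono)
    fix x
    have "ennreal ((u x $ i)\<^sup>2 * w x) \<le> ennreal (3 * ((R y x)\<^sup>2 * w x) + 3 * ((R (y + e) x)\<^sup>2 * w x)
      + 3 * (2 * A\<^sup>2 + 4 * B\<^sup>2 / a) * exp (- (a/2) * (norm x)\<^sup>2))"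
      by (rule ennreal_leI[OF pt])
    also have "\<dots> = (ennreal 3 * ennreal ((R y x)\<^sup>2 * w x) + ennreal 3 * ennreal ((R (y + e) x)\<^sup>2 * w x)) +
      ennreal (3 * (2 * A\<^sup>2 + 4 * B\<^sup>2 / a)) * ennreal (exp (- (a/2) * (norm x)\<^sup>2))"
      by (rule ennreal_linear3) (use a w0 in \<open>auto intro!: add_nonneg_nonneg mult_nonneg_nonneg\<close>)
    finally show "ennreal ((u x $ i)\<^sup>2 * w x) \<le> (ennreal 3 * ennreal ((R y x)\<^sup>2 * w x) + ennreal 3 * ennreal ((R (y + e) x)\<^sup>2 * w x)) +
      ennreal (3 * (2 * A\<^sup>2 + 4 * B\<^sup>2 / a)) * ennreal (exp (- (a/2) * (norm x)\<^sup>2))" .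
  qed
  also have "\<dots> = ennreal 3 * (\<integral>\<^sup>+x. ennreal ((R y x)\<^sup>2 * w x) \<partial>lborel)
      + ennreal 3 * (\<integral>\<^sup>+x. ennreal ((R (y + e) x)\<^sup>2 * w x) \<partial>lborel)
      + ennreal (3 * (2 * A\<^sup>2 + 4 * B\<^sup>2 / a)) * (\<integral>\<^sup>+x. ennreal (exp (- (a/2) * (norm x)\<^sup>2)) \<partial>(lborel :: (real ^ 'n) measure))"
    by (simp add: nn_integral_add nn_integral_cmult)
  also have "\<dots> < \<infinity>"
    using y ye a nn_integral_gauss[of "a / 2", where 'a="real ^ 'n"] by (simp add: ennreal_mult_less_top)
  finally show ?thesis by (simp add: w_def)
qed

section \<open>Polynomials in Gaussian space\<close>

abbreviation rpoly :: "(real ^ 'n \<Rightarrow> real) \<Rightarrow> bool" where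
  "rpoly \<equiv> real_polynomial_function"

definition pd :: "'n \<Rightarrow> (real ^ 'n \<Rightarrow> real) \<Rightarrow> real ^ 'n \<Rightarrow> real" where
  "pd k p x = frechet_derivative p (at x) (axis k 1)"

text \<open>The operator \<delta>_k of the overview, known as the creation operator;
  \<open>pd k\<close> is the corresponding annihilation operator.\<close>

definition adj_pd :: "'n \<Rightarrow> (real ^ 'n \<Rightarrow> real) \<Rightarrow> real ^ 'n \<Rightarrow> real" where
  "adj_pd k p x = x $ k * p x - pd k p x"

lemma rpoly_differentiable: "rpoly p \<Longrightarrow> p differentiable (at x)"
proof (induction rule: real_polynomial_function.induct)
  case (linear f)
  then show ?case by (intro bounded_linear_imp_differentiable)
qed auto

lemma rpoly_component: "rpoly (\<lambda>x. x $ k)"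
  by (intro real_polynomial_function.intros(1) bounded_linear_vec_nth)

lemma pd_eqI: "(p has_derivative p') (at x) \<Longrightarrow> pd k p x = p' (axis k 1)"
  unfolding pd_def by (metis frechet_derivative_at)

lemma has_derivative_frechet:
  "rpoly p \<Longrightarrow> (p has_derivative frechet_derivative p (at x)) (at x)"
  using rpoly_differentiable frechet_derivative_works by blast

lemma pd_linear: "bounded_linear f \<Longrightarrow> pd k f = (\<lambda>x. f (axis k 1))"
  by (rule ext) (auto intro!: pd_eqI bounded_linear_imp_has_derivative)

lemma pd_const: "pd k (\<lambda>x. c) = (\<lambda>x. 0)"
  by (rule ext, rule pd_eqI[where p'="\<lambda>_. 0"]) simp

lemma pd_component: "pd k (\<lambda>x. x $ l) = (\<lambda>x. if k = l then 1 else 0)"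
  by (subst pd_linear) (auto simp: bounded_linear_vec_nth axis_def)

lemma pd_add:
  assumes "rpoly f" "rpoly g"
  shows "pd k (\<lambda>x. f x + g x) = (\<lambda>x. pd k f x + pd k g x)"
proof
  fix x
  show "pd k (\<lambda>x. f x + g x) x = pd k f x + pd k g x"
    by (subst pd_eqI[OF has_derivative_add[OF assms[THEN has_derivative_frechet]]]) (simp add: pd_def)
qed

lemma pd_mult:
  assumes "rpoly f" "rpoly g"
  shows "pd k (\<lambda>x. f x * g x) = (\<lambda>x. f x * pd k g x + pd k f x * g x)"
proof
  fix x
  show "pd k (\<lambda>x. f x * g x) x = f x * pd k g x + pd k f x * g x"
    by (subst pd_eqI[OF has_derivative_mult[OF assms[THEN has_derivative_frechet]]]) (simp add: pd_def)
qed

lemma pd_cmult: "rpoly f \<Longrightarrow> pd k (\<lambda>x. c * f x) = (\<lambda>x. c * pd k f x)"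
  by (subst pd_mult) (auto simp: pd_const)

lemma pd_diff: "rpoly f \<Longrightarrow> rpoly g \<Longrightarrow> pd k (\<lambda>x. f x - g x) = (\<lambda>x. pd k f x - pd k g x)"
  using pd_add[of f "\<lambda>x. (-1) * g x" k] by (simp add: pd_cmult[of g k "-1", simplified] real_polynomial_function_minus)

lemma rpoly_pd: "rpoly p \<Longrightarrow> rpoly (pd k p)"
  by (induction rule: real_polynomial_function.induct) (auto simp: pd_linear pd_const pd_add pd_mult)

lemma rpoly_adj_pd: "rpoly p \<Longrightarrow> rpoly (adj_pd k p)"
  unfolding adj_pd_def[abs_def]
  by (intro real_polynomial_function_diff real_polynomial_function.intros(4) rpoly_component rpoly_pd)

text \<open>Induction over the construction of polynomials gives the symmetry of mixed derivatives
  purely algebraically.\<close>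

lemma pd_pd: "rpoly p \<Longrightarrow> pd k (pd l p) = pd l (pd k p)"
proof (induction rule: real_polynomial_function.induct)
  case (mult f g)
  then show ?case
    by (simp add: pd_mult pd_add rpoly_pd real_polynomial_function.intros algebra_simps)
qed (auto simp: pd_linear pd_const pd_add rpoly_pd)

lemma pd_sum:
  assumes "finite I" "\<And>i. i \<in> I \<Longrightarrow> rpoly (f i)"
  shows "pd k (\<lambda>x. \<Sum>i\<in>I. f i x) = (\<lambda>x. \<Sum>i\<in>I. pd k (f i) x)"
  using assms
  by (induction rule: finite_induct) (auto simp: pd_const pd_add real_polynomial_function_sum)

lemma adj_pd_add:
  "rpoly f \<Longrightarrow> rpoly g \<Longrightarrow> adj_pd k (\<lambda>x. f x + g x) = (\<lambda>x. adj_pd k f x + adj_pd k g x)"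
  by (auto simp: adj_pd_def pd_add fun_eq_iff algebra_simps)

lemma adj_pd_cmult: "rpoly f \<Longrightarrow> adj_pd k (\<lambda>x. c * f x) = (\<lambda>x. c * adj_pd k f x)"
  by (auto simp: adj_pd_def pd_cmult fun_eq_iff algebra_simps)

lemma adj_pd_zero: "adj_pd k (\<lambda>x. 0) = (\<lambda>x. 0)"
  by (auto simp: adj_pd_def pd_const)

lemma adj_pd_sum:
  assumes "finite I" "\<And>i. i \<in> I \<Longrightarrow> rpoly (f i)"
  shows "adj_pd k (\<lambda>x. \<Sum>i\<in>I. f i x) = (\<lambda>x. \<Sum>i\<in>I. adj_pd k (f i) x)"
  using assms by (auto simp: adj_pd_def pd_sum sum_subtractf sum_distrib_left)

lemma pd_adj_pd:
  assumes "rpoly p"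
  shows "pd l (adj_pd k p) = (\<lambda>x. adj_pd k (pd l p) x + (if k = l then p x else 0))"
proof -
  have "pd l (adj_pd k p) = (\<lambda>x. (x $ k * pd l p x + (if l = k then 1 else 0) * p x) - pd l (pd k p) x)"
    unfolding adj_pd_def[abs_def] using assms
    by (simp add: pd_diff pd_mult rpoly_component rpoly_pd real_polynomial_function.intros(4) pd_component)
  then show ?thesis using pd_pd[OF assms, of l k] by (auto simp: adj_pd_def fun_eq_iff)
qed

lemma adj_pd_adj_pd:
  assumes "rpoly p"
  shows "adj_pd l (adj_pd k p) = adj_pd k (adj_pd l p)"
proof
  fix x
  show "adj_pd l (adj_pd k p) x = adj_pd k (adj_pd l p) x"
    using pd_pd[OF assms, of l k] pd_adj_pd[OF assms, of l k] pd_adj_pd[OF assms, of k l]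
    by (simp add: adj_pd_def[of _ "adj_pd _ _"]) (simp add: adj_pd_def algebra_simps)
qed

lemma rpoly_growth: "rpoly (p :: real ^ 'n \<Rightarrow> real) \<Longrightarrow> \<exists>C c. 0 \<le> c \<and> (\<forall>x. \<bar>p x\<bar> \<le> C * exp (c * norm x))"
proof (induction rule: real_polynomial_function.induct)
  case (linear f)
  obtain K where K: "K > 0" "\<And>x. norm (f x) \<le> norm x * K" using bounded_linear.pos_bounded[OF linear] by auto
  have "\<bar>f x\<bar> \<le> K * exp (1 * norm x)" for x
  proof -
    have "norm x \<le> exp (norm x)" using exp_ge_add_one_self[of "norm x"] by linarith
    then have "norm x * K \<le> exp (norm x) * K" using K by (intro mult_right_mono) auto
    then show ?thesis using K(2)[of x] by (simp add: mult.commute)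
  qed
  then show ?case by (intro exI[of _ K] exI[of _ 1]) auto
next
  case (const c)
  show ?case by (intro exI[of _ "\<bar>c\<bar>"] exI[of _ 0]) auto
next
  case (add f g)
  then obtain C c D d where "0 \<le> c" "0 \<le> d" and f: "\<And>x. \<bar>f x\<bar> \<le> C * exp (c * norm x)"
    and g: "\<And>x. \<bar>g x\<bar> \<le> D * exp (d * norm x)" by blast
  have CD: "C \<ge> 0" "D \<ge> 0" using f[of 0] g[of 0] by auto
  have "\<bar>f x + g x\<bar> \<le> (C + D) * exp ((c + d) * norm x)" for x
  proof -
    have "C * exp (c * norm x) \<le> C * exp ((c + d) * norm x)" "D * exp (d * norm x) \<le> D * exp ((c + d) * norm x)"
      using CD \<open>0 \<le> c\<close> \<open>0 \<le> d\<close> by (auto intro!: mult_left_mono simp: algebra_simps)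
    then show ?thesis using f[of x] g[of x] by (simp add: algebra_simps)
  qed
  then show ?case using \<open>0 \<le> c\<close> \<open>0 \<le> d\<close> by (intro exI[of _ "C + D"] exI[of _ "c + d"]) auto
next
  case (mult f g)
  then obtain C c D d where "0 \<le> c" "0 \<le> d" and f: "\<And>x. \<bar>f x\<bar> \<le> C * exp (c * norm x)"
    and g: "\<And>x. \<bar>g x\<bar> \<le> D * exp (d * norm x)" by blast
  have CD: "C \<ge> 0" "D \<ge> 0" using f[of 0] g[of 0] by auto
  have "\<bar>f x * g x\<bar> \<le> (C * D) * exp ((c + d) * norm x)" for x
  proof -
    have "\<bar>f x * g x\<bar> \<le> (C * exp (c * norm x)) * (D * exp (d * norm x))"
      unfolding abs_mult using CD by (intro mult_mono f g) auto
    then show ?thesis by (simp add: exp_add algebra_simps)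
  qed
  then show ?case using \<open>0 \<le> c\<close> \<open>0 \<le> d\<close> by (intro exI[of _ "C * D"] exI[of _ "c + d"]) auto
qed

lemma rpoly_continuous: "rpoly p \<Longrightarrow> continuous_on UNIV p"
  by (simp add: continuous_on_eq_continuous_at differentiable_imp_continuous_within rpoly_differentiable)

lemma rpoly_measurable: "rpoly p \<Longrightarrow> p \<in> borel_measurable borel"
  by (intro borel_measurable_continuous_onI rpoly_continuous)

lemma rpoly_integrable: "rpoly p \<Longrightarrow> integrable std_gaussian p"
  using rpoly_growth integrable_std_gaussian_exp_bound rpoly_measurable by metis

section \<open>Square-integrable functions and finite orthogonal projections\<close>

definition L2g :: "(real ^ 'n \<Rightarrow> real) \<Rightarrow> bool" where
  "L2g f \<longleftrightarrow> f \<in> borel_measurable borel \<and> integrable std_gaussian (\<lambda>x. (f x)\<^sup>2)"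

definition ginner :: "(real ^ 'n \<Rightarrow> real) \<Rightarrow> (real ^ 'n \<Rightarrow> real) \<Rightarrow> real" where
  "ginner f g = (LINT x|std_gaussian. f x * g x)"

abbreviation gnormsq :: "(real ^ 'n \<Rightarrow> real) \<Rightarrow> real" where
  "gnormsq f \<equiv> ginner f f"

lemma L2g_rpoly: "rpoly p \<Longrightarrow> L2g p"
  unfolding L2g_def power2_eq_square by (intro conjI rpoly_measurable rpoly_integrable) auto

lemma L2g_mult_integrable:
  assumes "L2g f" "L2g g"
  shows "integrable std_gaussian (\<lambda>x. f x * g x)"
proof (rule Bochner_Integration.integrable_bound)
  show "integrable std_gaussian (\<lambda>x. (f x)\<^sup>2 + (g x)\<^sup>2)"
    using assms by (simp add: L2g_def)
  show "(\<lambda>x. f x * g x) \<in> borel_measurable std_gaussian"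
    using assms by (auto simp: L2g_def measurable_cong_sets[OF sets_std_gaussian refl])
  have "\<bar>f x * g x\<bar> \<le> (f x)\<^sup>2 + (g x)\<^sup>2" for x
    using sum_squares_bound[of "\<bar>f x\<bar>" "\<bar>g x\<bar>"] mult_nonneg_nonneg[of "\<bar>f x\<bar>" "\<bar>g x\<bar>"]
    unfolding abs_mult power2_abs by linarith
  then show "AE x in std_gaussian. norm (f x * g x) \<le> norm ((f x)\<^sup>2 + (g x)\<^sup>2)"
    by auto
qed

lemma L2g_add: "L2g f \<Longrightarrow> L2g g \<Longrightarrow> L2g (\<lambda>x. f x + g x)"
  using L2g_mult_integrable[of f g] by (auto simp: L2g_def power2_sum mult.assoc)

lemma L2g_cmult: "L2g f \<Longrightarrow> L2g (\<lambda>x. c * f x)"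
  by (auto simp: L2g_def power_mult_distrib)

lemma L2g_diff: "L2g f \<Longrightarrow> L2g g \<Longrightarrow> L2g (\<lambda>x. f x - g x)"
  using L2g_add[of f "\<lambda>x. (-1) * g x"] L2g_cmult[of g "-1"] by simp

lemma L2g_const: "L2g (\<lambda>x. c)"
  by (auto simp: L2g_def)

lemma L2g_sum: "(\<And>i. i \<in> I \<Longrightarrow> L2g (f i)) \<Longrightarrow> L2g (\<lambda>x. \<Sum>i\<in>I. f i x)"
  by (induction I rule: infinite_finite_induct) (auto intro: L2g_add L2g_const)

lemma L2g_integrable: "L2g f \<Longrightarrow> integrable std_gaussian f"
  using L2g_mult_integrable[OF _ L2g_const[of 1]] by simp

lemma ginner_commute: "ginner f g = ginner g f"
  by (simp add: ginner_def mult.commute)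

lemma ginner_nonneg: "0 \<le> ginner f f"
  unfolding ginner_def by (rule integral_nonneg_AE) auto

lemma ginner_add_left: "L2g f \<Longrightarrow> L2g g \<Longrightarrow> L2g h \<Longrightarrow> ginner (\<lambda>x. f x + g x) h = ginner f h + ginner g h"
  by (simp add: ginner_def distrib_right L2g_mult_integrable)

lemma ginner_diff_left: "L2g f \<Longrightarrow> L2g g \<Longrightarrow> L2g h \<Longrightarrow> ginner (\<lambda>x. f x - g x) h = ginner f h - ginner g h"
  by (simp add: ginner_def left_diff_distrib L2g_mult_integrable)

lemma ginner_cmult_left: "ginner (\<lambda>x. c * f x) h = c * ginner f h"
  by (simp add: ginner_def mult.assoc)

lemma ginner_zero_left: "ginner (\<lambda>x. 0) h = 0"
  by (simp add: ginner_def)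

lemma ginner_sum_left:
  "(\<And>i. i \<in> I \<Longrightarrow> L2g (f i)) \<Longrightarrow> L2g h \<Longrightarrow> ginner (\<lambda>x. \<Sum>i\<in>I. f i x) h = (\<Sum>i\<in>I. ginner (f i) h)"
  by (simp add: ginner_def sum_distrib_right L2g_mult_integrable)

lemma ginner_add_right: "L2g f \<Longrightarrow> L2g g \<Longrightarrow> L2g h \<Longrightarrow> ginner h (\<lambda>x. f x + g x) = ginner h f + ginner h g"
  using ginner_add_left[of f g h] by (simp add: ginner_commute)

lemma ginner_diff_right: "L2g f \<Longrightarrow> L2g g \<Longrightarrow> L2g h \<Longrightarrow> ginner h (\<lambda>x. f x - g x) = ginner h f - ginner h g"
  using ginner_diff_left[of f g h] by (simp add: ginner_commute)

lemma ginner_cmult_right: "ginner h (\<lambda>x. c * f x) = c * ginner h f"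
  using ginner_cmult_left[of c f h] by (simp add: ginner_commute)

lemma ginner_sum_right:
  "(\<And>i. i \<in> I \<Longrightarrow> L2g (f i)) \<Longrightarrow> L2g h \<Longrightarrow> ginner h (\<lambda>x. \<Sum>i\<in>I. f i x) = (\<Sum>i\<in>I. ginner h (f i))"
  using ginner_sum_left[of I f h] by (simp add: ginner_commute)

lemma ginner_add_self:
  "L2g f \<Longrightarrow> L2g g \<Longrightarrow> gnormsq (\<lambda>x. f x + g x) = ginner f f + 2 * ginner f g + ginner g g"
  by (simp add: ginner_add_left ginner_add_right L2g_add ginner_commute[of g f])

lemma ginner_diff_self:
  "L2g f \<Longrightarrow> L2g g \<Longrightarrow> gnormsq (\<lambda>x. f x - g x) = ginner f f - 2 * ginner f g + ginner g g"
  by (simp add: ginner_diff_left ginner_diff_right L2g_diff ginner_commute[of g f])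

text \<open>Functions are not identified almost everywhere, so the form is only semidefinite; this
  is the degenerate case of Cauchy-Schwarz.\<close>

lemma ginner_Cauchy_zero:
  assumes "L2g f" "L2g h" "ginner h h = 0"
  shows "ginner f h = 0"
proof (rule ccontr)
  assume nz: "ginner f h \<noteq> 0"
  \<comment> \<open>This value makes the squared norm of \<open>f - c * h\<close> equal to
    -1.\<close>
  define c where "c = (ginner f f + 1) / (2 * ginner f h)"
  have "0 \<le> gnormsq (\<lambda>x. f x - c * h x)" by (rule ginner_nonneg)
  also have "\<dots> = ginner f f - 2 * c * ginner f h"
    using assms by (simp add: ginner_diff_self L2g_cmult ginner_cmult_left ginner_cmult_right)
  also have "2 * c * ginner f h = ginner f f + 1" using nz by (simp add: c_def)
  finally show False by simp
qed

text \<open>One Gram-Schmidt step per element. The functions \<open>h i\<close> may be linearly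
  dependent, which matters later because the same Hermite polynomial is indexed by several
  words.\<close>

lemma finite_projection_exists:
  assumes "finite I" "\<And>i. i \<in> I \<Longrightarrow> L2g (h i)" "L2g f"
  shows "\<exists>c. \<forall>i\<in>I. ginner (\<lambda>x. f x - (\<Sum>j\<in>I. c j * h j x)) (h i) = 0"
  using assms
proof (induction I arbitrary: f rule: finite_induct)
  case (insert a I)
  obtain c where c: "\<And>i. i \<in> I \<Longrightarrow> ginner (\<lambda>x. f x - (\<Sum>j\<in>I. c j * h j x)) (h i) = 0"
    using insert.IH[of f] insert.prems by auto
  obtain d where d: "\<And>i. i \<in> I \<Longrightarrow> ginner (\<lambda>x. h a x - (\<Sum>j\<in>I. d j * h j x)) (h i) = 0"
    using insert.IH[of "h a"] insert.prems by auto
  define f' where "f' x = f x - (\<Sum>j\<in>I. c j * h j x)" for x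
  define a' where "a' x = h a x - (\<Sum>j\<in>I. d j * h j x)" for x
  have L: "L2g f'" "L2g a'" "L2g (h a)" unfolding f'_def[abs_def] a'_def[abs_def]
    using insert by (auto intro!: L2g_diff L2g_sum L2g_cmult)
  have Lh: "L2g (h i)" if "i \<in> I" for i using insert that by auto
  \<comment> \<open>If \<open>a'\<close> has norm zero, the quotient is 0 by convention, and the
    next relation still holds because \<open>ginner f' a'\<close> vanishes too.\<close>
  define t where "t = ginner f' a' / ginner a' a'"
  have t: "t * ginner a' a' = ginner f' a'"
    using ginner_Cauchy_zero[OF L(1,2)] by (auto simp: t_def)
  define e where "e j = (if j = a then t else c j - t * d j)" for j
  have eq: "f x - (\<Sum>j\<in>insert a I. e j * h j x) = f' x - t * a' x" for x
  proof -
    have "(\<Sum>j\<in>I. e j * h j x) = (\<Sum>j\<in>I. c j * h j x - t * (d j * h j x))"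
      using insert(2) by (intro sum.cong) (auto simp: e_def algebra_simps)
    then show ?thesis using insert(1,2)
      by (simp add: f'_def a'_def sum_subtractf sum_distrib_left e_def algebra_simps)
  qed
  have o: "ginner (\<lambda>x. f' x - t * a' x) (h i) = 0" if "i \<in> I" for i
    using c[OF that] d[OF that] L Lh[OF that]
    by (simp add: ginner_diff_left L2g_cmult ginner_cmult_left f'_def[abs_def, symmetric] a'_def[abs_def, symmetric])
  have ha: "h a = (\<lambda>x. a' x + (\<Sum>j\<in>I. d j * h j x))" by (simp add: a'_def fun_eq_iff)
  have "ginner (\<lambda>x. f' x - t * a' x) (\<lambda>x. a' x + (\<Sum>j\<in>I. d j * h j x))
     = ginner (\<lambda>x. f' x - t * a' x) a' + (\<Sum>j\<in>I. d j * ginner (\<lambda>x. f' x - t * a' x) (h j))"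
    using L Lh by (simp add: ginner_add_right L2g_diff L2g_cmult L2g_sum ginner_sum_right ginner_cmult_right)
  also have "\<dots> = 0"
    using L t by (simp add: o ginner_diff_left L2g_cmult ginner_cmult_left)
  finally have "ginner (\<lambda>x. f' x - t * a' x) (h a) = 0" using ha by simp
  then show ?case using o unfolding eq[symmetric] by (intro exI[of _ e]) auto
qed simp

section \<open>Gaussian integration by parts\<close>

lemma gauss_density_derivative:
  "((\<lambda>s. gauss_density (x + s *\<^sub>R e)) has_real_derivative - (x \<bullet> e) * gauss_density x) (at 0)"
proof -
  have "(norm (x + s *\<^sub>R e))\<^sup>2 = x \<bullet> x + 2 * s * (x \<bullet> e) + s\<^sup>2 * (e \<bullet> e)" for s
    unfolding power2_norm_eq_inner
    by (simp only: inner_add_left inner_add_right inner_scaleR_left inner_scaleR_right inner_commute[of e x])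
       (simp add: algebra_simps power2_eq_square)
  then show ?thesis unfolding gauss_density_def
    by (auto intro!: derivative_eq_intros simp: power2_norm_eq_inner)
qed

text \<open>The derivative is taken along the single direction \<open>e\<close>. This lets the lemma
  apply to \<open>u x \<bullet> e\<close>, whose derivative along \<open>e\<close> is controlled by
  \<open>sym_grad\<close>, while nothing is known about the integrability of the other partial
  derivatives.\<close>

lemma std_gaussian_ibp:
  fixes f f' :: "real ^ 'n \<Rightarrow> real"
  assumes f: "integrable std_gaussian f" and f': "integrable std_gaussian f'"
    and xf: "integrable std_gaussian (\<lambda>x. (x \<bullet> e) * f x)"
    and der: "\<And>x. ((\<lambda>s. f (x + s *\<^sub>R e)) has_real_derivative f' x) (at 0)"
  shows "(LINT x|std_gaussian. f' x) = (LINT x|std_gaussian. (x \<bullet> e) * f x)"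
proof -
  have [measurable]: "f \<in> borel_measurable borel" "f' \<in> borel_measurable borel"
    using f f' by (auto dest!: borel_measurable_integrable simp: measurable_cong_sets[OF sets_std_gaussian refl])
  have i: "integrable lborel (\<lambda>x. gauss_density x * f x)" "integrable lborel (\<lambda>x. gauss_density x * f' x)"
    "integrable lborel (\<lambda>x. gauss_density x * ((x \<bullet> e) * f x))"
    using f f' xf by (simp_all add: integrable_std_gaussian)
  have "(LINT x|lborel. gauss_density x * f' x - gauss_density x * ((x \<bullet> e) * f x)) = 0"
  proof (rule integral_directional_derivative_eq_0)
    show "((\<lambda>s. gauss_density (x + s *\<^sub>R e) * f (x + s *\<^sub>R e)) has_real_derivative
        gauss_density x * f' x - gauss_density x * ((x \<bullet> e) * f x)) (at 0)" for x
      using DERIV_mult[OF gauss_density_derivative[of x e] der[of x]] by (simp add: algebra_simps)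
  qed (use i in auto)
  then show ?thesis using i by (simp add: integral_std_gaussian)
qed

lemma rpoly_derivative_along:
  assumes "rpoly p"
  shows "((\<lambda>s. p (x + s *\<^sub>R e)) has_real_derivative frechet_derivative p (at x) e) (at 0)"
proof -
  have "((\<lambda>r. x + r *\<^sub>R e) has_derivative (\<lambda>r. r *\<^sub>R e)) (at 0)"
    by (auto intro!: derivative_eq_intros)
  moreover have d: "(p has_derivative frechet_derivative p (at x)) (at (x + 0 *\<^sub>R e))"
    using has_derivative_frechet[OF assms] by simp
  ultimately have "((\<lambda>s. p (x + s *\<^sub>R e)) has_derivative (\<lambda>r. frechet_derivative p (at x) (r *\<^sub>R e))) (at 0)"
    by (rule has_derivative_compose)
  moreover have "(\<lambda>r. frechet_derivative p (at x) (r *\<^sub>R e)) = (*) (frechet_derivative p (at x) e)"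
    using has_derivative_linear[OF d] by (auto simp: linear_scale)
  ultimately show ?thesis
    by (simp add: has_field_derivative_def)
qed

lemma ginner_pd:
  assumes "rpoly p" "rpoly q"
  shows "ginner (pd k p) q = ginner p (adj_pd k q)"
proof -
  note r = assms rpoly_pd rpoly_component real_polynomial_function.intros(2-4)
  have "(LINT x|std_gaussian. p x * pd k q x + pd k p x * q x) = (LINT x|std_gaussian. (x \<bullet> axis k 1) * (p x * q x))"
  proof (rule std_gaussian_ibp)
    fix x :: "real ^ 'a"
    show "((\<lambda>s. p (x + s *\<^sub>R axis k 1) * q (x + s *\<^sub>R axis k 1)) has_real_derivative p x * pd k q x + pd k p x * q x) (at 0)"
      using DERIV_mult[OF rpoly_derivative_along[of p x "axis k 1"] rpoly_derivative_along[of q x "axis k 1"]] assms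
      by (simp add: pd_def algebra_simps)
  qed (auto simp: inner_axis intro!: rpoly_integrable r)
  moreover have "integrable std_gaussian (\<lambda>x. p x * pd k q x)" "integrable std_gaussian (\<lambda>x. pd k p x * q x)"
    "integrable std_gaussian (\<lambda>x. x $ k * (p x * q x))"
    by (auto intro!: rpoly_integrable r)
  ultimately show ?thesis
    by (simp add: ginner_def adj_pd_def inner_axis right_diff_distrib mult_ac)
qed

text \<open>Polarization: the directions \<open>axis k 1\<close>, \<open>axis l 1\<close> and their
  sum are each admissible for integration by parts, and the off-diagonal entry is obtained from the
  third identity by subtracting the other two.\<close>

lemma sym_grad_weak:
  fixes u :: "real ^ 'n \<Rightarrow> real ^ 'n"
  assumes d: "\<And>x. u differentiable (at x)"
    and u: "\<And>k. L2g (\<lambda>x. u x $ k)" and S: "\<And>k l. L2g (\<lambda>x. sym_grad u x $ k $ l)"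
    and p: "rpoly p"
  shows "ginner (\<lambda>x. u x $ k) (adj_pd l p) + ginner (\<lambda>x. u x $ l) (adj_pd k p) = 2 * ginner (\<lambda>x. sym_grad u x $ k $ l) p"
proof -
  have Lp: "L2g p" "L2g (pd k p)" "L2g (adj_pd k p)" for k by (auto intro!: L2g_rpoly p rpoly_pd rpoly_adj_pd)
  have Lxp: "L2g (\<lambda>x. x $ k * p x)" for k
    by (intro L2g_rpoly real_polynomial_function.intros(4) rpoly_component p)
  have weak: "(LINT x|std_gaussian. (u x \<bullet> e) * ((x \<bullet> e) * p x - frechet_derivative p (at x) e))
      = (LINT x|std_gaussian. (sym_grad u x *v e) \<bullet> e * p x)"
    if Lu: "L2g (\<lambda>x. u x \<bullet> e)" and LS: "L2g (\<lambda>x. (sym_grad u x *v e) \<bullet> e)"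
      and Lpe: "L2g (\<lambda>x. frechet_derivative p (at x) e)" and Lxpe: "L2g (\<lambda>x. (x \<bullet> e) * p x)" for e
  proof -
    have 1: "integrable std_gaussian (\<lambda>x. (u x \<bullet> e) * p x)" "integrable std_gaussian (\<lambda>x. (u x \<bullet> e) * frechet_derivative p (at x) e)"
      "integrable std_gaussian (\<lambda>x. ((sym_grad u x *v e) \<bullet> e) * p x)" "integrable std_gaussian (\<lambda>x. (u x \<bullet> e) * ((x \<bullet> e) * p x))"
      using Lu LS Lpe Lxpe Lp(1) by (auto intro: L2g_mult_integrable)
    have "(LINT x|std_gaussian. (u x \<bullet> e) * frechet_derivative p (at x) e + (sym_grad u x *v e) \<bullet> e * p x)
      = (LINT x|std_gaussian. (x \<bullet> e) * ((u x \<bullet> e) * p x))"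
    proof (rule std_gaussian_ibp)
      fix x
      show "((\<lambda>s. (u (x + s *\<^sub>R e) \<bullet> e) * p (x + s *\<^sub>R e)) has_real_derivative
         (u x \<bullet> e) * frechet_derivative p (at x) e + (sym_grad u x *v e) \<bullet> e * p x) (at 0)"
        using DERIV_mult[OF inner_has_real_derivative_along[of u x 0 e] rpoly_derivative_along[OF p, of x e]] d
        by (simp add: algebra_simps)
    qed (use 1 in \<open>auto simp: mult_ac\<close>)
    then show ?thesis using 1 by (simp add: right_diff_distrib mult_ac)
  qed
  have lin: "linear (frechet_derivative p (at x))" for x
    using has_derivative_linear[OF has_derivative_frechet[OF p]] .
  have dle: "(x \<bullet> axis k 1) * p x - frechet_derivative p (at x) (axis k 1) = adj_pd k p x" for x k
    by (simp add: adj_pd_def pd_def inner_axis)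
  have Sk: "(sym_grad u x *v axis k 1) \<bullet> axis l 1 = sym_grad u x $ l $ k" for x k l
    by (simp add: inner_axis matrix_vector_mult_basis column_def)
  have one: "ginner (\<lambda>x. u x $ k) (adj_pd k p) = ginner (\<lambda>x. sym_grad u x $ k $ k) p" for k
    using weak[of "axis k 1"] u S Lp Lxp
    by (simp add: inner_axis ginner_def adj_pd_def[symmetric] pd_def[symmetric] Sk[unfolded inner_axis, simplified])
  let ?e = "axis k 1 + axis l 1 :: real ^ 'n"
  have e1: "u x \<bullet> ?e = u x $ k + u x $ l" for x by (simp add: inner_add_right inner_axis)
  have e2: "(sym_grad u x *v ?e) \<bullet> ?e = sym_grad u x $ k $ k + 2 * sym_grad u x $ k $ l + sym_grad u x $ l $ l" for x
    by (simp add: matrix_vector_right_distrib inner_add_left inner_add_right Sk sym_grad_sym[of u x l k] del: One_nat_def)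
  have e3: "frechet_derivative p (at x) ?e = pd k p x + pd l p x" for x
    by (simp add: linear_add[OF lin] pd_def)
  have e4: "(x \<bullet> ?e) * p x = x $ k * p x + x $ l * p x" for x
    by (simp add: inner_add_right inner_axis distrib_right)
  have e5: "x $ k * p x + x $ l * p x - (pd k p x + pd l p x) = adj_pd k p x + adj_pd l p x" for x
    by (simp add: adj_pd_def)
  have "ginner (\<lambda>x. u x $ k + u x $ l) (\<lambda>x. adj_pd k p x + adj_pd l p x) =
      ginner (\<lambda>x. sym_grad u x $ k $ k + 2 * sym_grad u x $ k $ l + sym_grad u x $ l $ l) p"
    unfolding ginner_def
    by (rule weak[of ?e, unfolded e1 e2 e3 e4 e5]) (intro L2g_add L2g_cmult u S Lp Lxp)+
  then show ?thesis
    using one[of k] one[of l] u S Lp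
    by (simp add: ginner_add_left ginner_add_right L2g_add L2g_cmult ginner_cmult_left)
qed

section \<open>Hermite decomposition\<close>

lemmas rpoly_intros = real_polynomial_function.intros(2-4) rpoly_pd rpoly_adj_pd rpoly_component
  real_polynomial_function_diff real_polynomial_function_sum

text \<open>Unnormalized multivariate Hermite polynomials, as products of creation operators applied
  to 1. Words replace multi-indices; permuted words give the same polynomial, which is harmless
  since only spans are used.\<close>

fun hermite :: "'n list \<Rightarrow> real ^ 'n \<Rightarrow> real" where
  "hermite [] = (\<lambda>x. 1)"
| "hermite (k # L) = adj_pd k (hermite L)"

text \<open>The homogeneous Gaussian chaos of degree \<open>m\<close>, that is, the span of the
  Hermite polynomials of degree \<open>m\<close>. The inductive form gives all linear statements by
  rule induction.\<close>

inductive_set Herm :: "nat \<Rightarrow> (real ^ 'n \<Rightarrow> real) set" for m where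
  zero: "(\<lambda>x. 0) \<in> Herm m"
| base: "length L = m \<Longrightarrow> hermite L \<in> Herm m"
| add: "f \<in> Herm m \<Longrightarrow> g \<in> Herm m \<Longrightarrow> (\<lambda>x. f x + g x) \<in> Herm m"
| cmult: "f \<in> Herm m \<Longrightarrow> (\<lambda>x. c * f x) \<in> Herm m"

lemma rpoly_hermite: "rpoly (hermite L)"
  by (induction L) (auto intro!: rpoly_intros simp del: adj_pd_def)

lemma Herm_rpoly: "f \<in> Herm m \<Longrightarrow> rpoly f"
  by (induction rule: Herm.induct) (auto intro!: rpoly_intros rpoly_hermite)

lemma Herm_L2g: "f \<in> Herm m \<Longrightarrow> L2g f"
  by (intro L2g_rpoly Herm_rpoly)

lemma Herm_sum: "(\<And>i. i \<in> I \<Longrightarrow> f i \<in> Herm m) \<Longrightarrow> (\<lambda>x. \<Sum>i\<in>I. f i x) \<in> Herm m"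
  by (induction I rule: infinite_finite_induct) (auto intro: Herm.add Herm.zero)

lemma adj_pd_Herm: "f \<in> Herm m \<Longrightarrow> adj_pd k f \<in> Herm (Suc m)"
proof (induction rule: Herm.induct)
  case (base L)
  then show ?case using Herm.base[of "k # L" "Suc m"] by simp
qed (auto simp: adj_pd_zero adj_pd_add adj_pd_cmult Herm_rpoly intro: Herm.intros)

text \<open>Truncated subtraction would place the derivative for the empty word in
  \<open>Herm 0\<close>, and a creation operator would raise it to degree 1 where degree 0 is
  wanted. The second conjunct closes this gap.\<close>

lemma pd_hermite: "pd k (hermite L) \<in> Herm (length L - 1) \<and> (L = [] \<longrightarrow> pd k (hermite L) = (\<lambda>x. 0))"
proof (induction L)
  case (Cons j L)
  have "adj_pd j (pd k (hermite L)) \<in> Herm (length L)"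
  proof (cases L)
    case Nil
    then show ?thesis using Cons by (simp add: adj_pd_zero Herm.zero)
  next
    case (Cons a L')
    then show ?thesis using adj_pd_Herm[of "pd k (hermite L)" "length L - 1" j] Cons.IH by simp
  qed
  moreover have "(\<lambda>x. if j = k then hermite L x else 0) \<in> Herm (length L)"
    by (cases "j = k") (auto intro: Herm.zero Herm.base)
  ultimately show ?case by (simp add: pd_adj_pd rpoly_hermite Herm.add)
qed (auto simp: pd_const Herm.zero)

lemma pd_Herm: "f \<in> Herm m \<Longrightarrow> pd k f \<in> Herm (m - 1) \<and> (m = 0 \<longrightarrow> pd k f = (\<lambda>x. 0))"
proof (induction rule: Herm.induct)
  case (base L)
  then show ?case using pd_hermite[of k L] by auto
qed (auto simp: pd_const pd_add pd_cmult Herm_rpoly intro: Herm.intros)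

text \<open>The number operator, or negative Ornstein-Uhlenbeck operator: \<open>Herm m\<close> is
  contained in its eigenspace for the eigenvalue \<open>m\<close>.\<close>

definition number_op :: "(real ^ 'n \<Rightarrow> real) \<Rightarrow> real ^ 'n \<Rightarrow> real" where
  "number_op f x = (\<Sum>k\<in>UNIV. adj_pd k (pd k f) x)"

lemma number_op_adj_pd:
  assumes p: "rpoly p"
  shows "number_op (adj_pd j p) = (\<lambda>x. adj_pd j (number_op p) x + adj_pd j p x)"
proof
  fix x
  have "adj_pd k (pd k (adj_pd j p)) x = adj_pd j (adj_pd k (pd k p)) x + (if k = j then adj_pd j p x else 0)" for k
    using p by (cases "j = k")
      (auto simp: pd_adj_pd adj_pd_add rpoly_intros adj_pd_zero adj_pd_adj_pd[of "pd k p" k j])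
  then show "number_op (adj_pd j p) x = adj_pd j (number_op p) x + adj_pd j p x"
    unfolding number_op_def[abs_def] using p
    by (simp add: sum.distrib adj_pd_sum rpoly_intros)
qed

lemma number_op_Herm: "f \<in> Herm m \<Longrightarrow> number_op f = (\<lambda>x. real m * f x)"
proof (induction rule: Herm.induct)
  case (base L)
  have "number_op (hermite L) = (\<lambda>x. real (length L) * hermite L x)"
  proof (induction L)
    case Nil
    show ?case by (simp add: number_op_def[abs_def] pd_const adj_pd_zero)
  next
    case (Cons k L)
    show ?case by (simp add: number_op_adj_pd rpoly_hermite Cons.IH adj_pd_cmult) (simp add: algebra_simps)
  qed
  then show ?case using base by simp
qed (auto simp: number_op_def fun_eq_iff pd_const adj_pd_zero pd_add pd_cmult adj_pd_add adj_pd_cmult Herm_rpoly rpoly_intros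
    sum.distrib sum_distrib_left[symmetric] algebra_simps)

lemma ginner_number_op: "rpoly f \<Longrightarrow> rpoly g \<Longrightarrow> ginner (number_op f) g = (\<Sum>k\<in>UNIV. ginner (pd k f) (pd k g))"
  unfolding number_op_def[abs_def]
  by (simp add: ginner_sum_left L2g_rpoly rpoly_intros ginner_commute[of "adj_pd _ _" g] ginner_pd[symmetric] ginner_commute[of "pd _ g"])

text \<open>Eigenvectors of a symmetric operator for different eigenvalues are orthogonal; the
  symmetry of \<open>number_op\<close> is visible from its Dirichlet form.\<close>

lemma Herm_orth:
  assumes f: "f \<in> Herm m" and g: "g \<in> Herm m'" and ne: "m \<noteq> m'"
  shows "ginner f g = 0"
proof -
  have "ginner (number_op f) g = ginner (number_op g) f"
    unfolding ginner_number_op[OF Herm_rpoly[OF f] Herm_rpoly[OF g]] ginner_number_op[OF Herm_rpoly[OF g] Herm_rpoly[OF f]]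
    by (intro sum.cong ginner_commute refl)
  then have "real m * ginner f g = real m' * ginner f g"
    using f g by (simp add: number_op_Herm ginner_cmult_left ginner_commute)
  then show ?thesis using ne by simp
qed

lemma Herm_0: "f \<in> Herm 0 \<Longrightarrow> \<exists>c. f = (\<lambda>x. c)"
  by (induction rule: Herm.induct) (auto intro!: exI)

lemma hermite_single: "hermite [k] = (\<lambda>x. x $ k)"
  by (auto simp: adj_pd_def pd_const)

lemma component_Herm: "(\<lambda>x. x $ k) \<in> Herm 1"
  using Herm.base[of "[k]" 1] hermite_single[of k] by simp

lemma const_Herm: "(\<lambda>x. c) \<in> Herm 0"
  using Herm.cmult[OF Herm.base[of "[]" 0], of c] by simp

lemma Herm_1: "f \<in> Herm 1 \<Longrightarrow> \<exists>b. f = (\<lambda>x. b \<bullet> x)"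
proof (induction rule: Herm.induct)
  case zero
  show ?case by (rule exI[of _ 0]) simp
next
  case (base L)
  then obtain k where "L = [k]" by (metis One_nat_def length_0_conv length_Suc_conv)
  then show ?case by (intro exI[of _ "axis k 1"]) (simp add: hermite_single inner_axis' del: hermite.simps)
next
  case (add f g)
  then obtain a b where "f = (\<lambda>x. a \<bullet> x)" "g = (\<lambda>x. b \<bullet> x)" by blast
  then show ?case by (intro exI[of _ "a + b"]) (simp add: inner_add_left)
next
  case (cmult f c)
  then obtain a where "f = (\<lambda>x. a \<bullet> x)" by blast
  then show ?case by (intro exI[of _ "c *\<^sub>R a"]) simp
qed

definition Herm_le :: "nat \<Rightarrow> (real ^ 'n \<Rightarrow> real) set" where
  "Herm_le M = {f. \<exists>g. (\<forall>m. g m \<in> Herm m) \<and> f = (\<lambda>x. \<Sum>m\<le>M. g m x)}"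

lemma Herm_le_mono: "f \<in> Herm_le M \<Longrightarrow> M \<le> M' \<Longrightarrow> f \<in> Herm_le M'"
proof -
  assume "f \<in> Herm_le M" and le: "M \<le> M'"
  then obtain g where g: "\<And>m. g m \<in> Herm m" "f = (\<lambda>x. \<Sum>m\<le>M. g m x)" unfolding Herm_le_def by auto
  define g' where "g' m = (if m \<le> M then g m else (\<lambda>x. 0))" for m
  have "(\<Sum>m\<le>M. g m x) = (\<Sum>m\<le>M'. g' m x)" for x
    using le by (intro sum.mono_neutral_cong_left) (auto simp: g'_def)
  then show ?thesis unfolding Herm_le_def using g by (auto intro!: exI[of _ g'] simp: g'_def Herm.zero)
qed

lemma Herm_le_add: "f \<in> Herm_le M \<Longrightarrow> g \<in> Herm_le M \<Longrightarrow> (\<lambda>x. f x + g x) \<in> Herm_le M"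
  unfolding Herm_le_def
proof safe
  fix a b :: "nat \<Rightarrow> real ^ 'a \<Rightarrow> real"
  assume "\<forall>m. a m \<in> Herm m" "\<forall>m. b m \<in> Herm m"
  then show "\<exists>g. (\<forall>m. g m \<in> Herm m) \<and> (\<lambda>x. (\<Sum>m\<le>M. a m x) + (\<Sum>m\<le>M. b m x)) = (\<lambda>x. \<Sum>m\<le>M. g m x)"
    by (intro exI[of _ "\<lambda>m x. a m x + b m x"]) (auto simp: sum.distrib intro: Herm.add)
qed

lemma Herm_Herm_le: "f \<in> Herm m \<Longrightarrow> f \<in> Herm_le m"
  unfolding Herm_le_def
proof (safe, intro exI conjI allI)
  assume "f \<in> Herm m"
  then show "(if k = m then f else (\<lambda>x. 0)) \<in> Herm k" for k by (auto intro: Herm.zero)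
  show "f = (\<lambda>x. \<Sum>k\<le>m. (if k = m then f else (\<lambda>x. 0)) x)"
  proof
    fix x
    have "(\<Sum>k\<le>m. (if k = m then f else (\<lambda>x. 0)) x) = (\<Sum>k\<le>m. if k = m then f x else 0)"
      by (intro sum.cong) auto
    then show "f x = (\<Sum>k\<le>m. (if k = m then f else (\<lambda>x. 0)) x)" by simp
  qed
qed

lemma Herm_le_rpoly: "f \<in> Herm_le M \<Longrightarrow> rpoly f"
  unfolding Herm_le_def by (auto intro!: real_polynomial_function_sum) (blast intro: Herm_rpoly)

lemma Herm_le_cmult: "f \<in> Herm_le M \<Longrightarrow> (\<lambda>x. c * f x) \<in> Herm_le M"
  unfolding Herm_le_def
proof safe
  fix a :: "nat \<Rightarrow> real ^ 'a \<Rightarrow> real"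
  assume "\<forall>m. a m \<in> Herm m"
  then show "\<exists>g. (\<forall>m. g m \<in> Herm m) \<and> (\<lambda>x. c * (\<Sum>m\<le>M. a m x)) = (\<lambda>x. \<Sum>m\<le>M. g m x)"
    by (intro exI[of _ "\<lambda>m x. c * a m x"]) (auto simp: sum_distrib_left intro: Herm.cmult)
qed

lemma Herm_le_diff: "f \<in> Herm_le M \<Longrightarrow> g \<in> Herm_le M \<Longrightarrow> (\<lambda>x. f x - g x) \<in> Herm_le M"
  using Herm_le_add[of f M "\<lambda>x. (-1) * g x"] Herm_le_cmult[of g M "-1"] by simp

lemma Herm_le_sum:
  "(\<And>i. i \<in> I \<Longrightarrow> f i \<in> Herm_le M) \<Longrightarrow> (\<lambda>x. \<Sum>i\<in>I. f i x) \<in> Herm_le M"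
proof (induction I rule: infinite_finite_induct)
  case (insert a I)
  then show ?case by (auto intro: Herm_le_add)
qed (use Herm_le_mono[OF Herm_Herm_le[OF const_Herm[of 0]]] in auto)

text \<open>Multiplication by a coordinate is creation plus annihilation, so it changes the degree
  by one up or down.\<close>

lemma component_mult_Herm_le:
  assumes "f \<in> Herm_le M"
  shows "(\<lambda>x. x $ k * f x) \<in> Herm_le (Suc M)"
proof -
  obtain g where g: "\<And>m. g m \<in> Herm m" "f = (\<lambda>x. \<Sum>m\<le>M. g m x)" using assms unfolding Herm_le_def by auto
  have "(\<lambda>x. adj_pd k (g m) x + pd k (g m) x) \<in> Herm_le (Suc M)" if "m \<le> M" for m
  proof (rule Herm_le_add)
    show "adj_pd k (g m) \<in> Herm_le (Suc M)"
      by (rule Herm_le_mono[OF Herm_Herm_le[OF adj_pd_Herm[OF g(1)]]]) (use that in simp)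
    show "pd k (g m) \<in> Herm_le (Suc M)"
      by (rule Herm_le_mono[OF Herm_Herm_le[OF conjunct1[OF pd_Herm[OF g(1)]]]]) (use that in simp)
  qed
  then have "(\<lambda>x. \<Sum>m\<le>M. adj_pd k (g m) x + pd k (g m) x) \<in> Herm_le (Suc M)" by (intro Herm_le_sum) auto
  moreover have "(\<lambda>x. \<Sum>m\<le>M. adj_pd k (g m) x + pd k (g m) x) = (\<lambda>x. x $ k * f x)"
    by (simp add: adj_pd_def g(2) sum_distrib_left)
  ultimately show ?thesis by simp
qed

text \<open>Stated for the multiplication operator of \<open>p\<close>, with \<open>f\<close>
  arbitrary: a product of polynomials then acts as a composition, and no product formula for Hermite
  polynomials is called for.\<close>

lemma rpoly_mult_Herm_le:
  assumes "rpoly p"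
  shows "f \<in> Herm_le M \<Longrightarrow> \<exists>M'. (\<lambda>x. p x * f x) \<in> Herm_le M'"
  using assms
proof (induction arbitrary: f M rule: real_polynomial_function.induct)
  case (linear l)
  have "l x * f x = (\<Sum>k\<in>UNIV. l (axis k 1) * (x $ k * f x))" for x
  proof -
    have "(\<Sum>k\<in>UNIV. x $ k *\<^sub>R axis k 1) = x"
      using basis_expansion[of x] by (simp add: scalar_mult_eq_scaleR)
    then have "l x = l (\<Sum>k\<in>UNIV. x $ k *\<^sub>R axis k 1)" by simp
    also have "\<dots> = (\<Sum>k\<in>UNIV. x $ k * l (axis k 1))"
      using bounded_linear.linear[OF linear(1)] by (simp add: linear_sum linear_scale)
    finally show ?thesis by (simp add: sum_distrib_left sum_distrib_right mult_ac)
  qed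
  then have "(\<lambda>x. l x * f x) \<in> Herm_le (Suc M)"
    using linear(2) by (auto intro!: Herm_le_sum Herm_le_cmult component_mult_Herm_le)
  then show ?case by blast
next
  case (const c)
  then show ?case using Herm_le_cmult by blast
next
  case (add p q)
  then obtain M1 M2 where "(\<lambda>x. p x * f x) \<in> Herm_le M1" "(\<lambda>x. q x * f x) \<in> Herm_le M2" by blast
  then have "(\<lambda>x. p x * f x + q x * f x) \<in> Herm_le (max M1 M2)"
    by (intro Herm_le_add) (auto elim: Herm_le_mono)
  then show ?case by (auto simp: distrib_right)
next
  case (mult p q)
  then obtain M1 where "(\<lambda>x. q x * f x) \<in> Herm_le M1" by blast
  from mult(3)[OF this] show ?case by (simp add: mult.assoc)
qed

lemma rpoly_Herm_le: "rpoly p \<Longrightarrow> \<exists>M. p \<in> Herm_le M"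
  using rpoly_mult_Herm_le[OF _ Herm_Herm_le[OF const_Herm[of 1]]] by simp

text \<open>There are finitely many words of length \<open>m\<close>, so the projection exists by
  finite Gram-Schmidt, without completeness of the function space.\<close>

lemma Herm_projection_exists:
  assumes "L2g f"
  shows "\<exists>q\<in>Herm m. \<forall>g\<in>Herm m. ginner (\<lambda>x. f x - q x) g = 0"
proof -
  have fin: "finite {L :: 'a list. length L = m}"
    using finite_lists_length_eq[of "UNIV :: 'a set" m] by simp
  obtain c where c: "\<And>L. length L = m \<Longrightarrow> ginner (\<lambda>x. f x - (\<Sum>J | length J = m. c J * hermite J x)) (hermite L) = 0"
    using finite_projection_exists[OF fin, of hermite f] assms by (auto simp: L2g_rpoly rpoly_hermite)
  define q where "q x = (\<Sum>J | length J = m. c J * hermite J x)" for x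
  have q: "q \<in> Herm m" unfolding q_def[abs_def] by (intro Herm_sum Herm.cmult Herm.base) auto
  have "ginner (\<lambda>x. f x - q x) g = 0" if "g \<in> Herm m" for g
    using that
  proof (induction rule: Herm.induct)
    case (base L)
    then show ?case using c by (simp add: q_def)
  next
    case (add f' g')
    then show ?case using assms q by (simp add: ginner_add_right L2g_diff Herm_L2g)
  qed (simp_all add: ginner_cmult_right ginner_commute[of _ "\<lambda>x. 0"] ginner_zero_left)
  then show ?thesis using q by blast
qed

section \<open>Trigonometric and polynomial approximation\<close>

text \<open>The free phase makes this real span contain the sines and closes it under products, in
  place of complex exponentials.\<close>

inductive trig :: "(real ^ 'n \<Rightarrow> real) \<Rightarrow> bool" where
  cos: "trig (\<lambda>x. c * cos (\<xi> \<bullet> x + \<theta>))"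
| add: "trig f \<Longrightarrow> trig g \<Longrightarrow> trig (\<lambda>x. f x + g x)"

lemma trig_const: "trig (\<lambda>x. c)"
  using trig.cos[of c 0 0] by simp

lemma trig_cmult: "trig f \<Longrightarrow> trig (\<lambda>x. d * f x)"
proof (induction rule: trig.induct)
  case (cos c \<xi> \<theta>)
  show ?case using trig.cos[of "d * c" \<xi> \<theta>] by (simp add: mult.assoc)
qed (auto simp: distrib_left intro: trig.add)

lemma trig_sum: "(\<And>i. i \<in> I \<Longrightarrow> trig (f i)) \<Longrightarrow> trig (\<lambda>x. \<Sum>i\<in>I. f i x)"
  by (induction I rule: infinite_finite_induct) (auto intro: trig.add trig_const)

lemma trig_mult: "trig f \<Longrightarrow> trig g \<Longrightarrow> trig (\<lambda>x. f x * g x)"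
proof (induction rule: trig.induct)
  case (cos c \<xi> \<theta>)
  from cos show ?case
  proof (induction rule: trig.induct)
    case (cos d \<eta> \<theta>')
    have "c * cos (\<xi> \<bullet> x + \<theta>) * (d * cos (\<eta> \<bullet> x + \<theta>')) =
        (c * d / 2) * cos ((\<xi> - \<eta>) \<bullet> x + (\<theta> - \<theta>')) + (c * d / 2) * cos ((\<xi> + \<eta>) \<bullet> x + (\<theta> + \<theta>'))" for x
    proof -
      have "(\<xi> - \<eta>) \<bullet> x + (\<theta> - \<theta>') = (\<xi> \<bullet> x + \<theta>) - (\<eta> \<bullet> x + \<theta>')"
        "(\<xi> + \<eta>) \<bullet> x + (\<theta> + \<theta>') = (\<xi> \<bullet> x + \<theta>) + (\<eta> \<bullet> x + \<theta>')"
        by (simp_all add: inner_diff_left inner_add_left)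
      then show ?thesis by (simp only: cos_add cos_diff) (simp add: algebra_simps)
    qed
    then show ?case by (simp only:) (intro trig.intros)
  qed (auto simp: distrib_left intro: trig.add)
qed (auto simp: distrib_right intro: trig.add)

lemma trig_sin: "trig (\<lambda>x. sin (a * x $ i))"
proof -
  have "sin (a * x $ i) = 1 * cos (axis i a \<bullet> x + - (pi / 2))" for x :: "real ^ 'a"
    by (simp add: inner_axis' cos_diff)
  then show ?thesis using trig.cos[of 1 "axis i a" "- (pi / 2)"] by simp
qed

lemma linear_component_sum:
  fixes l :: "real ^ 'n \<Rightarrow> real"
  assumes "bounded_linear l"
  shows "l x = (\<Sum>k\<in>UNIV. l (axis k 1) * x $ k)"
proof -
  have "(\<Sum>k\<in>UNIV. x $ k *\<^sub>R axis k 1) = x"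
    using basis_expansion[of x] by (simp add: scalar_mult_eq_scaleR)
  then have "l x = l (\<Sum>k\<in>UNIV. x $ k *\<^sub>R axis k 1)" by simp
  also have "\<dots> = (\<Sum>k\<in>UNIV. x $ k * l (axis k 1))"
    using bounded_linear.linear[OF assms] by (simp add: linear_sum linear_scale)
  finally show ?thesis by (simp add: mult.commute)
qed

lemma trig_rpoly_sin: "rpoly P \<Longrightarrow> trig (\<lambda>x. P (\<chi> i. sin (a * x $ i)))"
proof (induction rule: real_polynomial_function.induct)
  case (linear l)
  show ?case
    by (subst linear_component_sum[OF linear]) (auto intro!: trig_sum trig_cmult trig_sin)
qed (auto intro: trig_const trig.add trig_mult)

lemma trig_continuous: "trig f \<Longrightarrow> continuous_on UNIV f"
  by (induction rule: trig.induct) (auto intro!: continuous_intros)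

lemma trig_measurable: "trig f \<Longrightarrow> f \<in> borel_measurable borel"
  by (intro borel_measurable_continuous_onI trig_continuous)

lemma trig_bounded: "trig f \<Longrightarrow> \<exists>B. \<forall>x. \<bar>f x\<bar> \<le> B"
proof (induction rule: trig.induct)
  case (cos c \<xi> \<theta>)
  show ?case by (rule exI[of _ "\<bar>c\<bar>"]) (simp add: abs_mult mult_left_le)
next
  case (add f g)
  then show ?case by (metis abs_triangle_ineq add_mono order_trans)
qed

text \<open>Stone-Weierstrass in the variables \<open>sin (\<pi> x\<^sub>i / (2 L))\<close>: they separate the points of the cube \<open>|x\<^sub>i| \<le> L\<close>
  and map all of \<open>\<real>\<^sup>n\<close> into the unit cube, so the approximant is bounded globally.\<close>

lemma trig_approx:
  fixes f :: "real ^ 'n \<Rightarrow> real"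
  assumes f: "continuous_on UNIV f" and B: "\<And>x. \<bar>f x\<bar> \<le> B" and L: "L > 0" and e: "e > 0"
  shows "\<exists>T. trig T \<and> (\<forall>x. (\<forall>i. \<bar>x $ i\<bar> \<le> L) \<longrightarrow> \<bar>f x - T x\<bar> < e) \<and> (\<forall>x. \<bar>T x\<bar> \<le> B + e)"
proof -
  define K where "K = {s :: real ^ 'n. \<forall>i. -1 \<le> s $ i \<and> s $ i \<le> 1}"
  have "K = cbox (\<chi> i. -1) (\<chi> i. 1)"
    by (auto simp: K_def mem_box_cart)
  then have K: "compact K" by simp
  define F where "F s = f (\<chi> i. 2 * L / pi * arcsin (s $ i))" for s :: "real ^ 'n"
  have F: "continuous_on K F"
    unfolding F_def
    by (rule continuous_on_compose2[OF f]) (auto simp: K_def intro!: continuous_intros)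
  obtain P where P: "rpoly P" "\<And>s. s \<in> K \<Longrightarrow> \<bar>F s - P s\<bar> < e"
    using Stone_Weierstrass_real_polynomial_function[OF K F e] by blast
  define s where "s x = (\<chi> i. sin (pi / (2 * L) * x $ i))" for x :: "real ^ 'n"
  have sK: "s x \<in> K" for x by (simp add: s_def K_def)
  define T where "T x = P (s x)" for x
  have "trig T" unfolding T_def[abs_def] s_def by (rule trig_rpoly_sin[OF P(1)])
  moreover have "\<bar>f x - T x\<bar> < e" if x: "\<And>i. \<bar>x $ i\<bar> \<le> L" for x
  proof -
    have "arcsin (sin (pi / (2 * L) * x $ i)) = pi / (2 * L) * x $ i" for i
    proof (rule arcsin_sin)
      have "- L \<le> x $ i" "x $ i \<le> L" using x[of i] by auto
      then have "pi / (2 * L) * - L \<le> pi / (2 * L) * x $ i" "pi / (2 * L) * x $ i \<le> pi / (2 * L) * L"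
        using L by (intro mult_left_mono; simp)+
      then show "- (pi / 2) \<le> pi / (2 * L) * x $ i" "pi / (2 * L) * x $ i \<le> pi / 2"
        using L by simp_all
    qed
    then have "F (s x) = f x" using L by (simp add: F_def s_def)
    then show ?thesis using P(2)[OF sK[of x]] by (simp add: T_def)
  qed
  moreover have "\<bar>T x\<bar> \<le> B + e" for x
    using P(2)[OF sK[of x]] B[of "(\<chi> i. 2 * L / pi * arcsin (s x $ i))"] unfolding T_def F_def by linarith
  ultimately show ?thesis by blast
qed

text \<open>The cubes grow while the tolerance shrinks. The common bound makes dominated convergence
  applicable under every probability measure.\<close>

lemma trig_approx_sequence:
  fixes f :: "real ^ 'n \<Rightarrow> real"
  assumes f: "continuous_on UNIV f" and B: "\<And>x. \<bar>f x\<bar> \<le> B"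
  shows "\<exists>T. (\<forall>n. trig (T n)) \<and> (\<forall>x. (\<lambda>n. T n x) \<longlonglongrightarrow> f x) \<and> (\<forall>n x. \<bar>T n x\<bar> \<le> B + 1)"
proof -
  have "\<forall>n. \<exists>T. trig T \<and> (\<forall>x. (\<forall>i. \<bar>x $ i\<bar> \<le> real (Suc n)) \<longrightarrow> \<bar>f x - T x\<bar> < inverse (real (Suc n)))
      \<and> (\<forall>x. \<bar>T x\<bar> \<le> B + inverse (real (Suc n)))"
    using trig_approx[OF f B] by simp
  then obtain T where T: "\<And>n. trig (T n)"
    "\<And>n x. (\<And>i. \<bar>x $ i\<bar> \<le> real (Suc n)) \<Longrightarrow> \<bar>f x - T n x\<bar> < inverse (real (Suc n))"
    "\<And>n x. \<bar>T n x\<bar> \<le> B + inverse (real (Suc n))"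
    by metis
  have "(\<lambda>n. T n x) \<longlonglongrightarrow> f x" for x
  proof -
    have ev: "\<forall>\<^sub>F n in sequentially. norm (T n x - f x) \<le> inverse (real (Suc n))"
    proof (rule eventually_sequentiallyI)
      fix n assume n: "nat \<lceil>norm x\<rceil> \<le> n"
      have "\<bar>x $ i\<bar> \<le> real (Suc n)" for i
        using component_le_norm_cart[of x i] n by linarith
      then show "norm (T n x - f x) \<le> inverse (real (Suc n))"
        using T(2)[of x n] by (simp add: abs_minus_commute less_imp_le)
    qed
    have "(\<lambda>n. T n x - f x) \<longlonglongrightarrow> 0"
      by (rule Lim_null_comparison[OF ev LIMSEQ_inverse_real_of_nat])
    then show ?thesis by (simp add: LIM_zero_iff)
  qed
  moreover have "\<bar>T n x\<bar> \<le> B + 1" for n x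
  proof -
    have "inverse (real (Suc n)) \<le> 1" by (simp add: field_simps)
    then show ?thesis using T(3)[of n x] by linarith
  qed
  ultimately show ?thesis using T(1) by blast
qed

text \<open>The uniqueness theorem for characteristic functions in real form. Bounded pointwise
  limits carry the equality from trigonometric sums to bounded continuous functions and then to
  indicators of closed sets, an intersection-stable generator.\<close>

theorem measure_eqI_trig:
  fixes M M' :: "(real ^ 'n) measure"
  assumes M: "prob_space M" "sets M = sets borel" and M': "prob_space M'" "sets M' = sets borel"
    and eq: "\<And>\<xi> \<theta>. (LINT x|M. cos (\<xi> \<bullet> x + \<theta>)) = (LINT x|M'. cos (\<xi> \<bullet> x + \<theta>))"
  shows "M = M'"
proof -
  interpret M: prob_space M by fact
  interpret M': prob_space M' by fact
  note [measurable_cong] = M(2) M'(2)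
  have int: "integrable M f" "integrable M' f" if "f \<in> borel_measurable borel" "\<And>x. \<bar>f x\<bar> \<le> B"
    for f :: "real ^ 'n \<Rightarrow> real" and B
    using that(2)
    by (intro M.integrable_const_bound[of _ B] M'.integrable_const_bound[of _ B] AE_I2;
        simp add: measurable_cong_sets[OF M(2) refl] measurable_cong_sets[OF M'(2) refl] that(1))+
  have int_trig: "integrable M T" "integrable M' T" if "trig T" for T :: "real ^ 'n \<Rightarrow> real"
    using int[OF trig_measurable[OF that]] trig_bounded[OF that] by blast+
  have trig: "(LINT x|M. T x) = (LINT x|M'. T x)" if "trig T" for T
    using that
  proof (induction rule: trig.induct)
    case (add f g)
    then show ?case by (simp add: int_trig)
  qed (simp add: eq)
  have cont: "(LINT x|M. f x) = (LINT x|M'. f x)"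
    if f: "continuous_on UNIV f" and B: "\<And>x. \<bar>f x\<bar> \<le> B" for f :: "real ^ 'n \<Rightarrow> real" and B
  proof -
    obtain T where T: "\<And>n. trig (T n)" "\<And>x. (\<lambda>n. T n x) \<longlonglongrightarrow> f x" "\<And>n x. \<bar>T n x\<bar> \<le> B + 1"
      using trig_approx_sequence[OF f B] by blast
    have [measurable]: "f \<in> borel_measurable borel" by (rule borel_measurable_continuous_onI[OF f])
    have [measurable]: "T n \<in> borel_measurable borel" for n by (rule trig_measurable[OF T(1)])
    have "(\<lambda>n. LINT x|M. T n x) \<longlonglongrightarrow> (LINT x|M. f x)"
      by (rule integral_dominated_convergence[where w="\<lambda>x. B + 1"]) (auto simp: T)
    moreover have "(\<lambda>n. LINT x|M'. T n x) \<longlonglongrightarrow> (LINT x|M'. f x)"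
      by (rule integral_dominated_convergence[where w="\<lambda>x. B + 1"]) (auto simp: T)
    ultimately show ?thesis using trig[OF T(1)] LIMSEQ_unique by auto
  qed
  \<comment> \<open>The empty set is kept apart because \<open>infdist x {}\<close> is 0, so that
    \<open>f n\<close> would be constantly 1 there.\<close>
  have closed: "measure M C = measure M' C" if C: "closed C" "C \<noteq> {}" for C
  proof -
    define f where "f n x = max 0 (1 - real n * infdist x C)" for n :: nat and x
    have fc: "continuous_on UNIV (f n)" for n
      unfolding f_def by (intro continuous_intros)
    have fb: "\<bar>f n x\<bar> \<le> 1" for n x by (auto simp: f_def infdist_nonneg)
    have [measurable]: "f n \<in> borel_measurable borel" for n by (rule borel_measurable_continuous_onI[OF fc])
    have [measurable]: "C \<in> sets borel" using C by simp
    have lim: "(\<lambda>n. f n x) \<longlonglongrightarrow> indicator C x" for x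
    proof (cases "x \<in> C")
      case True
      then show ?thesis by (simp add: f_def)
    next
      case False
      then have d: "infdist x C > 0" using C by (simp add: infdist_pos_not_in_closed)
      have "\<forall>\<^sub>F n in sequentially. f n x = 0"
      proof (rule eventually_sequentiallyI)
        fix n assume n: "nat \<lceil>1 / infdist x C\<rceil> \<le> n"
        then have "1 / infdist x C \<le> real n" by linarith
        then show "f n x = 0" using d by (simp add: f_def field_simps)
      qed
      then show ?thesis using False by (simp add: tendsto_eventually)
    qed
    have "(\<lambda>n. LINT x|M. f n x) \<longlonglongrightarrow> (LINT x|M. indicator C x)"
      by (rule integral_dominated_convergence[where w="\<lambda>x. 1"]) (auto simp: lim fb)
    moreover have "(\<lambda>n. LINT x|M'. f n x) \<longlonglongrightarrow> (LINT x|M'. indicator C x)"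
      by (rule integral_dominated_convergence[where w="\<lambda>x. 1"]) (auto simp: lim fb)
    moreover have "(LINT x|M. f n x) = (LINT x|M'. f n x)" for n by (rule cont[OF fc fb])
    ultimately have "(LINT x|M. indicator C x :: real) = (LINT x|M'. indicator C x)"
      using LIMSEQ_unique by auto
    then show ?thesis by (simp add: M.emeasure_eq_measure sets_eq_imp_space_eq[OF M(2)] sets_eq_imp_space_eq[OF M'(2)])
  qed
  show ?thesis
  proof (rule measure_eqI_generator_eq[where E="Collect closed" and \<Omega>=UNIV and A="\<lambda>_. UNIV"])
    show "Int_stable (Collect closed :: (real ^ 'n) set set)" by (auto simp: Int_stable_def)
    show "emeasure M X = emeasure M' X" if "X \<in> Collect closed" for X
      using that closed[of X] by (cases "X = {}") (auto simp: M.emeasure_eq_measure M'.emeasure_eq_measure)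
    show "sets M = sigma_sets UNIV (Collect closed)" "sets M' = sigma_sets UNIV (Collect closed)"
      using M(2) M'(2) by (simp_all add: borel_eq_closed)
  qed (auto simp: M.emeasure_eq_measure)
qed

section \<open>Density of the polynomials\<close>

definition approximable :: "(real ^ 'n \<Rightarrow> real) \<Rightarrow> bool" where
  "approximable f \<longleftrightarrow> (\<forall>e>0. \<exists>p. rpoly p \<and> gnormsq (\<lambda>x. f x - p x) < e)"

text \<open>One half of the parallelogram law, a triangle inequality without square roots.\<close>

lemma ginner_diff_triangle:
  assumes "L2g f" "L2g g" "L2g h"
  shows "gnormsq (\<lambda>x. f x - h x)
    \<le> 2 * gnormsq (\<lambda>x. f x - g x) + 2 * gnormsq (\<lambda>x. g x - h x)"
proof -
  have "0 \<le> gnormsq (\<lambda>x. (f x - g x) - (g x - h x))" by (rule ginner_nonneg)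
  moreover have "gnormsq (\<lambda>x. f x - h x) = gnormsq (\<lambda>x. (f x - g x) + (g x - h x))"
    by simp
  ultimately show ?thesis
    using assms by (simp only: ginner_diff_self[OF L2g_diff L2g_diff] ginner_add_self[OF L2g_diff L2g_diff])
qed

lemma approximable_trans:
  assumes f: "L2g f" and g: "\<And>e. e > 0 \<Longrightarrow> \<exists>g. L2g g \<and> approximable g \<and> gnormsq (\<lambda>x. f x - g x) < e"
  shows "approximable f"
  unfolding approximable_def
proof (intro allI impI)
  fix e :: real assume "e > 0"
  then obtain g where g: "L2g g" "approximable g" "gnormsq (\<lambda>x. f x - g x) < e / 4"
    using g[of "e / 4"] by auto
  obtain p where p: "rpoly p" "gnormsq (\<lambda>x. g x - p x) < e / 4"
    using g(2) \<open>e > 0\<close> unfolding approximable_def by (meson divide_pos_pos zero_less_numeral)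
  show "\<exists>p. rpoly p \<and> gnormsq (\<lambda>x. f x - p x) < e"
    using ginner_diff_triangle[OF f g(1) L2g_rpoly[OF p(1)]] g(3) p by (intro exI[of _ p]) auto
qed

lemma approximable_dominated:
  fixes f :: "real ^ 'n \<Rightarrow> real"
  assumes f: "L2g f" and g: "\<And>n. L2g (g n)" "\<And>n. approximable (g n)"
    and lim: "\<And>x. (\<lambda>n. g n x) \<longlonglongrightarrow> f x"
    and w: "integrable std_gaussian w" "\<And>n x. (f x - g n x)\<^sup>2 \<le> w x"
  shows "approximable f"
proof (rule approximable_trans[OF f])
  fix e :: real assume e: "e > 0"
  have [measurable]: "f \<in> borel_measurable borel" "g n \<in> borel_measurable borel" for n
    using f g by (auto simp: L2g_def)
  have "(\<lambda>n. LINT x|std_gaussian. (f x - g n x)\<^sup>2) \<longlonglongrightarrow> (LINT x|(std_gaussian :: (real ^ 'n) measure). 0)"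
  proof (rule integral_dominated_convergence[OF _ _ w(1)])
    have "(\<lambda>n. (f x - g n x)\<^sup>2) \<longlonglongrightarrow> (f x - f x)\<^sup>2" for x
      by (intro tendsto_intros lim)
    then show "AE x in std_gaussian. (\<lambda>n. (f x - g n x)\<^sup>2) \<longlonglongrightarrow> 0" by simp
    show "AE x in std_gaussian. norm ((f x - g n x)\<^sup>2) \<le> w x" for n using w(2) by simp
  qed auto
  then have "(\<lambda>n. gnormsq (\<lambda>x. f x - g n x)) \<longlonglongrightarrow> 0"
    by (simp add: ginner_def power2_eq_square)
  then obtain n where "gnormsq (\<lambda>x. f x - g n x) < e"
    using e by (metis (no_types, lifting) eventually_happens order_tendstoD(2) sequentially_bot)
  then show "\<exists>g. L2g g \<and> approximable g \<and> gnormsq (\<lambda>x. f x - g x) < e"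
    using g by blast
qed

lemma approximable_rpoly: "rpoly p \<Longrightarrow> approximable p"
  unfolding approximable_def by (auto intro!: exI[of _ p] simp: ginner_def)

lemma trig_L2g:
  fixes f :: "real ^ 'n \<Rightarrow> real"
  assumes "trig f" shows "L2g f"
proof -
  have [measurable]: "f \<in> borel_measurable borel" by (rule trig_measurable[OF assms])
  obtain B where B: "\<And>x. \<bar>f x\<bar> \<le> B" using trig_bounded[OF assms] by blast
  have "(f x)\<^sup>2 \<le> B\<^sup>2" for x using power_mono[OF B abs_ge_zero, of x 2] by simp
  then have "integrable std_gaussian (\<lambda>x. (f x)\<^sup>2)"
    by (intro std_gaussian.integrable_const_bound[of _ "B\<^sup>2"]) auto
  then show ?thesis by (simp add: L2g_def)
qed

text \<open>The bound is uniform in the number of terms, so one dominating function serves all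
  partial sums.\<close>

lemma sum_exp_bound:
  fixes c :: "nat \<Rightarrow> real"
  assumes "\<And>j. \<bar>c j\<bar> \<le> 1 / fact j"
  shows "\<bar>\<Sum>j<J. c j * y ^ j\<bar> \<le> exp \<bar>y\<bar>"
proof -
  have "\<bar>\<Sum>j<J. c j * y ^ j\<bar> \<le> (\<Sum>j<J. \<bar>c j * y ^ j\<bar>)" by (rule sum_abs)
  also have "\<dots> \<le> (\<Sum>j<J. \<bar>y\<bar> ^ j / fact j)"
  proof (rule sum_mono)
    fix j
    have "\<bar>c j\<bar> * \<bar>y\<bar> ^ j \<le> 1 / fact j * \<bar>y\<bar> ^ j"
      by (intro mult_right_mono assms) auto
    then show "\<bar>c j * y ^ j\<bar> \<le> \<bar>y\<bar> ^ j / fact j" by (simp add: abs_mult power_abs)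
  qed
  also have "\<dots> \<le> (\<Sum>j. \<bar>y\<bar> ^ j / fact j)"
    using summable_exp_generic[of "\<bar>y\<bar>"] by (intro sum_le_suminf) (auto simp: divide_inverse mult.commute)
  also have "\<dots> = exp \<bar>y\<bar>" by (simp add: exp_def divide_inverse mult.commute)
  finally show ?thesis .
qed

text \<open>The Taylor polynomials of cosine and sine, combined by the addition formula, converge
  pointwise under a bound exp (|\<xi>| |x|), whose square is integrable. The light tails of the
  Gaussian are what makes the polynomials dense.\<close>

lemma approximable_cos: "approximable (\<lambda>x :: real ^ 'n. cos (\<xi> \<bullet> x + \<theta>))"
proof -
  define p where "p J x = cos \<theta> * (\<Sum>j<J. cos_coeff j * (\<xi> \<bullet> x) ^ j) - sin \<theta> * (\<Sum>j<J. sin_coeff j * (\<xi> \<bullet> x) ^ j)"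
    for J and x :: "real ^ 'n"
  have xi: "rpoly (\<lambda>x. \<xi> \<bullet> x)"
    by (intro real_polynomial_function.intros(1) bounded_linear_inner_right)
  have rp: "rpoly (p J)" for J
    unfolding p_def[abs_def] by (intro rpoly_intros real_polynomial_function_power xi) auto
  have pb: "\<bar>p J x\<bar> \<le> 2 * exp (norm \<xi> * norm x)" for J x
  proof -
    have "\<bar>cos_coeff j\<bar> \<le> 1 / fact j" "\<bar>sin_coeff j\<bar> \<le> 1 / fact j" for j
      by (auto simp: cos_coeff_def sin_coeff_def abs_mult divide_simps power_abs)
    then have 1: "\<bar>\<Sum>j<J. cos_coeff j * (\<xi> \<bullet> x) ^ j\<bar> \<le> exp \<bar>\<xi> \<bullet> x\<bar>" "\<bar>\<Sum>j<J. sin_coeff j * (\<xi> \<bullet> x) ^ j\<bar> \<le> exp \<bar>\<xi> \<bullet> x\<bar>"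
      by (auto intro!: sum_exp_bound)
    have 2: "exp \<bar>\<xi> \<bullet> x\<bar> \<le> exp (norm \<xi> * norm x)" using Cauchy_Schwarz_ineq2[of \<xi> x] by simp
    have "\<bar>cos \<theta> * (\<Sum>j<J. cos_coeff j * (\<xi> \<bullet> x) ^ j)\<bar> \<le> 1 * exp \<bar>\<xi> \<bullet> x\<bar>"
      "\<bar>sin \<theta> * (\<Sum>j<J. sin_coeff j * (\<xi> \<bullet> x) ^ j)\<bar> \<le> 1 * exp \<bar>\<xi> \<bullet> x\<bar>"
      unfolding abs_mult by (intro mult_mono 1; simp)+
    then show ?thesis using 2 unfolding p_def by linarith
  qed
  show ?thesis
  proof (rule approximable_dominated[where g=p and w="\<lambda>x. 9 * exp (2 * norm \<xi> * norm x)"])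
    show "L2g (\<lambda>x. cos (\<xi> \<bullet> x + \<theta>))" using trig_L2g[OF trig.cos[of 1 \<xi> \<theta>]] by simp
    show "L2g (p n)" "approximable (p n)" for n using rp by (auto intro: L2g_rpoly approximable_rpoly)
    fix x
    have "(\<lambda>J. \<Sum>j<J. cos_coeff j * (\<xi> \<bullet> x) ^ j) \<longlonglongrightarrow> cos (\<xi> \<bullet> x)"
      using cos_converges[of "\<xi> \<bullet> x"] by (simp add: sums_def)
    moreover have "(\<lambda>J. \<Sum>j<J. sin_coeff j * (\<xi> \<bullet> x) ^ j) \<longlonglongrightarrow> sin (\<xi> \<bullet> x)"
      using sin_converges[of "\<xi> \<bullet> x"] by (simp add: sums_def)
    ultimately have "(\<lambda>J. p J x) \<longlonglongrightarrow> cos \<theta> * cos (\<xi> \<bullet> x) - sin \<theta> * sin (\<xi> \<bullet> x)"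
      unfolding p_def by (intro tendsto_intros)
    then show "(\<lambda>J. p J x) \<longlonglongrightarrow> cos (\<xi> \<bullet> x + \<theta>)" by (simp add: cos_add mult.commute)
  next
    show "integrable std_gaussian (\<lambda>x. 9 * exp (2 * norm \<xi> * norm x))"
      by (rule integrable_std_gaussian_exp_bound[where C=9 and c="2 * norm \<xi>"]) auto
    fix n x
    have "\<bar>cos (\<xi> \<bullet> x + \<theta>) - p n x\<bar> \<le> 3 * exp (norm \<xi> * norm x)"
    proof -
      have "1 \<le> exp (norm \<xi> * norm x)" by simp
      then show ?thesis using abs_cos_le_one[of "\<xi> \<bullet> x + \<theta>"] pb[of n x] by linarith
    qed
    then have "\<bar>cos (\<xi> \<bullet> x + \<theta>) - p n x\<bar>\<^sup>2 \<le> (3 * exp (norm \<xi> * norm x))\<^sup>2"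
      by (rule power_mono) simp
    then show "(cos (\<xi> \<bullet> x + \<theta>) - p n x)\<^sup>2 \<le> 9 * exp (2 * norm \<xi> * norm x)"
      by (simp add: power_mult_distrib exp_double[symmetric] mult.assoc)
  qed
qed

lemma approximable_cmult:
  assumes "approximable f" shows "approximable (\<lambda>x. c * f x)"
  unfolding approximable_def
proof (intro allI impI)
  fix e :: real assume e: "e > 0"
  have c: "c\<^sup>2 + 1 > 0" by (simp add: add_nonneg_pos)
  obtain p where p: "rpoly p" "gnormsq (\<lambda>x. f x - p x) < e / (c\<^sup>2 + 1)"
    using assms e c unfolding approximable_def by (meson divide_pos_pos)
  have "gnormsq (\<lambda>x. c * f x - c * p x) = c\<^sup>2 * gnormsq (\<lambda>x. f x - p x)"
    by (simp add: right_diff_distrib[symmetric] ginner_cmult_left ginner_cmult_right power2_eq_square)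
  also have "\<dots> \<le> (c\<^sup>2 + 1) * gnormsq (\<lambda>x. f x - p x)"
    by (intro mult_right_mono ginner_nonneg) simp
  also have "\<dots> < e" using p(2) c by (simp add: field_simps)
  finally show "\<exists>p. rpoly p \<and> gnormsq (\<lambda>x. c * f x - p x) < e"
    using p(1) by (intro exI[of _ "\<lambda>x. c * p x"]) (auto intro: rpoly_intros)
qed

lemma approximable_add:
  assumes f: "L2g f" "approximable f" and g: "L2g g" "approximable g"
  shows "approximable (\<lambda>x. f x + g x)"
  unfolding approximable_def
proof (intro allI impI)
  fix e :: real assume e: "e > 0"
  obtain p where p: "rpoly p" "gnormsq (\<lambda>x. f x - p x) < e / 4"
    using f(2) e unfolding approximable_def by (meson divide_pos_pos zero_less_numeral)
  obtain q where q: "rpoly q" "gnormsq (\<lambda>x. g x - q x) < e / 4"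
    using g(2) e unfolding approximable_def by (meson divide_pos_pos zero_less_numeral)
  have "gnormsq (\<lambda>x. (f x - p x) - (q x - g x))
     \<le> 2 * gnormsq (\<lambda>x. (f x - p x) - 0) + 2 * gnormsq (\<lambda>x. 0 - (q x - g x))"
    by (intro ginner_diff_triangle L2g_diff L2g_rpoly[OF p(1)] L2g_rpoly[OF q(1)] L2g_const f(1) g(1))
  also have "gnormsq (\<lambda>x. 0 - (q x - g x)) = gnormsq (\<lambda>x. g x - q x)" by simp
  finally have "gnormsq (\<lambda>x. (f x + g x) - (p x + q x)) < e"
    using p(2) q(2) by (simp add: algebra_simps)
  then show "\<exists>p. rpoly p \<and> gnormsq (\<lambda>x. (f x + g x) - p x) < e"
    using p(1) q(1) by (intro exI[of _ "\<lambda>x. p x + q x"]) (auto intro: rpoly_intros)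
qed

lemma approximable_trig: "trig f \<Longrightarrow> approximable f"
  by (induction rule: trig.induct)
    (auto intro: approximable_cmult approximable_cos approximable_add trig_L2g)

text \<open>Three layers: truncation to bounded continuous functions, trigonometric sums for these,
  and Taylor polynomials for the cosines. Each limit is dominated.\<close>

theorem approximable_continuous:
  fixes f :: "real ^ 'n \<Rightarrow> real"
  assumes f: "continuous_on UNIV f" "L2g f"
  shows "approximable f"
proof -
  define g where "g n x = max (- real n) (min (real n) (f x))" for n x
  have gc: "continuous_on UNIV (g n)" for n
    unfolding g_def by (intro continuous_intros f)
  have gb: "\<bar>g n x\<bar> \<le> real n" for n x by (auto simp: g_def)
  have [measurable]: "g n \<in> borel_measurable borel" for n by (rule borel_measurable_continuous_onI[OF gc])
  have gL: "L2g (g n)" for n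
  proof -
    have "(g n x)\<^sup>2 \<le> (real n)\<^sup>2" for x using power_mono[OF gb abs_ge_zero, of n x 2] by simp
    then have "integrable std_gaussian (\<lambda>x. (g n x)\<^sup>2)"
      by (intro std_gaussian.integrable_const_bound[of _ "(real n)\<^sup>2"]) auto
    then show ?thesis by (simp add: L2g_def)
  qed
  have ga: "approximable (g n)" for n
  proof -
    obtain T where T: "\<And>k. trig (T k)" "\<And>x. (\<lambda>k. T k x) \<longlonglongrightarrow> g n x" "\<And>k x. \<bar>T k x\<bar> \<le> real n + 1"
      using trig_approx_sequence[OF gc gb] by blast
    show ?thesis
    proof (rule approximable_dominated[OF gL trig_L2g[OF T(1)] approximable_trig[OF T(1)] T(2)])
      show "integrable std_gaussian (\<lambda>x :: real ^ 'n. (2 * real n + 1)\<^sup>2)" by simp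
      fix k x
      have "\<bar>g n x - T k x\<bar> \<le> 2 * real n + 1" using gb[of n x] T(3)[of k x] by linarith
      then have "\<bar>g n x - T k x\<bar>\<^sup>2 \<le> (2 * real n + 1)\<^sup>2" by (rule power_mono) simp
      then show "(g n x - T k x)\<^sup>2 \<le> (2 * real n + 1)\<^sup>2" by simp
    qed
  qed
  show ?thesis
  proof (rule approximable_dominated[OF f(2) gL ga])
    show "integrable std_gaussian (\<lambda>x. (f x)\<^sup>2)" using f(2) by (simp add: L2g_def)
    fix x
    show "(\<lambda>n. g n x) \<longlonglongrightarrow> f x"
    proof (rule tendsto_eventually, rule eventually_sequentiallyI)
      fix n assume "nat \<lceil>\<bar>f x\<bar>\<rceil> \<le> n"
      then have "\<bar>f x\<bar> \<le> real n" by linarith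
      then show "g n x = f x" by (auto simp: g_def)
    qed
    fix n
    have "\<bar>f x - g n x\<bar> \<le> \<bar>f x\<bar>" by (auto simp: g_def)
    then have "\<bar>f x - g n x\<bar>\<^sup>2 \<le> \<bar>f x\<bar>\<^sup>2" by (rule power_mono) simp
    then show "(f x - g n x)\<^sup>2 \<le> (f x)\<^sup>2" by simp
  qed
qed

section \<open>The Gaussian inequality for polynomials and square-integrable fields\<close>

text \<open>An annihilation followed by a creation keeps the degree. A projection error orthogonal
  to \<open>Herm_le M\<close> is therefore also orthogonal to such expressions in the
  projection.\<close>

lemma adj_pd_pd_Herm_le:
  assumes "f \<in> Herm_le M"
  shows "adj_pd l (pd j f) \<in> Herm_le M"
proof -
  obtain g where g: "\<And>m. g m \<in> Herm m" "f = (\<lambda>x. \<Sum>m\<le>M. g m x)" using assms unfolding Herm_le_def by auto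
  have r: "rpoly (g m)" for m using g(1) by (rule Herm_rpoly)
  have "adj_pd l (pd j (g m)) \<in> Herm m" for m
  proof (cases m)
    case 0
    then show ?thesis using pd_Herm[OF g(1)[of m], of j] by (simp add: adj_pd_zero Herm.zero)
  next
    case (Suc m')
    then show ?thesis using pd_Herm[OF g(1)[of m], of j] adj_pd_Herm[of "pd j (g m)" m' l] by simp
  qed
  then have "(\<lambda>x. \<Sum>m\<le>M. adj_pd l (pd j (g m)) x) \<in> Herm_le M"
    by (intro Herm_le_sum) (auto intro: Herm_le_mono[OF Herm_Herm_le])
  moreover have "adj_pd l (pd j f) = (\<lambda>x. \<Sum>m\<le>M. adj_pd l (pd j (g m)) x)"
    unfolding g(2) by (simp add: pd_sum adj_pd_sum r rpoly_pd)
  ultimately show ?thesis by simp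
qed

definition sym_pd :: "('n \<Rightarrow> real ^ 'n \<Rightarrow> real) \<Rightarrow> 'n \<Rightarrow> 'n \<Rightarrow> real ^ 'n \<Rightarrow> real" where
  "sym_pd q k l x = (1 / 2) * (pd l (q k) x + pd k (q l) x)"

lemma sym_pd_sym: "sym_pd q k l = sym_pd q l k"
  by (auto simp: sym_pd_def fun_eq_iff)

lemma rpoly_sym_pd: "(\<And>k. rpoly (q k)) \<Longrightarrow> rpoly (sym_pd q k l)"
  unfolding sym_pd_def[abs_def] by (intro rpoly_intros) auto

text \<open>A symmetric matrix is orthogonal to antisymmetric ones, so one factor may be replaced by
  the full gradient.\<close>

lemma ginner_sym_pd_sym_pd:
  assumes q: "\<And>k. rpoly (q k)"
  shows "(\<Sum>k\<in>UNIV. \<Sum>l\<in>UNIV. ginner (sym_pd q k l) (sym_pd q k l)) = (\<Sum>k\<in>UNIV. \<Sum>l\<in>UNIV. ginner (pd l (q k)) (sym_pd q k l))"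
proof -
  have "ginner (sym_pd q k l) (sym_pd q k l) = (1 / 2) * (ginner (pd l (q k)) (sym_pd q k l) + ginner (pd k (q l)) (sym_pd q l k))" for k l
  proof -
    have "ginner (sym_pd q k l) (sym_pd q k l) = ginner (\<lambda>x. (1 / 2) * (pd l (q k) x + pd k (q l) x)) (sym_pd q k l)"
      by (simp add: sym_pd_def[abs_def])
    also have "\<dots> = (1 / 2) * (ginner (pd l (q k)) (sym_pd q k l) + ginner (pd k (q l)) (sym_pd q k l))"
      by (subst ginner_cmult_left, subst ginner_add_left) (auto intro!: L2g_rpoly rpoly_sym_pd rpoly_pd q)
    finally show ?thesis by (simp add: sym_pd_sym[of q l k])
  qed
  then have "(\<Sum>k\<in>UNIV. \<Sum>l\<in>UNIV. ginner (sym_pd q k l) (sym_pd q k l)) =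
      (1 / 2) * ((\<Sum>k\<in>UNIV. \<Sum>l\<in>UNIV. ginner (pd l (q k)) (sym_pd q k l)) + (\<Sum>k\<in>UNIV. \<Sum>l\<in>UNIV. ginner (pd k (q l)) (sym_pd q l k)))"
    by (simp add: sum.distrib sum_distrib_left distrib_left)
  moreover have "(\<Sum>k\<in>UNIV. \<Sum>l\<in>UNIV. ginner (pd k (q l)) (sym_pd q l k)) = (\<Sum>k\<in>UNIV. \<Sum>l\<in>UNIV. ginner (pd l (q k)) (sym_pd q k l))"
    by (rule sum.swap)
  ultimately show ?thesis by simp
qed

lemma korn_identity:
  assumes q: "\<And>k. rpoly (q k)"
  shows "2 * (\<Sum>k\<in>UNIV. \<Sum>l\<in>UNIV. ginner (sym_pd q k l) (sym_pd q k l)) =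
    (\<Sum>k\<in>UNIV. ginner (number_op (q k)) (q k)) - (\<Sum>k\<in>UNIV. ginner (q k) (q k))
      + gnormsq (\<lambda>x. \<Sum>l\<in>UNIV. adj_pd l (q l) x)"
proof -
  note L = L2g_rpoly rpoly_pd rpoly_adj_pd q
  have "2 * ginner (pd l (q k)) (sym_pd q k l) = ginner (pd l (q k)) (pd l (q k)) + ginner (pd l (q k)) (pd k (q l))" for k l
    unfolding sym_pd_def[abs_def] by (subst ginner_cmult_right, subst ginner_add_right) (auto intro!: L)
  \<comment> \<open>Both derivatives change sides. They produce the square of the adjoint
    divergence, and the commutator leaves one term of the squared norm of \<open>q\<close> on the
    diagonal.\<close>
  moreover have "ginner (pd l (q k)) (pd k (q l)) = ginner (adj_pd k (q k)) (adj_pd l (q l)) - (if k = l then ginner (q k) (q k) else 0)" for k l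
  proof -
    have e: "adj_pd l (pd k (q l)) = (\<lambda>x. pd k (adj_pd l (q l)) x - (if k = l then 1 else 0) * q l x)"
      by (auto simp: pd_adj_pd[OF q] fun_eq_iff)
    have "ginner (pd l (q k)) (pd k (q l)) = ginner (q k) (adj_pd l (pd k (q l)))"
      by (intro ginner_pd q rpoly_pd)
    also have "\<dots> = ginner (q k) (pd k (adj_pd l (q l))) - (if k = l then 1 else 0) * ginner (q k) (q l)"
      unfolding e by (simp add: ginner_diff_right ginner_cmult_right L L2g_cmult L2g_const)
    also have "ginner (q k) (pd k (adj_pd l (q l))) = ginner (adj_pd k (q k)) (adj_pd l (q l))"
      by (subst ginner_commute, subst ginner_pd) (auto simp: ginner_commute intro: rpoly_adj_pd q)
    finally show ?thesis by simp
  qed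
  ultimately have "2 * (\<Sum>k\<in>UNIV. \<Sum>l\<in>UNIV. ginner (sym_pd q k l) (sym_pd q k l)) =
     (\<Sum>k\<in>UNIV. \<Sum>l\<in>UNIV. ginner (pd l (q k)) (pd l (q k))) + (\<Sum>k\<in>UNIV. \<Sum>l\<in>UNIV. ginner (adj_pd k (q k)) (adj_pd l (q l)))
       - (\<Sum>k\<in>UNIV. \<Sum>l\<in>UNIV. if k = l then ginner (q k) (q k) else 0)"
    unfolding ginner_sym_pd_sym_pd[OF q] sum_distrib_left by (simp add: sum.distrib sum_subtractf)
  moreover have "gnormsq (\<lambda>x. \<Sum>l\<in>UNIV. adj_pd l (q l) x) = (\<Sum>k\<in>UNIV. \<Sum>l\<in>UNIV. ginner (adj_pd k (q k)) (adj_pd l (q l)))"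
    by (simp add: ginner_sum_left ginner_sum_right L L2g_sum)
  ultimately show ?thesis by (simp add: ginner_number_op q)
qed

lemma ginner_sum_Herm_self:
  assumes Q: "\<And>m. Q m \<in> Herm m" and I: "finite I"
  shows "ginner (\<lambda>x. \<Sum>m\<in>I. a m * Q m x) (\<lambda>x. \<Sum>m\<in>I. Q m x) = (\<Sum>m\<in>I. a m * ginner (Q m) (Q m))"
proof -
  have L: "L2g (Q m)" for m using Q by (rule Herm_L2g)
  have "ginner (\<lambda>x. \<Sum>m\<in>I. a m * Q m x) (\<lambda>x. \<Sum>m\<in>I. Q m x) = (\<Sum>m\<in>I. a m * (\<Sum>m'\<in>I. ginner (Q m) (Q m')))"
    by (simp add: ginner_sum_left ginner_sum_right L L2g_sum L2g_cmult ginner_cmult_left)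
  also have "\<dots> = (\<Sum>m\<in>I. a m * ginner (Q m) (Q m))"
  proof (rule sum.cong[OF refl])
    fix m assume m: "m \<in> I"
    have "(\<Sum>m'\<in>I. ginner (Q m) (Q m')) = (\<Sum>m'\<in>I. if m' = m then ginner (Q m) (Q m) else 0)"
      by (intro sum.cong refl) (auto intro: Herm_orth[OF Q Q])
    then show "a m * (\<Sum>m'\<in>I. ginner (Q m) (Q m')) = a m * ginner (Q m) (Q m)"
      using m I by simp
  qed
  finally show ?thesis .
qed



text \<open>The divergence square is dropped and the spectral gap is used. Lower degrees must be
  excluded: constants and skew maps have vanishing symmetrized gradient.\<close>

lemma korn_degree_ge_2:
  fixes Q :: "'n::finite \<Rightarrow> nat \<Rightarrow> real ^ 'n \<Rightarrow> real" and M :: nat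
  assumes Q: "\<And>k m. Q k m \<in> Herm m"
  defines "r \<equiv> \<lambda>k x. \<Sum>m\<in>{2..M}. Q k m x"
  shows "(\<Sum>k\<in>UNIV. ginner (r k) (r k)) \<le> 2 * (\<Sum>k\<in>UNIV. \<Sum>l\<in>UNIV. ginner (sym_pd r k l) (sym_pd r k l))"
proof -
  have rQ: "rpoly (Q k m)" for k m by (rule Herm_rpoly[OF Q])
  have r: "rpoly (r k)" for k unfolding r_def by (intro real_polynomial_function_sum rQ) auto
  have number_eq_r: "number_op (r k) = (\<lambda>x. \<Sum>m\<in>{2..M}. real m * Q k m x)" for k
  proof
    fix x
    have "number_op (r k) x = (\<Sum>m\<in>{2..M}. number_op (Q k m) x)"
      unfolding number_op_def r_def by (simp add: pd_sum adj_pd_sum rQ rpoly_pd) (rule sum.swap)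
    then show "number_op (r k) x = (\<Sum>m\<in>{2..M}. real m * Q k m x)" by (simp add: number_op_Herm[OF Q])
  qed
  have a: "ginner (number_op (r k)) (r k) = (\<Sum>m\<in>{2..M}. real m * ginner (Q k m) (Q k m))" for k
    unfolding number_eq_r unfolding r_def by (rule ginner_sum_Herm_self[OF Q]) simp
  have b: "ginner (r k) (r k) = (\<Sum>m\<in>{2..M}. ginner (Q k m) (Q k m))" for k
    using ginner_sum_Herm_self[of "Q k" "{2..M}" "\<lambda>_. 1", OF Q] unfolding r_def by simp
  have "2 * ginner (r k) (r k) \<le> ginner (number_op (r k)) (r k)" for k
    unfolding a b sum_distrib_left by (intro sum_mono mult_right_mono ginner_nonneg) auto
  then have "(\<Sum>k\<in>UNIV. ginner (r k) (r k)) \<le> (\<Sum>k\<in>UNIV. ginner (number_op (r k)) (r k)) - (\<Sum>k\<in>UNIV. ginner (r k) (r k))"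
    by (simp add: sum_subtractf[symmetric] sum_mono algebra_simps)
  then show ?thesis
    using korn_identity[of r, OF r] ginner_nonneg[of "\<lambda>x. \<Sum>l\<in>UNIV. adj_pd l (r l) x"] by linarith
qed

lemma adj_pd_1: "adj_pd l (\<lambda>x. 1) = (\<lambda>x. x $ l)"
  by (auto simp: adj_pd_def pd_const)

lemma ginner_one_one: "ginner (\<lambda>x :: real ^ 'n. 1) (\<lambda>x. 1) = 1"
  by (simp add: ginner_def std_gaussian.prob_space[simplified])

lemma ginner_component: "ginner (\<lambda>x. x $ k) (\<lambda>x. x $ l) = (if k = l then 1 else 0)"
proof -
  have "ginner (\<lambda>x. x $ k) (\<lambda>x. x $ l) = ginner (pd l (\<lambda>x. x $ k)) (\<lambda>x. 1)"
    by (subst ginner_pd) (auto simp: adj_pd_1 intro: rpoly_intros)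
  then show ?thesis by (simp add: pd_component ginner_one_one ginner_zero_left)
qed

text \<open>The approximating polynomials \<open>p\<close> only fix a degree \<open>M\<close> at
  which the projections \<open>q\<close> are within \<open>e\<close> of \<open>u\<close>. The
  estimate itself is made for \<open>q\<close>, since the projection is compatible with the
  symmetrized gradient and an arbitrary approximation is not.\<close>

theorem gaussian_poincare_korn_L2:
  fixes u :: "real ^ 'n \<Rightarrow> real ^ 'n"
  assumes d: "\<And>x. u differentiable (at x)"
    and u: "\<And>k. L2g (\<lambda>x. u x $ k)" and S: "\<And>k l. L2g (\<lambda>x. sym_grad u x $ k $ l)"
    and e: "e > 0"
  shows "\<exists>c A. A = - transpose A \<and>
    (\<Sum>k\<in>UNIV. gnormsq (\<lambda>x. u x $ k - c $ k - (A *v x) $ k))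
      \<le> 2 * (\<Sum>k\<in>UNIV. \<Sum>l\<in>UNIV. gnormsq (\<lambda>x. sym_grad u x $ k $ l)) + e"
proof -
  define w where "w k x = u x $ k" for k x
  define s where "s k l x = sym_grad u x $ k $ l" for k l x
  have Lw: "L2g (w k)" and Ls: "L2g (s k l)" for k l
    using u S by (auto simp: w_def[abs_def] s_def[abs_def])
  have s_sym: "s k l = s l k" for k l by (auto simp: s_def sym_grad_sym fun_eq_iff)
  have weak: "ginner (w k) (adj_pd l p) + ginner (w l) (adj_pd k p) = 2 * ginner (s k l) p" if "rpoly p" for k l p
    using sym_grad_weak[OF d u S that] by (simp add: w_def[abs_def] s_def[abs_def])
  have "continuous_on UNIV u"
    using d by (simp add: continuous_on_eq_continuous_at differentiable_imp_continuous_within)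
  then have "approximable (w k)" for k
    unfolding w_def[abs_def]
    by (intro approximable_continuous u bounded_linear.continuous_on[OF bounded_linear_vec_nth])
  then have "\<forall>k. \<exists>p. rpoly p \<and> gnormsq (\<lambda>x. w k x - p x) < e / real CARD('n)"
    using e unfolding approximable_def by simp
  then obtain p where p: "\<And>k. rpoly (p k)"
    "\<And>k. gnormsq (\<lambda>x. w k x - p k x) < e / real CARD('n)" by metis
  obtain M0 where M0: "\<And>k. p k \<in> Herm_le (M0 k)" using rpoly_Herm_le[OF p(1)] by metis
  \<comment> \<open>The extra 1 guarantees that the linear part, and with it the skew map to be
    subtracted, is contained in \<open>q\<close>.\<close>
  define M where "M = Max (insert 1 (range M0))"
  have M1: "1 \<le> M" and "M0 k \<le> M" for k unfolding M_def by (rule Max_ge; simp)+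
  then have pV: "p k \<in> Herm_le M" for k using Herm_le_mono[OF M0] by blast
  have "\<forall>k m. \<exists>q. q \<in> Herm m \<and> (\<forall>g\<in>Herm m. ginner (\<lambda>x. w k x - q x) g = 0)"
    using Herm_projection_exists[OF Lw] by blast
  then obtain Q where Q: "\<And>k m. Q k m \<in> Herm m" "\<And>k m g. g \<in> Herm m \<Longrightarrow> ginner (\<lambda>x. w k x - Q k m x) g = 0"
    by metis
  have LQ: "L2g (Q k m)" for k m by (rule Herm_L2g[OF Q(1)])
  have rQ: "rpoly (Q k m)" for k m by (rule Herm_rpoly[OF Q(1)])
  define q where "q k x = (\<Sum>m\<le>M. Q k m x)" for k x
  have qV: "q k \<in> Herm_le M" for k unfolding Herm_le_def q_def[abs_def] using Q(1) by auto
  have rq: "rpoly (q k)" for k by (rule Herm_le_rpoly[OF qV])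
  have Lq: "L2g (q k)" for k by (rule L2g_rpoly[OF rq])
  have oE: "ginner (\<lambda>x. w k x - q k x) g = 0" if g: "g \<in> Herm m" and m: "m \<le> M" for k m g
  proof -
    have "ginner (q k) g = (\<Sum>m'\<le>M. ginner (Q k m') g)"
      unfolding q_def[abs_def] by (rule ginner_sum_left[OF LQ Herm_L2g[OF g]])
    also have "\<dots> = (\<Sum>m'\<le>M. if m' = m then ginner (Q k m) g else 0)"
      by (intro sum.cong refl) (auto intro: Herm_orth[OF Q(1) g])
    also have "\<dots> = ginner (Q k m) g" using m by simp
    finally show ?thesis using Q(2)[OF g, of k] by (simp add: ginner_diff_left Lw Lq LQ Herm_L2g[OF g])
  qed
  have oV: "ginner (\<lambda>x. w k x - q k x) g = 0" if g: "g \<in> Herm_le M" for k g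
  proof -
    obtain h where h: "\<And>m. h m \<in> Herm m" "g = (\<lambda>x. \<Sum>m\<le>M. h m x)" using g unfolding Herm_le_def by auto
    show ?thesis unfolding h(2)
      by (subst ginner_sum_right) (auto intro!: sum.neutral oE[OF h(1)] L2g_diff Lw Lq Herm_L2g[OF h(1)])
  qed
  have err: "gnormsq (\<lambda>x. w k x - q k x) \<le> e / real CARD('n)" for k
  proof -
    \<comment> \<open>By Pythagoras the projection is at least as close to \<open>w k\<close> as
      \<open>p k\<close> is.\<close>
    have qp: "(\<lambda>x. q k x - p k x) \<in> Herm_le M" by (rule Herm_le_diff[OF qV pV])
    have "gnormsq (\<lambda>x. (w k x - q k x) + (q k x - p k x))
      = gnormsq (\<lambda>x. w k x - q k x) + gnormsq (\<lambda>x. q k x - p k x)"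
      unfolding ginner_add_self[OF L2g_diff[OF Lw Lq] L2g_diff[OF Lq L2g_rpoly[OF p(1)]]] oV[OF qp] by simp
    then show ?thesis using p(2)[of k] ginner_nonneg[of "\<lambda>x. q k x - p k x"] by simp
  qed
  define X where "X = (\<Sum>k\<in>UNIV. \<Sum>l\<in>UNIV. ginner (sym_pd q k l) (sym_pd q k l))"
  define Y where "Y = (\<Sum>k\<in>UNIV. \<Sum>l\<in>UNIV. ginner (s k l) (s k l))"
  have rT: "rpoly (sym_pd q k l)" for k l by (rule rpoly_sym_pd[OF rq])
  have LT: "L2g (sym_pd q k l)" for k l by (rule L2g_rpoly[OF rT])
  \<comment> \<open>Moving the derivative off \<open>q k\<close> produces a test polynomial of
    degree at most \<open>M\<close>, against which \<open>q k\<close> and \<open>w k\<close> have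
    the same pairing.\<close>
  have X1: "X = (\<Sum>k\<in>UNIV. \<Sum>l\<in>UNIV. ginner (w k) (adj_pd l (sym_pd q k l)))"
  proof -
    have "ginner (pd l (q k)) (sym_pd q k l) = ginner (w k) (adj_pd l (sym_pd q k l))" for k l
    proof -
      have "adj_pd l (sym_pd q k l) = (\<lambda>x. (1 / 2) * (adj_pd l (pd l (q k)) x + adj_pd l (pd k (q l)) x))"
        unfolding sym_pd_def[abs_def]
        by (subst adj_pd_cmult, intro rpoly_intros rq) (subst adj_pd_add; intro refl rpoly_pd rq)
      then have "adj_pd l (sym_pd q k l) \<in> Herm_le M" by (simp only:) (intro Herm_le_cmult Herm_le_add adj_pd_pd_Herm_le qV)
      from oV[OF this, of k] have "ginner (q k) (adj_pd l (sym_pd q k l)) = ginner (w k) (adj_pd l (sym_pd q k l))"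
        by (simp add: ginner_diff_left Lw Lq L2g_rpoly rpoly_adj_pd rT)
      then show ?thesis by (simp add: ginner_pd[OF rq rT])
    qed
    then show ?thesis unfolding X_def ginner_sym_pd_sym_pd[OF rq] by simp
  qed
  \<comment> \<open>The weak formulation replaces \<open>w\<close>, about whose derivatives little
    is known, by the symmetrized gradient \<open>s\<close>.\<close>
  have X2: "X = (\<Sum>k\<in>UNIV. \<Sum>l\<in>UNIV. ginner (s k l) (sym_pd q k l))"
  proof -
    have "2 * (\<Sum>k\<in>UNIV. \<Sum>l\<in>UNIV. ginner (s k l) (sym_pd q k l)) =
      (\<Sum>k\<in>UNIV. \<Sum>l\<in>UNIV. ginner (w k) (adj_pd l (sym_pd q k l))) + (\<Sum>k\<in>UNIV. \<Sum>l\<in>UNIV. ginner (w l) (adj_pd k (sym_pd q l k)))"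
      by (simp add: sum_distrib_left weak[OF rT, symmetric] sum.distrib sym_pd_sym[of q])
    also have "(\<Sum>k\<in>UNIV. \<Sum>l\<in>UNIV. ginner (w l) (adj_pd k (sym_pd q l k))) = (\<Sum>k\<in>UNIV. \<Sum>l\<in>UNIV. ginner (w k) (adj_pd l (sym_pd q k l)))"
      by (rule sum.swap)
    finally show ?thesis using X1 by simp
  qed
  \<comment> \<open>Bessel's inequality: \<open>X\<close> is both the squared norm of
    \<open>sym_pd q\<close> and its pairing with \<open>s\<close>, so the squared distance of the
    two is \<open>Y - X\<close>.\<close>
  have XY: "X \<le> Y"
  proof -
    have "0 \<le> (\<Sum>k\<in>UNIV. \<Sum>l\<in>UNIV. gnormsq (\<lambda>x. s k l x - sym_pd q k l x))"
      by (intro sum_nonneg ginner_nonneg)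
    also have "\<dots> = Y - 2 * X + X"
      unfolding Y_def by (simp add: ginner_diff_self Ls LT sum_subtractf sum.distrib sum_distrib_left[symmetric] X2[symmetric] X_def[symmetric])
    finally show ?thesis by simp
  qed
  define r where "r k x = (\<Sum>m\<in>{2..M}. Q k m x)" for k x
  have rr: "rpoly (r k)" for k unfolding r_def[abs_def] by (intro real_polynomial_function_sum rQ) auto
  have Lr: "L2g (r k)" for k by (rule L2g_rpoly[OF rr])
  have rE: "ginner (r k) g = 0" if g: "g \<in> Herm m" "m < 2" for k g m
    unfolding r_def[abs_def]
    by (subst ginner_sum_left) (use that in \<open>auto intro!: sum.neutral LQ Herm_L2g[OF g(1)] Herm_orth[OF Q(1) g(1)]\<close>)
  have rV: "r k \<in> Herm_le M" for k
    unfolding r_def[abs_def] by (intro Herm_le_sum Herm_le_mono[OF Herm_Herm_le[OF Q(1)]]) auto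
  have "\<exists>c. Q k 0 = (\<lambda>x. c)" "\<exists>b. Q k 1 = (\<lambda>x. b \<bullet> x)" for k using Q(1) Herm_0 Herm_1 by blast+
  then obtain c0 b where c0: "\<And>k. Q k 0 = (\<lambda>x. c0 k)" and b: "\<And>k. Q k 1 = (\<lambda>x. b k \<bullet> x)" by metis
  have q_eq: "q k x = c0 k + b k \<bullet> x + r k x" for k x
  proof -
    have "{..M} = insert 0 (insert 1 {2..M})" using M1 by auto
    then show ?thesis by (simp add: q_def r_def c0 b[unfolded One_nat_def])
  qed
  define B where "B k l = (b k $ l + b l $ k) / 2" for k l
  have pdq: "pd l (q k) = (\<lambda>x. b k $ l + pd l (r k) x)" for k l
  proof -
    have q': "q k = (\<lambda>x. c0 k + (b k \<bullet> x + r k x))" by (auto simp: q_eq fun_eq_iff)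
    have bl: "bounded_linear (\<lambda>x. b k \<bullet> x)" by (rule bounded_linear_inner_right)
    then have rb: "rpoly (\<lambda>x. b k \<bullet> x)" by (rule real_polynomial_function.intros(1))
    show ?thesis unfolding q'
      by (simp add: pd_add rpoly_intros(1) rpoly_intros(2)[OF rb rr] rb rr pd_const pd_linear[OF bl] inner_axis)
  qed
  have sgq: "sym_pd q k l = (\<lambda>x. B k l + sym_pd r k l x)" for k l
    by (auto simp: sym_pd_def pdq B_def fun_eq_iff field_simps)
  \<comment> \<open>Integration by parts turns this pairing into one of \<open>r\<close> with a
    coordinate, which has degree 1.\<close>
  have sg1: "ginner (\<lambda>x. B k l) (sym_pd r k l) = 0" for k l
  proof -
    have "ginner (pd j (r i)) (\<lambda>x. 1) = 0" for i j
      using rE[OF component_Herm[of j], of i] by (simp add: ginner_pd rr rpoly_intros(1) adj_pd_1)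
    then have "ginner (sym_pd r k l) (\<lambda>x. 1) = 0"
      unfolding sym_pd_def[abs_def]
      by (subst ginner_cmult_left, subst ginner_add_left) (auto intro!: L2g_rpoly rpoly_pd rr L2g_const)
    then show ?thesis using ginner_cmult_left[of "B k l" "\<lambda>x. 1" "sym_pd r k l"] by (simp add: ginner_commute)
  qed
  have BB: "ginner (\<lambda>x :: real ^ 'n. a) (\<lambda>x. a) = a\<^sup>2" for a
    using ginner_cmult_left[of a "\<lambda>x :: real ^ 'n. 1" "\<lambda>x. a"] ginner_cmult_right[of "\<lambda>x :: real ^ 'n. 1" a "\<lambda>x. 1"]
    by (simp add: ginner_one_one power2_eq_square)
  have "X = (\<Sum>k\<in>UNIV. \<Sum>l\<in>UNIV. (B k l)\<^sup>2) + (\<Sum>k\<in>UNIV. \<Sum>l\<in>UNIV. ginner (sym_pd r k l) (sym_pd r k l))"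
    unfolding X_def sgq by (simp add: ginner_add_self L2g_const L2g_rpoly rpoly_sym_pd rr sg1 BB sum.distrib)
  moreover have "(\<Sum>k\<in>UNIV. ginner (r k) (r k)) \<le> 2 * (\<Sum>k\<in>UNIV. \<Sum>l\<in>UNIV. ginner (sym_pd r k l) (sym_pd r k l))"
  proof -
    have "r = (\<lambda>k x. \<Sum>m\<in>{2..M}. Q k m x)" by (intro ext) (simp add: r_def)
    then show ?thesis using korn_degree_ge_2[of Q M, OF Q(1)] by (simp only:)
  qed
  moreover have "0 \<le> (\<Sum>k\<in>UNIV. \<Sum>l\<in>UNIV. (B k l)\<^sup>2)" by (intro sum_nonneg) simp
  ultimately have X3: "(\<Sum>k\<in>UNIV. \<Sum>l\<in>UNIV. (B k l)\<^sup>2) + (\<Sum>k\<in>UNIV. ginner (r k) (r k)) \<le> 2 * X"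
    by linarith
  \<comment> \<open>The linear part is split: its antisymmetric part \<open>A\<close> is the skew
    map to subtract, and its symmetric part \<open>B\<close> has squared norm equal to that of its
    own symmetrized gradient, hence within the factor 2.\<close>
  define A :: "real ^ 'n ^ 'n" where "A = (\<chi> k l. (b k $ l - b l $ k) / 2)"
  define c :: "real ^ 'n" where "c = (\<chi> k. c0 k)"
  have A: "A = - transpose A" by (simp add: A_def transpose_def vec_eq_iff field_simps)
  define t where "t k x = (\<Sum>l\<in>UNIV. B k l * x $ l)" for k and x :: "real ^ 'n"
  have tE: "t k \<in> Herm 1" for k unfolding t_def[abs_def] by (intro Herm_sum Herm.cmult component_Herm)
  have tt: "ginner (t k) (t k) = (\<Sum>l\<in>UNIV. (B k l)\<^sup>2)" for k
  proof -
    have "ginner (t k) (t k) = (\<Sum>l\<in>UNIV. B k l * (\<Sum>l'\<in>UNIV. B k l' * ginner (\<lambda>x. x $ l) (\<lambda>x. x $ l')))"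
      unfolding t_def[abs_def]
      by (simp add: ginner_sum_left ginner_sum_right ginner_cmult_left ginner_cmult_right L2g_sum L2g_cmult Herm_L2g[OF component_Herm])
    also have "\<dots> = (\<Sum>l\<in>UNIV. (B k l)\<^sup>2)"
      by (simp add: ginner_component if_distrib sum.delta' power2_eq_square cong: if_cong)
    finally show ?thesis .
  qed
  \<comment> \<open>The projection error, the symmetric linear part and the part of degree at least
    2 are mutually orthogonal.\<close>
  have split: "u x $ k - c $ k - (A *v x) $ k = (w k x - q k x) + (t k x + r k x)" for k x
  proof -
    have "b k \<bullet> x = (A *v x) $ k + t k x"
      by (simp add: inner_vec_def matrix_vector_mult_def A_def t_def B_def sum.distrib[symmetric])
         (intro sum.cong refl, simp add: field_simps)
    then show ?thesis by (simp add: w_def q_eq c_def)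
  qed
  have "gnormsq (\<lambda>x. u x $ k - c $ k - (A *v x) $ k)
     = gnormsq (\<lambda>x. w k x - q k x) + ((\<Sum>l\<in>UNIV. (B k l)\<^sup>2) + ginner (r k) (r k))" for k
  proof -
    have trV: "(\<lambda>x. t k x + r k x) \<in> Herm_le M"
      using M1 by (intro Herm_le_add rV Herm_le_mono[OF Herm_Herm_le[OF tE]])
    have "gnormsq (\<lambda>x. t k x + r k x) = (\<Sum>l\<in>UNIV. (B k l)\<^sup>2) + ginner (r k) (r k)"
      using rE[OF tE, of k k] by (simp add: ginner_add_self Herm_L2g[OF tE] Lr tt ginner_commute[of "t k"])
    then show ?thesis unfolding split
      by (simp add: ginner_add_self[OF L2g_diff[OF Lw Lq] L2g_add[OF Herm_L2g[OF tE] Lr]] oV[OF trV])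
  qed
  then have "(\<Sum>k\<in>UNIV. gnormsq (\<lambda>x. u x $ k - c $ k - (A *v x) $ k))
     = (\<Sum>k\<in>UNIV. gnormsq (\<lambda>x. w k x - q k x)) + ((\<Sum>k\<in>UNIV. \<Sum>l\<in>UNIV. (B k l)\<^sup>2) + (\<Sum>k\<in>UNIV. ginner (r k) (r k)))"
    by (simp add: sum.distrib)
  also have "(\<Sum>k\<in>UNIV. gnormsq (\<lambda>x. w k x - q k x)) \<le> (\<Sum>k\<in>(UNIV :: 'n set). e / real CARD('n))"
    by (intro sum_mono err)
  also have "\<dots> = e" by simp
  finally have "(\<Sum>k\<in>UNIV. gnormsq (\<lambda>x. u x $ k - c $ k - (A *v x) $ k)) \<le> 2 * Y + e"
    using X3 XY by simp
  then show ?thesis unfolding Y_def s_def[abs_def] using A by blast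
qed

section \<open>The Gaussian constant\<close>

lemma jacobian_eqI:
  fixes u :: "real ^ 'n \<Rightarrow> real ^ 'm"
  assumes "(u has_derivative (\<lambda>h. J *v h)) (at x)"
  shows "jacobian u (at x) = J"
proof -
  have "frechet_derivative u (at x) = (\<lambda>h. J *v h)"
    using frechet_derivative_at[OF assms] by simp
  then show ?thesis by (simp add: jacobian_def matrix_of_matrix_vector_mul)
qed

lemma borel_measurable_matrix_vector_mult [measurable]:
  "(\<lambda>x. (A :: real ^ 'n ^ 'm) *v x) \<in> borel_measurable borel"
  by (intro borel_measurable_continuous_onI matrix_vector_mult_linear_continuous_on)

lemma L2_sq_vec_ginner:
  fixes f :: "real ^ 'n \<Rightarrow> real ^ 'n"
  assumes "\<And>k. L2g (\<lambda>x. f x $ k)"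
  shows "L2_sq_vec std_gaussian f = ennreal (\<Sum>k\<in>UNIV. gnormsq (\<lambda>x. f x $ k))"
proof -
  have n: "(norm (f x))\<^sup>2 = (\<Sum>k\<in>UNIV. (f x $ k)\<^sup>2)" for x
    by (simp add: norm_vec_def L2_set_def sum_nonneg)
  have i: "integrable std_gaussian (\<lambda>x. (f x $ k)\<^sup>2)" for k using assms by (simp add: L2g_def)
  have "(\<integral>\<^sup>+x. ennreal (\<Sum>k\<in>UNIV. (f x $ k)\<^sup>2) \<partial>std_gaussian) = ennreal (LINT x|std_gaussian. (\<Sum>k\<in>UNIV. (f x $ k)\<^sup>2))"
    using i by (intro nn_integral_eq_integral) (auto intro!: AE_I2 sum_nonneg)
  then show ?thesis using i unfolding L2_sq_vec_def n by (simp add: ginner_def power2_eq_square)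
qed

lemma L2_sq_mat_ginner:
  fixes f :: "real ^ 'n \<Rightarrow> real ^ 'n ^ 'n"
  assumes "\<And>k l. L2g (\<lambda>x. f x $ k $ l)"
  shows "L2_sq_mat std_gaussian f = ennreal (\<Sum>k\<in>UNIV. \<Sum>l\<in>UNIV. gnormsq (\<lambda>x. f x $ k $ l))"
proof -
  have i: "integrable std_gaussian (\<lambda>x. (f x $ k $ l)\<^sup>2)" for k l using assms by (simp add: L2g_def)
  have "(\<integral>\<^sup>+x. ennreal (\<Sum>k\<in>UNIV. \<Sum>l\<in>UNIV. (f x $ k $ l)\<^sup>2) \<partial>std_gaussian)
      = ennreal (LINT x|std_gaussian. (\<Sum>k\<in>UNIV. \<Sum>l\<in>UNIV. (f x $ k $ l)\<^sup>2))"
    using i by (intro nn_integral_eq_integral) (auto intro!: sum_nonneg)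
  then show ?thesis using i by (simp add: L2_sq_mat_def ginner_def power2_eq_square)
qed

lemma L2g_from_L2_sq_vec:
  fixes f :: "real ^ 'n \<Rightarrow> real ^ 'n"
  assumes [measurable]: "f \<in> borel_measurable borel" and fin: "L2_sq_vec std_gaussian f < \<infinity>"
  shows "L2g (\<lambda>x. f x $ k)"
proof -
  have "(f x $ k)\<^sup>2 \<le> (norm (f x))\<^sup>2" for x
    using power_mono[OF component_le_norm_cart[of "f x" k], of 2] by simp
  then have "(\<integral>\<^sup>+x. ennreal ((f x $ k)\<^sup>2) \<partial>std_gaussian) \<le> L2_sq_vec std_gaussian f"
    unfolding L2_sq_vec_def by (intro nn_integral_mono ennreal_leI)
  with fin have "integrable std_gaussian (\<lambda>x. (f x $ k)\<^sup>2)"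
    by (intro integrableI_nonneg) (auto simp: measurable_cong_sets[OF sets_std_gaussian refl])
  then show ?thesis by (simp add: L2g_def)
qed

lemma L2g_from_L2_sq_mat:
  fixes f :: "real ^ 'n \<Rightarrow> real ^ 'n ^ 'n"
  assumes m: "\<And>k l. (\<lambda>x. f x $ k $ l) \<in> borel_measurable borel" and fin: "L2_sq_mat std_gaussian f < \<infinity>"
  shows "L2g (\<lambda>x. f x $ k $ l)"
proof -
  note [measurable] = m
  have "(f x $ k $ l)\<^sup>2 \<le> (\<Sum>i\<in>UNIV. \<Sum>j\<in>UNIV. (f x $ i $ j)\<^sup>2)" for x
  proof -
    have "(f x $ k $ l)\<^sup>2 \<le> (\<Sum>j\<in>UNIV. (f x $ k $ j)\<^sup>2)" by (rule member_le_sum) auto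
    also have "\<dots> \<le> (\<Sum>i\<in>UNIV. \<Sum>j\<in>UNIV. (f x $ i $ j)\<^sup>2)"
      by (rule member_le_sum[of k UNIV "\<lambda>i. \<Sum>j\<in>UNIV. (f x $ i $ j)\<^sup>2"]) (auto intro: sum_nonneg)
    finally show ?thesis .
  qed
  then have "(\<integral>\<^sup>+x. ennreal ((f x $ k $ l)\<^sup>2) \<partial>std_gaussian) \<le> L2_sq_mat std_gaussian f"
    unfolding L2_sq_mat_def by (intro nn_integral_mono ennreal_leI)
  with fin have "integrable std_gaussian (\<lambda>x. (f x $ k $ l)\<^sup>2)"
    by (intro integrableI_nonneg) (auto simp: measurable_cong_sets[OF sets_std_gaussian refl])
  then show ?thesis by (simp add: L2g_def)
qed

section \<open>Dilated fields\<close>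

lemma has_derivative_scaled:
  fixes u :: "real ^ 'n \<Rightarrow> real ^ 'n"
  assumes d: "\<And>x. u differentiable (at x)"
  shows "((\<lambda>x. u (s *\<^sub>R x)) has_derivative (\<lambda>h. (s *\<^sub>R jacobian u (at (s *\<^sub>R x))) *v h)) (at x)"
proof -
  have "((\<lambda>x :: real ^ 'n. s *\<^sub>R x) has_derivative (\<lambda>h. s *\<^sub>R h)) (at x)"
    by (auto intro!: derivative_eq_intros)
  from has_derivative_compose[OF this has_derivative_jacobian[OF d]] show ?thesis
    by (simp add: linear_scale[OF matrix_vector_mul_linear] scaleR_matrix_vector_assoc[symmetric])
qed

lemma sym_grad_scaled:
  fixes u :: "real ^ 'n \<Rightarrow> real ^ 'n"
  assumes d: "\<And>x. u differentiable (at x)"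
  shows "sym_grad (\<lambda>x. u (s *\<^sub>R x)) x $ k $ l = s * sym_grad u (s *\<^sub>R x) $ k $ l"
  by (simp add: sym_grad_nth jacobian_eqI[OF has_derivative_scaled[OF d]] algebra_simps)

lemma gauss_density_scale_mono:
  assumes "0 \<le> s" "s \<le> 1"
  shows "gauss_density x \<le> gauss_density (s *\<^sub>R x)"
proof -
  have "norm (s *\<^sub>R x) \<le> norm x" using assms by (simp add: mult_left_le_one_le)
  then have "(norm (s *\<^sub>R x))\<^sup>2 \<le> (norm x)\<^sup>2" by (rule power_mono) simp
  then show ?thesis unfolding gauss_density_def by (intro mult_left_mono) auto
qed

text \<open>The chain rule contributes a factor at most 1, the density grows when its argument
  shrinks, and the substitution gives the power of \<open>s\<close>. The total factor tends to 1
  with \<open>s\<close>, so the sharp constant survives.\<close>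

lemma L2_sq_mat_scaled:
  fixes u :: "real ^ 'n \<Rightarrow> real ^ 'n"
  assumes d: "\<And>x. u differentiable (at x)" and s: "0 < s" "s < 1"
  shows "L2_sq_mat std_gaussian (sym_grad (\<lambda>x. u (s *\<^sub>R x)))
    \<le> ennreal (1 / s ^ CARD('n)) * L2_sq_mat std_gaussian (sym_grad u)"
proof -
  note [measurable] = borel_measurable_sym_grad_nth[OF d]
  define F where "F x = (\<Sum>i\<in>UNIV. \<Sum>j\<in>UNIV. (sym_grad u x $ i $ j)\<^sup>2)" for x
  have [measurable]: "F \<in> borel_measurable borel" unfolding F_def[abs_def] by measurable
  have F0: "F x \<ge> 0" for x unfolding F_def by (intro sum_nonneg) simp
  have "(\<Sum>i\<in>UNIV. \<Sum>j\<in>UNIV. (sym_grad (\<lambda>x. u (s *\<^sub>R x)) x $ i $ j)\<^sup>2) = s\<^sup>2 * F (s *\<^sub>R x)" for x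
    by (simp add: sym_grad_scaled[OF d] F_def power_mult_distrib sum_distrib_left)
  then have "L2_sq_mat std_gaussian (sym_grad (\<lambda>x. u (s *\<^sub>R x))) = (\<integral>\<^sup>+x. ennreal (gauss_density x) * ennreal (s\<^sup>2 * F (s *\<^sub>R x)) \<partial>lborel)"
    unfolding L2_sq_mat_def by (simp add: nn_integral_std_gaussian)
  also have "\<dots> \<le> (\<integral>\<^sup>+x. ennreal (gauss_density (s *\<^sub>R x) * F (s *\<^sub>R x)) \<partial>lborel)"
  proof (intro nn_integral_mono)
    fix x :: "real ^ 'n"
    have "s\<^sup>2 \<le> 1" using s by (simp add: power_le_one)
    then have "gauss_density x * (s\<^sup>2 * F (s *\<^sub>R x)) \<le> gauss_density (s *\<^sub>R x) * F (s *\<^sub>R x)"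
      using s gauss_density_scale_mono[of s x] F0 by (intro mult_mono mult_left_le_one_le) (auto intro: less_imp_le gauss_density_pos)
    then show "ennreal (gauss_density x) * ennreal (s\<^sup>2 * F (s *\<^sub>R x)) \<le> ennreal (gauss_density (s *\<^sub>R x) * F (s *\<^sub>R x))"
      using F0 gauss_density_pos[of x] by (subst ennreal_mult[symmetric]) (auto intro: ennreal_leI)
  qed
  also have "\<dots> = ennreal (1 / s ^ CARD('n)) * (\<integral>\<^sup>+x. ennreal (gauss_density x * F x) \<partial>lborel)"
    using nn_integral_lborel_affine[of "\<lambda>x. ennreal (gauss_density x * F x)" s 0] s by simp
  also have "(\<integral>\<^sup>+x. ennreal (gauss_density x * F x) \<partial>lborel) = L2_sq_mat std_gaussian (sym_grad u)"
  proof -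
    have "ennreal (gauss_density x * F x) = ennreal (gauss_density x) * ennreal (F x)" for x
      using F0 gauss_density_pos[of x] by (intro ennreal_mult) auto
    then show ?thesis unfolding L2_sq_mat_def F_def[symmetric] by (simp add: nn_integral_std_gaussian)
  qed
  finally show ?thesis .
qed

lemma L2g_scaled:
  fixes u :: "real ^ 'n \<Rightarrow> real ^ 'n"
  assumes d: "\<And>x. u differentiable (at x)" and s: "0 < s" "s < 1"
    and fin: "L2_sq_mat std_gaussian (sym_grad u) < \<infinity>"
  shows "L2g (\<lambda>x. u (s *\<^sub>R x) $ k)"
proof -
  note [measurable] = borel_measurable_norm_sym_grad[OF d] differentiable_imp_measurable[OF d]
  define K where "K = (2 * pi) powr (- real CARD('n) / 2)"
  have K: "K > 0" by (simp add: K_def)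
  have gK: "gauss_density x = K * exp (- (1/2) * (norm x)\<^sup>2)" for x :: "real ^ 'n" by (simp add: gauss_density_def K_def)
  have "L2_sq_mat std_gaussian (sym_grad u) = (\<integral>\<^sup>+x. ennreal (gauss_density x) * ennreal ((norm (sym_grad u x))\<^sup>2) \<partial>lborel)"
    unfolding L2_sq_mat_def sum_squares_matrix by (simp add: nn_integral_std_gaussian)
  also have "\<dots> = ennreal K * (\<integral>\<^sup>+x. ennreal (exp (- (1/2) * (norm x)\<^sup>2) * (norm (sym_grad u x))\<^sup>2) \<partial>lborel)"
    using K by (subst nn_integral_cmult[symmetric]) (auto simp: gK ennreal_mult mult.assoc)
  finally have fin': "(\<integral>\<^sup>+x. ennreal (exp (- (1/2) * (norm x)\<^sup>2) * (norm (sym_grad u x))\<^sup>2) \<partial>lborel) < \<infinity>"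
    using fin K by (auto simp: ennreal_mult_less_top)
  \<comment> \<open>With this exponent the weight at \<open>s *\<^sub>R x\<close> is exactly the
    Gaussian weight at \<open>x\<close>, and \<open>s < 1\<close> places \<open>a\<close> above
    1/2.\<close>
  define a where "a = 1 / (2 * s\<^sup>2)"
  have "s\<^sup>2 < 1" using s by (simp add: power_less_one_iff)
  then have a: "a > 1 / 2" using s by (simp add: a_def field_simps)
  have "(\<integral>\<^sup>+x. ennreal ((u (s *\<^sub>R x) $ k)\<^sup>2 * exp (- a * (norm (s *\<^sub>R x))\<^sup>2)) \<partial>lborel) =
    ennreal (1 / s ^ CARD('n)) * (\<integral>\<^sup>+x. ennreal ((u x $ k)\<^sup>2 * exp (- a * (norm x)\<^sup>2)) \<partial>lborel)"
    using nn_integral_lborel_affine[of "\<lambda>x. ennreal ((u x $ k)\<^sup>2 * exp (- a * (norm x)\<^sup>2))" s 0] s by simp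
  also have "\<dots> < \<infinity>"
    using nn_integral_square_finite[OF d fin' a, of k] by (simp add: ennreal_mult_less_top)
  finally have 1: "(\<integral>\<^sup>+x. ennreal ((u (s *\<^sub>R x) $ k)\<^sup>2 * exp (- a * (norm (s *\<^sub>R x))\<^sup>2)) \<partial>lborel) < \<infinity>" .
  have 2: "a * (norm (s *\<^sub>R x))\<^sup>2 = (norm x)\<^sup>2 / 2" for x :: "real ^ 'n"
    using s by (simp add: a_def power_mult_distrib)
  have "(\<integral>\<^sup>+x. ennreal ((u (s *\<^sub>R x) $ k)\<^sup>2) \<partial>std_gaussian) =
    (\<integral>\<^sup>+x. ennreal K * ennreal ((u (s *\<^sub>R x) $ k)\<^sup>2 * exp (- a * (norm (s *\<^sub>R x))\<^sup>2)) \<partial>lborel)"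
  proof -
    have "gauss_density x * (u (s *\<^sub>R x) $ k)\<^sup>2 = K * ((u (s *\<^sub>R x) $ k)\<^sup>2 * exp (- a * (norm (s *\<^sub>R x))\<^sup>2))" for x
      using 2[of x] by (simp add: gK del: norm_scaleR)
    then have "ennreal (gauss_density x) * ennreal ((u (s *\<^sub>R x) $ k)\<^sup>2) =
        ennreal K * ennreal ((u (s *\<^sub>R x) $ k)\<^sup>2 * exp (- a * (norm (s *\<^sub>R x))\<^sup>2))" for x
      using K gauss_density_pos[of x] by (simp only: ennreal_mult[symmetric] zero_le_power2 less_imp_le mult_nonneg_nonneg exp_ge_zero)
    then show ?thesis by (subst nn_integral_std_gaussian) auto
  qed
  also have "\<dots> < \<infinity>"
    using 1 by (subst nn_integral_cmult) (auto simp: ennreal_mult_less_top)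
  finally have "integrable std_gaussian (\<lambda>x. (u (s *\<^sub>R x) $ k)\<^sup>2)"
    by (intro integrableI_nonneg) (auto simp: measurable_cong_sets[OF sets_std_gaussian refl])
  then show ?thesis by (simp add: L2g_def)
qed

lemma poincare_korn_scaled:
  fixes u :: "real ^ 'n \<Rightarrow> real ^ 'n"
  assumes d: "\<And>x. u differentiable (at x)" and s: "0 < s" "s < 1" and e: "e > 0"
    and fin: "L2_sq_mat std_gaussian (sym_grad u) = ennreal m" "m \<ge> 0"
  shows "\<exists>c A. A = - transpose A \<and>
    L2_sq_vec std_gaussian (\<lambda>x. u (s *\<^sub>R x) - c - A *v x) \<le> ennreal (2 * (1 / s ^ CARD('n)) * m + e)"
proof -
  let ?v = "\<lambda>x. u (s *\<^sub>R x)"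
  have dv: "?v differentiable (at x)" for x
    using has_derivative_scaled[OF d] unfolding differentiable_def by blast
  have Lv: "L2g (\<lambda>x. ?v x $ k)" for k
    using L2g_scaled[OF d s] fin by simp
  have m: "L2_sq_mat std_gaussian (sym_grad ?v) \<le> ennreal (1 / s ^ CARD('n) * m)"
  proof -
    have "ennreal (1 / s ^ CARD('n)) * ennreal m = ennreal (1 / s ^ CARD('n) * m)"
      using s fin(2) by (intro ennreal_mult[symmetric]) auto
    then show ?thesis using L2_sq_mat_scaled[OF d s] by (simp only: fin(1))
  qed
  then have LS: "L2g (\<lambda>x. sym_grad ?v x $ k $ l)" for k l
    by (intro L2g_from_L2_sq_mat borel_measurable_sym_grad_nth dv) (auto intro: le_less_trans)
  define Y where "Y = (\<Sum>k\<in>UNIV. \<Sum>l\<in>UNIV. gnormsq (\<lambda>x. sym_grad ?v x $ k $ l))"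
  have "ennreal Y \<le> ennreal (1 / s ^ CARD('n) * m)"
    using m L2_sq_mat_ginner[OF LS] by (simp add: Y_def)
  then have Y: "Y \<le> 1 / s ^ CARD('n) * m"
    using s fin(2) by (subst (asm) ennreal_le_iff) auto
  obtain c A where A: "A = - transpose A" and
    le: "(\<Sum>k\<in>UNIV. gnormsq (\<lambda>x. ?v x $ k - c $ k - (A *v x) $ k)) \<le> 2 * Y + e"
    using gaussian_poincare_korn_L2[OF dv Lv LS e] unfolding Y_def by blast
  have rA: "rpoly (\<lambda>x. (A *v x) $ k)" for k
    by (auto simp: matrix_vector_mult_def intro!: rpoly_intros)
  have "L2g (\<lambda>x. (?v x - c - A *v x) $ k)" for k
    by (simp only: vector_minus_component) (intro L2g_diff Lv L2g_const L2g_rpoly[OF rA])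
  from L2_sq_vec_ginner[OF this] le Y
  have "L2_sq_vec std_gaussian (\<lambda>x. ?v x - c - A *v x) \<le> ennreal (2 * (1 / s ^ CARD('n)) * m + e)"
    by (auto intro!: ennreal_leI)
  then show ?thesis using A by blast
qed

section \<open>Removing the dilation\<close>

lemma integral_affine_square:
  fixes c :: "real ^ 'n" and A :: "real ^ 'n ^ 'n"
  shows "integrable std_gaussian (\<lambda>x. (norm (c + A *v x))\<^sup>2)"
    and "(LINT x|std_gaussian. (norm (c + A *v x))\<^sup>2) = (norm c)\<^sup>2 + (norm A)\<^sup>2"
proof -
  have n: "(norm y)\<^sup>2 = (\<Sum>k\<in>UNIV. (y $ k)\<^sup>2)" for y :: "real ^ 'n"
    by (simp add: norm_vec_def L2_set_def sum_nonneg)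
  define f where "f k x = c $ k + (\<Sum>l\<in>UNIV. A $ k $ l * x $ l)" for k and x :: "real ^ 'n"
  have f: "(norm (c + A *v x))\<^sup>2 = (\<Sum>k\<in>UNIV. f k x * f k x)" for x
    by (simp add: n f_def matrix_vector_mult_def) (simp add: power2_eq_square)
  have Lx: "L2g (\<lambda>x. x $ l)" for l by (rule Herm_L2g[OF component_Herm])
  have Lf: "L2g (f k)" for k unfolding f_def[abs_def] by (intro L2g_add L2g_const L2g_sum L2g_cmult Lx)
  show "integrable std_gaussian (\<lambda>x. (norm (c + A *v x))\<^sup>2)"
    unfolding f by (intro Bochner_Integration.integrable_sum L2g_mult_integrable Lf)
  have "ginner (f k) (f k) = (c $ k)\<^sup>2 + (\<Sum>l\<in>UNIV. (A $ k $ l)\<^sup>2)" for k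
  proof -
    have lin: "(\<lambda>x. \<Sum>l\<in>UNIV. A $ k $ l * x $ l) \<in> Herm 1" by (intro Herm_sum Herm.cmult component_Herm)
    have "ginner (f k) (f k) = ginner (\<lambda>x. c $ k) (\<lambda>x :: real ^ 'n. c $ k) + gnormsq (\<lambda>x. \<Sum>l\<in>UNIV. A $ k $ l * x $ l)"
      unfolding f_def[abs_def] using Herm_orth[OF const_Herm[of "c $ k"] lin] by (simp add: ginner_add_self L2g_const Herm_L2g[OF lin])
    also have "ginner (\<lambda>x. c $ k) (\<lambda>x :: real ^ 'n. c $ k) = (c $ k)\<^sup>2"
      by (simp add: ginner_def std_gaussian.prob_space[simplified] power2_eq_square)
    also have "gnormsq (\<lambda>x. \<Sum>l\<in>UNIV. A $ k $ l * x $ l)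
       = (\<Sum>l\<in>UNIV. A $ k $ l * (\<Sum>l'\<in>UNIV. A $ k $ l' * ginner (\<lambda>x. x $ l) (\<lambda>x. x $ l')))"
      by (simp add: ginner_sum_left ginner_sum_right ginner_cmult_left ginner_cmult_right L2g_sum L2g_cmult Lx)
    also have "\<dots> = (\<Sum>l\<in>UNIV. (A $ k $ l)\<^sup>2)"
      by (simp add: ginner_component if_distrib sum.delta' power2_eq_square cong: if_cong)
    finally show ?thesis .
  qed
  then show "(LINT x|std_gaussian. (norm (c + A *v x))\<^sup>2) = (norm c)\<^sup>2 + (norm A)\<^sup>2"
    unfolding f by (simp add: L2g_mult_integrable Lf ginner_def[symmetric] sum.distrib n sum_squares_matrix[symmetric])
qed

text \<open>Lets a subsequence of the affine corrections for \<open>u (\<sigma> x)\<close> converge as \<open>\<sigma>\<close> tends to \<open>1\<close>.\<close>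

lemma affine_part_bounded:
  fixes B :: "real \<Rightarrow> real"
  shows "\<exists>C. \<forall>(w :: real ^ 'n \<Rightarrow> real ^ 'n) c A. w \<in> borel_measurable borel \<longrightarrow>
    (\<forall>r x. norm x \<le> r \<longrightarrow> norm (w x) \<le> B r) \<longrightarrow>
    L2_sq_vec std_gaussian (\<lambda>x. w x - c - A *v x) \<le> ennreal K \<longrightarrow> (norm c)\<^sup>2 + (norm A)\<^sup>2 \<le> C"
proof -
  \<comment> \<open>Outside the ball of radius \<open>R\<close> the square of an affine field is at
    most a multiple of \<open>h x / R\<^sup>2\<close>, by inserting the factor
    \<open>(norm x)\<^sup>2 / R\<^sup>2\<close>.\<close>
  define h where "h x = (1 + (norm x)\<^sup>2) * (norm x)\<^sup>2" for x :: "real ^ 'n"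
  have h0: "h x \<ge> 0" for x by (simp add: h_def)
  have "rpoly (\<lambda>x :: real ^ 'n. x \<bullet> x)" unfolding inner_vec_def inner_real_def by (intro rpoly_intros finite)
  then have "rpoly h" unfolding h_def[abs_def] power2_norm_eq_inner
    by (intro rpoly_intros)
  then have ih: "integrable std_gaussian h" by (rule rpoly_integrable)
  define m where "m = (LINT x|std_gaussian. h x)"
  have m: "m \<ge> 0" unfolding m_def by (intro integral_nonneg_AE) (simp add: h0)
  \<comment> \<open>Large enough that the region outside the ball contributes at most
    \<open>t / 2\<close>, which is absorbed on the left.\<close>
  define R where "R = sqrt (4 * m + 1)"
  have R2: "R\<^sup>2 = 4 * m + 1" using m by (simp add: R_def)
  have R: "R > 0" using m by (simp add: R_def)
  have "(norm c)\<^sup>2 + (norm A)\<^sup>2 \<le> 4 * max 0 K + 4 * (B R)\<^sup>2"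
    if [measurable]: "w \<in> borel_measurable borel" and B: "\<And>r x. norm x \<le> r \<Longrightarrow> norm (w x) \<le> B r"
      and K: "L2_sq_vec std_gaussian (\<lambda>x. w x - c - A *v x) \<le> ennreal K"
    for w :: "real ^ 'n \<Rightarrow> real ^ 'n" and c A
  proof -
    define t where "t = (norm c)\<^sup>2 + (norm A)\<^sup>2"
    have t: "t \<ge> 0" by (simp add: t_def)
    define f where "f x = (norm (w x - c - A *v x))\<^sup>2" for x
    have [measurable]: "f \<in> borel_measurable borel" unfolding f_def[abs_def] by measurable
    have fin: "(\<integral>\<^sup>+x. ennreal (f x) \<partial>std_gaussian) \<le> ennreal K" using K by (simp add: L2_sq_vec_def f_def)
    have fint: "integrable std_gaussian f"
      using fin by (intro integrableI_nonneg) (auto simp: f_def measurable_cong_sets[OF sets_std_gaussian refl] intro: le_less_trans)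
    have "ennreal (LINT x|std_gaussian. f x) \<le> ennreal K"
    proof -
      have "(\<integral>\<^sup>+x. ennreal (f x) \<partial>std_gaussian) = ennreal (LINT x|std_gaussian. f x)"
        by (rule nn_integral_eq_integral[OF fint]) (simp add: f_def)
      then show ?thesis using fin by (simp only:)
    qed
    then have fK: "(LINT x|std_gaussian. f x) \<le> max 0 K"
      by (metis ennreal_le_iff2 max.cobounded1 max.coboundedI2 order_trans)
    have pt: "(norm (c + A *v x))\<^sup>2 \<le> 2 * f x + 2 * (B R)\<^sup>2 + (2 * t / R\<^sup>2) * h x" for x
    proof (cases "norm x \<le> R")
      case True
      have "norm (c + A *v x) = norm (w x - (w x - c - A *v x))" by (simp add: algebra_simps)
      also have "\<dots> \<le> norm (w x) + norm (w x - c - A *v x)" by (rule norm_triangle_ineq4)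
      also have "\<dots> \<le> B R + norm (w x - c - A *v x)" using B[OF True] by simp
      finally have "(norm (c + A *v x))\<^sup>2 \<le> (B R + norm (w x - c - A *v x))\<^sup>2" by (rule power_mono) simp
      also have "\<dots> \<le> 2 * (B R)\<^sup>2 + 2 * f x"
        using sum_squares_bound[of "B R" "norm (w x - c - A *v x)"] by (simp add: f_def power2_sum)
      moreover have "(2 * t / R\<^sup>2) * h x \<ge> 0" using t h0 by simp
      ultimately show ?thesis by simp
    next
      case False
      have "norm (c + A *v x) \<le> norm c + norm (A *v x)" by (rule norm_triangle_ineq)
      also have "\<dots> \<le> norm c + norm A * norm x" by (simp add: norm_matrix_vector_mult_le)
      finally have "(norm (c + A *v x))\<^sup>2 \<le> (norm c + norm A * norm x)\<^sup>2" by (rule power_mono) simp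
      also have "\<dots> \<le> 2 * (norm c)\<^sup>2 + 2 * ((norm A)\<^sup>2 * (norm x)\<^sup>2)"
        using sum_squares_bound[of "norm c" "norm A * norm x"] by (simp add: power2_sum power_mult_distrib algebra_simps)
      also have "\<dots> \<le> 2 * t * (1 + (norm x)\<^sup>2)"
        by (simp add: t_def algebra_simps)
      also have "\<dots> \<le> 2 * t * ((1 + (norm x)\<^sup>2) * ((norm x)\<^sup>2 / R\<^sup>2))"
      proof (intro mult_left_mono)
        have "1 \<le> (norm x)\<^sup>2 / R\<^sup>2"
          using False R by (simp add: power_mono)
        then show "1 + (norm x)\<^sup>2 \<le> (1 + (norm x)\<^sup>2) * ((norm x)\<^sup>2 / R\<^sup>2)"
          using mult_left_mono[of 1 "(norm x)\<^sup>2 / R\<^sup>2" "1 + (norm x)\<^sup>2"] by simp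
      qed (use t in auto)
      also have "\<dots> = (2 * t / R\<^sup>2) * h x" by (simp add: h_def)
      finally have "(norm (c + A *v x))\<^sup>2 \<le> (2 * t / R\<^sup>2) * h x" .
      moreover have "f x \<ge> 0" "(B R)\<^sup>2 \<ge> 0" by (auto simp: f_def)
      ultimately show ?thesis by linarith
    qed
    have "t = (LINT x|std_gaussian. (norm (c + A *v x))\<^sup>2)"
      by (simp add: integral_affine_square t_def)
    also have "\<dots> \<le> (LINT x|std_gaussian. 2 * f x + 2 * (B R)\<^sup>2 + (2 * t / R\<^sup>2) * h x)"
      using fint ih by (intro integral_mono integral_affine_square pt) auto
    also have "\<dots> = 2 * (LINT x|std_gaussian. f x) + 2 * (B R)\<^sup>2 + (2 * t / R\<^sup>2) * m"
      using fint ih by (simp add: m_def std_gaussian.prob_space[simplified])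
    also have "(2 * t / R\<^sup>2) * m \<le> t / 2"
      using t m by (simp add: R2 field_simps)
    finally have "t \<le> 2 * (LINT x|std_gaussian. f x) + 2 * (B R)\<^sup>2 + t / 2" by simp
    moreover define q where "q = max 0 K"
    ultimately have "t \<le> 4 * q + 4 * (B R)\<^sup>2" using fK unfolding q_def[symmetric] by linarith
    then show ?thesis by (simp add: t_def q_def)
  qed
  then show ?thesis by (intro exI[of _ "4 * max 0 K + 4 * (B R)\<^sup>2"]) blast
qed

text \<open>Compactness for the finitely many affine parameters and Fatou for the fields. That
  \<open>u\<close> itself is square integrable comes out of the limit.\<close>

theorem gaussian_poincare_korn_affine:
  fixes u :: "real ^ 'n \<Rightarrow> real ^ 'n"
  assumes d: "\<And>x. u differentiable (at x)"
    and fin: "L2_sq_mat std_gaussian (sym_grad u) = ennreal m" "m \<ge> 0"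
  shows "\<exists>c A. A = - transpose A \<and> L2_sq_vec std_gaussian (\<lambda>x. u x - c - A *v x) \<le> ennreal (2 * m)"
proof -
  have cont: "continuous_on UNIV u"
    using d by (simp add: continuous_on_eq_continuous_at differentiable_imp_continuous_within)
  have [measurable]: "u \<in> borel_measurable borel" by (rule differentiable_imp_measurable[OF d])
  \<comment> \<open>Starting at 1/2 bounds \<open>1 / s j ^ CARD('n)\<close> by
    \<open>2 ^ CARD('n)\<close>, so that a single \<open>K\<close> serves all
    \<open>j\<close>.\<close>
  define s where "s j = 1 - inverse (real (Suc (Suc j)))" for j
  have s: "0 < s j" "s j < 1" "1 / 2 \<le> s j" for j by (auto simp: s_def field_simps)
  have s_lim: "s \<longlonglongrightarrow> 1"
    unfolding s_def using tendsto_diff[OF tendsto_const[of 1] LIMSEQ_Suc[OF LIMSEQ_inverse_real_of_nat]] by simp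
  define b where "b j = 2 * (1 / s j ^ CARD('n)) * m + inverse (real (Suc j))" for j
  have "\<forall>j. \<exists>c A. A = - transpose A \<and> L2_sq_vec std_gaussian (\<lambda>x. u (s j *\<^sub>R x) - c - A *v x) \<le> ennreal (b j)"
    unfolding b_def using poincare_korn_scaled[OF d s(1,2) _ fin] by simp
  from choice[OF this] obtain c where
    "\<forall>j. \<exists>A. A = - transpose A \<and> L2_sq_vec std_gaussian (\<lambda>x. u (s j *\<^sub>R x) - c j - A *v x) \<le> ennreal (b j)" ..
  from choice[OF this] obtain A where
    "\<forall>j. A j = - transpose (A j) \<and> L2_sq_vec std_gaussian (\<lambda>x. u (s j *\<^sub>R x) - c j - A j *v x) \<le> ennreal (b j)" ..
  then have A: "\<And>j. A j = - transpose (A j)"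
    and cA: "\<And>j. L2_sq_vec std_gaussian (\<lambda>x. u (s j *\<^sub>R x) - c j - A j *v x) \<le> ennreal (b j)"
    by blast+
  have b_lim: "b \<longlonglongrightarrow> 2 * m"
  proof -
    have "b \<longlonglongrightarrow> 2 * (1 / 1 ^ CARD('n)) * m + 0"
      unfolding b_def by (intro tendsto_intros s_lim LIMSEQ_inverse_real_of_nat) auto
    then show ?thesis by simp
  qed
  define K where "K = 2 * 2 ^ CARD('n) * m + 1"
  have bK: "b j \<le> K" for j
  proof -
    have "(1 / s j) ^ CARD('n) \<le> 2 ^ CARD('n)"
      using s[of j] by (intro power_mono) (auto simp: field_simps)
    then have "2 * (1 / s j ^ CARD('n)) * m \<le> 2 * 2 ^ CARD('n) * m"
      using fin(2) by (intro mult_right_mono) (auto simp: power_one_over)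
    moreover have "inverse (real (Suc j)) \<le> 1" by (simp add: field_simps)
    ultimately show ?thesis unfolding b_def K_def by linarith
  qed
  have "\<forall>r. \<exists>B. \<forall>x. norm x \<le> r \<longrightarrow> norm (u x) \<le> B"
  proof
    fix r
    have "bounded (u ` cball 0 r)"
      by (intro compact_imp_bounded compact_continuous_image continuous_on_subset[OF cont]) auto
    then obtain a where "\<forall>y\<in>u ` cball 0 r. norm y \<le> a" unfolding bounded_iff ..
    then show "\<exists>B. \<forall>x. norm x \<le> r \<longrightarrow> norm (u x) \<le> B" by (intro exI[of _ a]) auto
  qed
  then obtain B where B: "\<And>r x. norm x \<le> r \<Longrightarrow> norm (u x) \<le> B r" by metis
  obtain C where C: "\<forall>(w :: real ^ 'n \<Rightarrow> real ^ 'n) c A. w \<in> borel_measurable borel \<longrightarrow>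
    (\<forall>r x. norm x \<le> r \<longrightarrow> norm (w x) \<le> B r) \<longrightarrow>
    L2_sq_vec std_gaussian (\<lambda>x. w x - c - A *v x) \<le> ennreal K \<longrightarrow> (norm c)\<^sup>2 + (norm A)\<^sup>2 \<le> C"
    using affine_part_bounded[of B K] ..
  have "(norm (c j))\<^sup>2 + (norm (A j))\<^sup>2 \<le> C" for j
  proof (rule C[rule_format, of "\<lambda>x. u (s j *\<^sub>R x)"])
    \<comment> \<open>A dilation by at most 1 maps each ball into itself, so the local bound
      \<open>B\<close> of \<open>u\<close> holds for every dilated field.\<close>
    show "norm (u (s j *\<^sub>R x)) \<le> B r" if "norm x \<le> r" for r x
    proof (rule B)
      have "norm (s j *\<^sub>R x) \<le> norm x" using s[of j] by (simp add: mult_left_le_one_le)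
      then show "norm (s j *\<^sub>R x) \<le> r" using that by simp
    qed
    show "L2_sq_vec std_gaussian (\<lambda>x. u (s j *\<^sub>R x) - c j - A j *v x) \<le> ennreal K"
      by (rule order_trans[OF cA ennreal_leI[OF bK]])
  qed measurable
  then have "norm (c j, A j) \<le> sqrt C" for j by (simp add: norm_Pair)
  then have "bounded (range (\<lambda>j. (c j, A j)))" by (auto simp: bounded_iff)
  then obtain l \<phi> where \<phi>: "strict_mono \<phi>" "((\<lambda>j. (c j, A j)) \<circ> \<phi>) \<longlonglongrightarrow> l"
    using bounded_imp_convergent_subsequence by blast
  define c0 A0 where "c0 = fst l" and "A0 = snd l"
  have c0: "(\<lambda>j. c (\<phi> j)) \<longlonglongrightarrow> c0" and A0: "(\<lambda>j. A (\<phi> j)) \<longlonglongrightarrow> A0"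
    using tendsto_fst[OF \<phi>(2)] tendsto_snd[OF \<phi>(2)] by (simp_all add: c0_def A0_def o_def)
  have A0n: "(\<lambda>j. A (\<phi> j) $ k $ i) \<longlonglongrightarrow> A0 $ k $ i" for k i
    by (intro tendsto_vec_nth A0)
  have "A0 $ k $ i = - A0 $ i $ k" for k i
  proof -
    have "A (\<phi> j) $ k $ i = - A (\<phi> j) $ i $ k" for j
      using arg_cong[OF A[of "\<phi> j"], of "\<lambda>M. M $ k $ i"] by (simp add: transpose_def)
    then have eq: "(\<lambda>j. A (\<phi> j) $ k $ i) = (\<lambda>j. - A (\<phi> j) $ i $ k)" by (rule ext)
    have "(\<lambda>j. A (\<phi> j) $ k $ i) \<longlonglongrightarrow> - A0 $ i $ k"
      unfolding eq by (rule tendsto_minus[OF A0n[of i k]])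
    from LIMSEQ_unique[OF A0n[of k i] this] show ?thesis .
  qed
  moreover have "(- transpose A0) $ k $ i = - A0 $ i $ k" for k i
    by (simp add: transpose_def)
  ultimately have "A0 $ k $ i = (- transpose A0) $ k $ i" for k i
    by (rule trans[OF _ sym])
  then have skew: "A0 = - transpose A0"
    by (intro vec_eq_iff[THEN iffD2] allI)
  define f where "f j x = ennreal ((norm (u (s (\<phi> j) *\<^sub>R x) - c (\<phi> j) - A (\<phi> j) *v x))\<^sup>2)" for j x
  have [measurable]: "f j \<in> borel_measurable borel" for j
    unfolding f_def[abs_def] by measurable
  have "(\<lambda>j. f j x) \<longlonglongrightarrow> ennreal ((norm (u x - c0 - A0 *v x))\<^sup>2)" for x
  proof -
    have "(\<lambda>j. s (\<phi> j) *\<^sub>R x) \<longlonglongrightarrow> 1 *\<^sub>R x"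
      using LIMSEQ_subseq_LIMSEQ[OF s_lim \<phi>(1)] by (intro tendsto_intros) (simp add: o_def)
    moreover have "isCont u x" using d differentiable_imp_continuous_within by blast
    ultimately have "(\<lambda>j. u (s (\<phi> j) *\<^sub>R x)) \<longlonglongrightarrow> u x"
      using isCont_tendsto_compose[of x u] by simp
    moreover have "(\<lambda>j. A (\<phi> j) *v x) \<longlonglongrightarrow> A0 *v x"
      unfolding matrix_vector_mult_def by (intro tendsto_vec_lambda tendsto_intros A0n)
    ultimately show ?thesis unfolding f_def by (intro tendsto_ennrealI tendsto_intros c0)
  qed
  then have "liminf (\<lambda>j. f j x) = ennreal ((norm (u x - c0 - A0 *v x))\<^sup>2)" for x
    by (intro lim_imp_Liminf) auto
  then have "L2_sq_vec std_gaussian (\<lambda>x. u x - c0 - A0 *v x) = (\<integral>\<^sup>+x. liminf (\<lambda>j. f j x) \<partial>std_gaussian)"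
    by (simp add: L2_sq_vec_def)
  \<comment> \<open>Fatou's lemma: only an upper bound is wanted, and no dominating function for the
    dilated fields is at hand.\<close>
  also have "\<dots> \<le> liminf (\<lambda>j. \<integral>\<^sup>+x. f j x \<partial>std_gaussian)"
    by (rule nn_integral_liminf) (simp add: measurable_cong_sets[OF sets_std_gaussian refl])
  also have "\<dots> \<le> liminf (\<lambda>j. ennreal (b (\<phi> j)))"
    using cA by (intro Liminf_mono) (simp add: f_def L2_sq_vec_def)
  also have "\<dots> = ennreal (2 * m)"
    using LIMSEQ_subseq_LIMSEQ[OF b_lim \<phi>(1)] by (intro lim_imp_Liminf tendsto_ennrealI) (auto simp: o_def)
  finally show ?thesis using skew by blast
qed

theorem C_PK_std_gaussian_le_1: "C_PK (std_gaussian :: (real ^ 'n) measure) \<le> 1"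
proof -
  have "(INF a\<in>skew_maps. L2_sq_vec std_gaussian (\<lambda>x. u x - a x)) \<le> ennreal (2 * 1) * L2_sq_mat std_gaussian (sym_grad u)"
    if u: "u \<in> PK_class std_gaussian" for u :: "real ^ 'n \<Rightarrow> real ^ 'n"
  proof -
    have d: "\<And>x. u differentiable (at x)" and mean: "has_bochner_integral std_gaussian u 0"
      and fin: "L2_sq_mat std_gaussian (sym_grad u) < \<infinity>" using u by (auto simp: PK_class_def)
    note [measurable] = differentiable_imp_measurable[OF d]
    obtain m where m: "L2_sq_mat std_gaussian (sym_grad u) = ennreal m" "m \<ge> 0"
      using fin by (cases "L2_sq_mat std_gaussian (sym_grad u)") auto
    obtain c A where A: "A = - transpose A" and
      le: "L2_sq_vec std_gaussian (\<lambda>x. u x - c - A *v x) \<le> ennreal (2 * m)"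
      using gaussian_poincare_korn_affine[OF d m] by blast
    define f where "f k x = (u x - c - A *v x) $ k" for k x
    define g where "g k x = (u x - A *v x) $ k" for k x
    have "(\<lambda>x. u x - c - A *v x) \<in> borel_measurable borel" by measurable
    then have Lf: "L2g (\<lambda>x. (u x - c - A *v x) $ k)" for k
      using le by (intro L2g_from_L2_sq_vec) (auto intro: le_less_trans)
    then have Lf': "L2g (f k)" for k by (simp add: f_def[abs_def])
    have gf: "g k = (\<lambda>x. f k x + c $ k)" for k by (auto simp: g_def f_def)
    have Lg: "L2g (g k)" for k unfolding gf by (intro L2g_add Lf' L2g_const)
    have g0: "ginner (g k) (\<lambda>x. c $ k) = 0" for k
    proof -
      have 1: "integrable std_gaussian (\<lambda>x. u x $ k)" "(LINT x|std_gaussian. u x $ k) = 0"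
        using has_bochner_integral_bounded_linear[OF bounded_linear_vec_nth mean, of k]
        by (auto simp: has_bochner_integral_iff)
      have Lx: "(LINT x|std_gaussian. x $ l) = 0" for l :: 'n
        using Herm_orth[OF component_Herm[of l] const_Herm[of 1]] by (simp add: ginner_def)
      have ix: "integrable std_gaussian (\<lambda>x :: real ^ 'n. x $ l)" for l by (intro rpoly_integrable rpoly_component)
      have "(LINT x|std_gaussian. g k x) = 0"
        using 1 ix by (simp add: g_def matrix_vector_mult_def Lx)
      then show ?thesis by (simp add: ginner_def)
    qed
    \<comment> \<open>\<open>g k\<close> has mean zero because \<open>u\<close> and linear maps do;
      subtracting a constant from it can only increase the norm.\<close>
    have "ginner (g k) (g k) \<le> ginner (f k) (f k)" for k
    proof -
      have "f k = (\<lambda>x. g k x - c $ k)" by (auto simp: g_def f_def)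
      then have "ginner (f k) (f k) = ginner (g k) (g k) - 2 * ginner (g k) (\<lambda>x. c $ k) + ginner (\<lambda>x. c $ k) (\<lambda>x :: real ^ 'n. c $ k)"
        by (simp add: ginner_diff_self Lg L2g_const)
      then show ?thesis using g0[of k] ginner_nonneg[of "\<lambda>x. c $ k"] by simp
    qed
    then have "ennreal (\<Sum>k\<in>UNIV. ginner (g k) (g k)) \<le> ennreal (\<Sum>k\<in>UNIV. ginner (f k) (f k))"
      by (intro ennreal_leI sum_mono)
    then have "L2_sq_vec std_gaussian (\<lambda>x. u x - A *v x) \<le> L2_sq_vec std_gaussian (\<lambda>x. u x - c - A *v x)"
      using L2_sq_vec_ginner[of "\<lambda>x. u x - A *v x"] L2_sq_vec_ginner[of "\<lambda>x. u x - c - A *v x"] Lf Lg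
      unfolding f_def[abs_def] g_def[abs_def] by simp
    also note le
    also have "ennreal (2 * m) = ennreal (2 * 1) * L2_sq_mat std_gaussian (sym_grad u)"
      using m by (simp add: ennreal_mult)
    finally have "L2_sq_vec std_gaussian (\<lambda>x. u x - A *v x) \<le> ennreal (2 * 1) * L2_sq_mat std_gaussian (sym_grad u)" .
    moreover have "(\<lambda>x. A *v x) \<in> skew_maps" unfolding skew_maps_def using A by blast
    ultimately show ?thesis by (intro INF_lower2[of "\<lambda>x. A *v x"])
  qed
  then have "C_PK (std_gaussian :: (real ^ 'n) measure) \<le> ennreal 1"
    unfolding C_PK_def by (intro Inf_lower) (auto intro!: exI[of _ 1])
  then show ?thesis by simp
qed

section \<open>First variation at an extremal field\<close>

lemma jacobian_nth:
  fixes u :: "real ^ 'n \<Rightarrow> real ^ 'm"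
  assumes "(u has_derivative u') (at x)"
  shows "jacobian u (at x) $ k $ l = u' (axis l 1) $ k"
  using frechet_derivative_at[OF assms] by (simp add: jacobian_def matrix_def)

text \<open>The infimum supplies admissible constants only below each \<open>K' > K\<close>; the
  bound for \<open>K\<close> follows by letting \<open>K'\<close> decrease to
  \<open>K\<close>.\<close>

lemma C_PK_le_imp:
  assumes u: "u \<in> PK_class \<mu>" and b: "\<And>a. a \<in> skew_maps \<Longrightarrow> ennreal b \<le> L2_sq_vec \<mu> (\<lambda>x. u x - a x)"
    and s: "L2_sq_mat \<mu> (sym_grad u) = ennreal s" "s \<ge> 0"
    and K: "C_PK \<mu> \<le> ennreal K" "K \<ge> 0"
  shows "b \<le> 2 * K * s"
proof -
  have *: "b \<le> 2 * K' * s" if "K < K'" for K'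
  proof -
    have "C_PK \<mu> < ennreal K'" using K that by (auto intro: le_less_trans simp: ennreal_less_iff)
    then obtain C where C: "C \<ge> 0" "ennreal C < ennreal K'"
      and le: "\<forall>u\<in>PK_class \<mu>. (INF a\<in>skew_maps. L2_sq_vec \<mu> (\<lambda>x. u x - a x)) \<le> ennreal (2 * C) * L2_sq_mat \<mu> (sym_grad u)"
      unfolding C_PK_def Inf_less_iff by blast
    have "ennreal b \<le> (INF a\<in>skew_maps. L2_sq_vec \<mu> (\<lambda>x. u x - a x))"
      by (intro INF_greatest b)
    also have "\<dots> \<le> ennreal (2 * C) * ennreal s" using le u s by auto
    also have "\<dots> = ennreal (2 * C * s)" using C s by (simp add: ennreal_mult)
    finally have "b \<le> 2 * C * s" using C s by (subst (asm) ennreal_le_iff) auto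
    also have "\<dots> \<le> 2 * K' * s" using C s by (intro mult_right_mono) (auto simp: ennreal_less_iff)
    finally show ?thesis .
  qed
  show ?thesis
  proof (cases "s = 0")
    case True
    then show ?thesis using *[of "K + 1"] by simp
  next
    case False
    have "b / (2 * s) \<le> K"
    proof (rule dense_ge)
      fix K' assume "K < K'"
      from *[OF this] show "b / (2 * s) \<le> K'" using s False by (simp add: field_simps)
    qed
    then show ?thesis using s False by (simp add: field_simps)
  qed
qed

text \<open>\<open>f\<close> may change sign. This admits lower bounds that contain terms linear in
  the perturbation.\<close>

lemma ennreal_integral_le_nn_integral:
  fixes f :: "'a \<Rightarrow> real"
  assumes "integrable M f"
  shows "ennreal (LINT x|M. f x) \<le> (\<integral>\<^sup>+x. ennreal (f x) \<partial>M)"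
proof -
  have "ennreal (LINT x|M. f x) \<le> ennreal (LINT x|M. max 0 (f x))"
    using assms by (intro ennreal_leI integral_mono) auto
  also have "\<dots> = (\<integral>\<^sup>+x. ennreal (max 0 (f x)) \<partial>M)"
    using assms by (subst nn_integral_eq_integral) auto
  also have "\<dots> = (\<integral>\<^sup>+x. ennreal (f x) \<partial>M)"
    by (intro nn_integral_cong) (simp add: max_def ennreal_neg)
  finally show ?thesis .
qed

section \<open>From a Stein identity to the characteristic function\<close>

lemma integrable_mult_bounded:
  fixes f g :: "'a \<Rightarrow> real"
  assumes f: "integrable M f" and [measurable]: "g \<in> borel_measurable M" and B: "\<And>x. \<bar>g x\<bar> \<le> B"
  shows "integrable M (\<lambda>x. f x * g x)"
proof (rule Bochner_Integration.integrable_bound)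
  show "integrable M (\<lambda>x. B * f x)" using f by simp
  have "B \<ge> 0" using B[of undefined] by linarith
  then show "AE x in M. norm (f x * g x) \<le> norm (B * f x)"
    using B by (auto simp: abs_mult mult.commute[of B] intro!: mult_left_mono)
  show "(\<lambda>x. f x * g x) \<in> borel_measurable M" using f by measurable
qed

text \<open>Fubini on the unit interval times the probability space takes the place of
  differentiation under the integral.\<close>

lemma expectation_derivative_eq_0:
  fixes f f' :: "real \<Rightarrow> 'a \<Rightarrow> real"
  assumes M: "prob_space M"
    and der: "\<And>t x. ((\<lambda>t. f t x) has_real_derivative f' t x) (at t)"
    and [measurable]: "(\<lambda>(t, x). f' t x) \<in> borel_measurable (borel \<Otimes>\<^sub>M M)"
    and w: "integrable M w" "\<And>t x. 0 \<le> t \<Longrightarrow> t \<le> 1 \<Longrightarrow> \<bar>f' t x\<bar> \<le> w x"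
    and zero: "\<And>t. 0 \<le> t \<Longrightarrow> t \<le> 1 \<Longrightarrow> (LINT x|M. f' t x) = 0"
    and int: "integrable M (f 0)" "integrable M (f 1)"
  shows "(LINT x|M. f 1 x) = (LINT x|M. f 0 x)"
proof -
  interpret prob_space M by fact
  interpret P: pair_sigma_finite lborel M ..
  define F where "F = (\<lambda>(t, x). indicator {0..1::real} t * f' t x)"
  have [measurable]: "w \<in> borel_measurable M" using w by auto
  have Fm [measurable]: "F \<in> borel_measurable (lborel \<Otimes>\<^sub>M M)" unfolding F_def split_beta' by measurable
  have Fw: "\<bar>F (t, x)\<bar> \<le> indicator {0..1} t * \<bar>w x\<bar>" for t x
    using w(2)[of t x] by (auto simp: F_def indicator_def)
  have "(\<integral>\<^sup>+z. ennreal (norm (F z)) \<partial>(lborel \<Otimes>\<^sub>M M)) = (\<integral>\<^sup>+t. (\<integral>\<^sup>+x. ennreal (norm (F (t, x))) \<partial>M) \<partial>lborel)"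
    by (rule nn_integral_fst[symmetric]) measurable
  also have "\<dots> \<le> (\<integral>\<^sup>+t. (\<integral>\<^sup>+x. indicator {0..1::real} t * ennreal \<bar>w x\<bar> \<partial>M) \<partial>lborel)"
  proof (intro nn_integral_mono)
    fix t x
    show "ennreal (norm (F (t, x))) \<le> indicator {0..1::real} t * ennreal \<bar>w x\<bar>"
      using Fw[of t x] by (cases "t \<in> {0..1}") (auto intro: ennreal_leI)
  qed
  also have "\<dots> = (\<integral>\<^sup>+x. ennreal \<bar>w x\<bar> \<partial>M)" by (simp add: nn_integral_cmult nn_integral_multc)
  also have "\<dots> < \<infinity>" using w(1) by (simp add: integrable_iff_bounded)
  finally have intF: "integrable (lborel \<Otimes>\<^sub>M M) F" by (intro integrableI_bounded) measurable
  have F1: "(LINT t|lborel. F (t, x)) = f 1 x - f 0 x" if x: "x \<in> space M" for x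
  proof -
    have "integrable lborel (\<lambda>t. indicator {0..1::real} t * \<bar>w x\<bar>)" by simp
    moreover have "(\<lambda>t. F (t, x)) \<in> borel_measurable lborel"
      using x by measurable
    ultimately have "integrable lborel (\<lambda>t. F (t, x))"
      by (rule Bochner_Integration.integrable_bound) (use Fw in \<open>auto simp: abs_mult\<close>)
    then show ?thesis
      using integral_01_derivative[of "\<lambda>t. f t x" "\<lambda>t. f' t x"] der by (simp add: F_def)
  qed
  have "(LINT x|M. f 1 x) - (LINT x|M. f 0 x) = (LINT x|M. f 1 x - f 0 x)"
    using int by simp
  also have "\<dots> = (LINT x|M. (LINT t|lborel. F (t, x)))"
    by (intro Bochner_Integration.integral_cong refl) (simp add: F1)
  also have "\<dots> = (LINT t|lborel. (LINT x|M. F (t, x)))"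
    using P.Fubini_integral[of "\<lambda>t x. F (t, x)"] intF by simp
  also have "\<dots> = (LINT t|lborel. (0 :: real))"
  proof -
    have "(LINT x|M. F (t, x)) = 0" for t
      using zero[of t] by (cases "t \<in> {0..1}") (auto simp: F_def)
    then show ?thesis by simp
  qed
  finally show ?thesis by simp
qed

text \<open>Let g(t) be the expectation of cos (t y + \<theta>), where y is the product of \<xi>
  with x and s = |\<xi>|^2. The hypothesis, contracted twice with \<xi>, says (g' + t s g)' = 0.
  Mean zero gives g'(0) = 0, hence g' = - t s g, and exp (t^2 s / 2) g is constant.\<close>

lemma expectation_cos:
  fixes M :: "(real ^ 'n) measure"
  assumes M: "prob_space M" "sets M = sets borel"
    and x1: "\<And>i. integrable M (\<lambda>x. x $ i)" "\<And>i. (LINT x|M. x $ i) = 0"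
    and x2: "\<And>i k. integrable M (\<lambda>x. x $ i * x $ k)"
    and stein: "\<And>i k \<eta> \<theta>. (LINT x|M. x $ i * x $ k * cos (\<eta> \<bullet> x + \<theta>)) - (if i = k then (LINT x|M. cos (\<eta> \<bullet> x + \<theta>)) else 0)
       = - (\<eta> $ k * (LINT x|M. x $ i * sin (\<eta> \<bullet> x + \<theta>)))"
  shows "(LINT x|M. cos (\<xi> \<bullet> x + \<theta>)) = exp (- (\<xi> \<bullet> \<xi>) / 2) * cos \<theta>"
proof -
  interpret prob_space M by fact
  note [measurable_cong] = M(2)
  have m_eq: "borel_measurable M = borel_measurable borel" by (rule measurable_cong_sets[OF M(2) refl])
  define s where "s = \<xi> \<bullet> \<xi>"
  define y where "y x = \<xi> \<bullet> x" for x
  have ym [measurable]: "y \<in> borel_measurable borel" unfolding y_def[abs_def] by measurable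
  have s0: "s \<ge> 0" by (simp add: s_def)
  have y1: "y x = (\<Sum>i\<in>UNIV. \<xi> $ i * x $ i)" for x by (simp add: y_def inner_vec_def)
  have y2: "(y x)\<^sup>2 = (\<Sum>i\<in>UNIV. \<Sum>k\<in>UNIV. \<xi> $ i * \<xi> $ k * (x $ i * x $ k))" for x
    by (simp add: y1 power2_eq_square sum_product algebra_simps)
  have iy: "integrable M y" unfolding y1[abs_def] using x1 by simp
  have iy2: "integrable M (\<lambda>x. (y x)\<^sup>2)" unfolding y2 using x2 by simp
  have Ey: "(LINT x|M. y x) = 0" unfolding y1 using x1 by simp
  have bnd: "\<bar>cos a\<bar> \<le> 1" "\<bar>sin a\<bar> \<le> 1" for a :: real by auto
  have icos: "integrable M (\<lambda>x. cos (t * y x + \<theta>))" for t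
    by (rule integrable_const_bound[of _ 1]) (auto simp: m_eq)
  have isin: "integrable M (\<lambda>x. sin (t * y x + \<theta>))" for t
    by (rule integrable_const_bound[of _ 1]) (auto simp: m_eq)
  have iysin: "integrable M (\<lambda>x. y x * sin (t * y x + \<theta>))" for t
    by (rule integrable_mult_bounded[OF iy _ bnd(2)]) (auto simp: m_eq)
  have iy2cos: "integrable M (\<lambda>x. (y x)\<^sup>2 * cos (t * y x + \<theta>))" for t
    by (rule integrable_mult_bounded[OF iy2 _ bnd(1)]) (auto simp: m_eq)
  \<comment> \<open>The identity at frequency \<open>t *\<^sub>R \<xi>\<close>, multiplied by the
    components \<open>i\<close> and \<open>k\<close> of \<xi> and summed over both indices.\<close>
  have second: "(LINT x|M. s * cos (t * y x + \<theta>) - t * s * (y x * sin (t * y x + \<theta>)) - (y x)\<^sup>2 * cos (t * y x + \<theta>)) = 0" for t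
  proof -
    have ty: "(t *\<^sub>R \<xi>) \<bullet> x = t * y x" for x by (simp add: y_def)
    define c where "c = (LINT x|M. cos (t * y x + \<theta>))"
    define S where "S i = (LINT x|M. x $ i * sin (t * y x + \<theta>))" for i
    define Q where "Q i k = (LINT x|M. x $ i * x $ k * cos (t * y x + \<theta>))" for i k
    have st: "Q i k = (if i = k then c else 0) - t * \<xi> $ k * S i" for i k
      using stein[of i k "t *\<^sub>R \<xi>" \<theta>] unfolding ty by (simp add: Q_def c_def S_def split: if_splits)
    have ixsin: "integrable M (\<lambda>x. x $ i * sin (t * y x + \<theta>))" for i
      by (rule integrable_mult_bounded[OF x1(1) _ bnd(2)]) (auto simp: m_eq)
    have ixxcos: "integrable M (\<lambda>x. x $ i * x $ k * cos (t * y x + \<theta>))" for i k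
      by (rule integrable_mult_bounded[OF x2 _ bnd(1)]) (auto simp: m_eq)
    have 1: "(LINT x|M. (y x)\<^sup>2 * cos (t * y x + \<theta>)) = (\<Sum>i\<in>UNIV. \<Sum>k\<in>UNIV. \<xi> $ i * \<xi> $ k * Q i k)"
    proof -
      have "(y x)\<^sup>2 * cos (t * y x + \<theta>) = (\<Sum>i\<in>UNIV. \<Sum>k\<in>UNIV. \<xi> $ i * \<xi> $ k * (x $ i * x $ k * cos (t * y x + \<theta>)))" for x
        unfolding y2 by (simp add: sum_distrib_right mult.assoc)
      then show ?thesis using ixxcos by (simp add: Q_def)
    qed
    have 2: "(LINT x|M. y x * sin (t * y x + \<theta>)) = (\<Sum>i\<in>UNIV. \<xi> $ i * S i)"
    proof -
      have "y x * sin (t * y x + \<theta>) = (\<Sum>i\<in>UNIV. \<xi> $ i * (x $ i * sin (t * y x + \<theta>)))" for x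
        by (subst (1) y1) (simp add: sum_distrib_right mult.assoc)
      then show ?thesis using ixsin by (simp add: S_def)
    qed
    have "(\<Sum>i\<in>UNIV. \<Sum>k\<in>UNIV. \<xi> $ i * \<xi> $ k * Q i k) = (\<Sum>i\<in>UNIV. \<Sum>k\<in>UNIV. (if i = k then \<xi> $ i * \<xi> $ i * c else 0) - t * (\<xi> $ k * \<xi> $ k) * (\<xi> $ i * S i))"
      unfolding st by (intro sum.cong refl) (simp add: algebra_simps)
    also have "\<dots> = s * c - t * s * (\<Sum>i\<in>UNIV. \<xi> $ i * S i)"
      by (simp add: sum_subtractf s_def inner_vec_def sum_distrib_left[symmetric] sum_distrib_right[symmetric])
    finally show ?thesis
      using icos iysin iy2cos by (simp add: 1 2 c_def)
  qed
  have first: "(LINT x|M. t * s * cos (t * y x + \<theta>) - y x * sin (t * y x + \<theta>)) = 0" if t: "0 \<le> t" "t \<le> 1" for t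
  proof -
    \<comment> \<open>The path from 0 to \<open>t\<close> is rescaled to the unit interval; at
      \<open>r = 0\<close> the expectation vanishes because \<open>y\<close> has mean zero.\<close>
    define f where "f r x = r * t * s * cos (r * t * y x + \<theta>) - y x * sin (r * t * y x + \<theta>)" for r x
    define f' where "f' r x = t * (s * cos (r * t * y x + \<theta>) - (r * t) * s * (y x * sin (r * t * y x + \<theta>)) - (y x)\<^sup>2 * cos (r * t * y x + \<theta>))" for r x
    have "(LINT x|M. f 1 x) = (LINT x|M. f 0 x)"
    proof (rule expectation_derivative_eq_0[OF M(1)])
      show "((\<lambda>r. f r x) has_real_derivative f' r x) (at r)" for r x
        unfolding f_def f'_def
        by (auto intro!: derivative_eq_intros simp: power2_eq_square algebra_simps)
      show "(\<lambda>(r, x). f' r x) \<in> borel_measurable (borel \<Otimes>\<^sub>M M)"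
        unfolding f'_def by measurable
      show "integrable M (\<lambda>x. s + s * \<bar>y x\<bar> + (y x)\<^sup>2)" using iy iy2 by simp
      show "\<bar>f' r x\<bar> \<le> s + s * \<bar>y x\<bar> + (y x)\<^sup>2" if r: "0 \<le> r" "r \<le> 1" for r x
      proof -
        let ?a = "r * t * y x + \<theta>"
        have 1: "\<bar>s * cos ?a\<bar> \<le> s" using s0 by (simp add: abs_mult mult_left_le)
        have "r * t * (\<bar>y x\<bar> * \<bar>sin ?a\<bar>) \<le> 1 * (\<bar>y x\<bar> * 1)"
          using r t by (intro mult_mono mult_le_one) auto
        then have "s * (r * t * (\<bar>y x\<bar> * \<bar>sin ?a\<bar>)) \<le> s * \<bar>y x\<bar>" using s0 by (intro mult_left_mono) auto
        then have 2: "\<bar>(r * t) * s * (y x * sin ?a)\<bar> \<le> s * \<bar>y x\<bar>" using r t s0 by (simp add: abs_mult mult_ac)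
        have 3: "\<bar>(y x)\<^sup>2 * cos ?a\<bar> \<le> (y x)\<^sup>2" by (simp add: abs_mult mult_left_le)
        have "\<bar>s * cos ?a - (r * t) * s * (y x * sin ?a) - (y x)\<^sup>2 * cos ?a\<bar> \<le> s + s * \<bar>y x\<bar> + (y x)\<^sup>2"
          using 1 2 3 by linarith
        then show ?thesis unfolding f'_def abs_mult
          using t mult_mono[of "\<bar>t\<bar>" 1] by (smt (verit) abs_ge_zero mult_left_le_one_le)
      qed
      show "(LINT x|M. f' r x) = 0" for r
        using second[of "r * t"] unfolding f'_def by (subst integral_mult_right_zero) simp
      show "integrable M (f 0)" "integrable M (f 1)"
        unfolding f_def[abs_def] using icos iysin iy by (auto simp: mult.assoc)
    qed
    also have "(LINT x|M. f 0 x) = 0" using Ey iy by (simp add: f_def)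
    finally show ?thesis by (simp add: f_def)
  qed
  \<comment> \<open>The exponential is the integrating factor of the first-order equation.\<close>
  define f where "f t x = exp (t\<^sup>2 * s / 2) * cos (t * y x + \<theta>)" for t x
  define f' where "f' t x = exp (t\<^sup>2 * s / 2) * (t * s * cos (t * y x + \<theta>) - y x * sin (t * y x + \<theta>))" for t x
  have "(LINT x|M. f 1 x) = (LINT x|M. f 0 x)"
  proof (rule expectation_derivative_eq_0[OF M(1)])
    show "((\<lambda>t. f t x) has_real_derivative f' t x) (at t)" for t x
      unfolding f_def f'_def
      by (auto intro!: derivative_eq_intros simp: algebra_simps)
    show "(\<lambda>(t, x). f' t x) \<in> borel_measurable (borel \<Otimes>\<^sub>M M)"
      unfolding f'_def by measurable
    show "integrable M (\<lambda>x. exp (s / 2) * (s + \<bar>y x\<bar>))" using iy by simp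
    show "\<bar>f' t x\<bar> \<le> exp (s / 2) * (s + \<bar>y x\<bar>)" if t: "0 \<le> t" "t \<le> 1" for t x
    proof -
      let ?a = "t * y x + \<theta>"
      have "t * \<bar>cos ?a\<bar> \<le> 1" using t by (simp add: mult_le_one)
      then have "s * (t * \<bar>cos ?a\<bar>) \<le> s * 1" using s0 by (intro mult_left_mono) auto
      then have 1: "\<bar>t * s * cos ?a\<bar> \<le> s" using t s0 by (simp add: abs_mult mult_ac)
      have 2: "\<bar>y x * sin ?a\<bar> \<le> \<bar>y x\<bar>" by (simp add: abs_mult mult_left_le)
      have "t\<^sup>2 \<le> 1" using t by (simp add: power_le_one)
      then have 3: "exp (t\<^sup>2 * s / 2) \<le> exp (s / 2)" using s0 by (simp add: mult_left_le_one_le)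
      show ?thesis unfolding f'_def abs_mult
        using 1 2 3 by (intro mult_mono) auto
    qed
    show "(LINT x|M. f' t x) = 0" if "0 \<le> t" "t \<le> 1" for t
      using first[OF that] unfolding f'_def by (subst integral_mult_right_zero) simp
    show "integrable M (f 0)" "integrable M (f 1)"
      unfolding f_def[abs_def] using icos[of 0] icos[of 1] by auto
  qed
  then have "exp (s / 2) * (LINT x|M. cos (y x + \<theta>)) = cos \<theta>"
    by (simp add: f_def prob_space)
  then show ?thesis by (simp add: y_def s_def exp_minus field_simps)
qed

lemma axis_nth: "axis k c $ i = (if i = k then c else 0)"
  by (simp add: axis_def)

lemma std_gaussian_stein:
  fixes \<eta> :: "real ^ 'n"
  shows "(LINT x|std_gaussian. x $ i * x $ k * cos (\<eta> \<bullet> x + \<theta>)) - (if i = k then (LINT x|std_gaussian. cos (\<eta> \<bullet> x + \<theta>)) else 0)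
    = - (\<eta> $ k * (LINT x|std_gaussian. x $ i * sin (\<eta> \<bullet> x + \<theta>)))"
proof -
  have L: "L2g (\<lambda>x :: real ^ 'n. cos (\<eta> \<bullet> x + \<theta>))" using trig_L2g[OF trig.cos[of 1 \<eta> \<theta>]] by simp
  have "sin (\<eta> \<bullet> x + \<theta>) = cos (\<eta> \<bullet> x + (\<theta> - pi / 2))" for x
    by (simp add: cos_diff[of "\<eta> \<bullet> x + \<theta>" "pi / 2", simplified] add_diff_eq)
  then have Ls: "L2g (\<lambda>x :: real ^ 'n. sin (\<eta> \<bullet> x + \<theta>))" using trig_L2g[OF trig.cos[of 1 \<eta> "\<theta> - pi / 2"]] by simp
  have Lx: "L2g (\<lambda>x :: real ^ 'n. x $ l)" for l by (rule Herm_L2g[OF component_Herm])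
  have Lxx: "L2g (\<lambda>x :: real ^ 'n. x $ i * x $ k)" by (intro L2g_rpoly rpoly_intros)
  have I: "integrable std_gaussian (\<lambda>x :: real ^ 'n. (if i = k then cos (\<eta> \<bullet> x + \<theta>) else 0) - \<eta> $ k * (x $ i * sin (\<eta> \<bullet> x + \<theta>)))"
    using L2g_integrable[OF L] L2g_mult_integrable[OF Lx Ls] by (cases "i = k") simp_all
  note int = I L2g_mult_integrable[OF Lx L] L2g_mult_integrable[OF Lx Ls] L2g_mult_integrable[OF Lxx L] L2g_integrable[OF L]
  have "(LINT x|std_gaussian. (if i = k then cos (\<eta> \<bullet> x + \<theta>) else 0) - \<eta> $ k * (x $ i * sin (\<eta> \<bullet> x + \<theta>)))
     = (LINT x|std_gaussian. (x \<bullet> axis k 1) * (x $ i * cos (\<eta> \<bullet> x + \<theta>)))"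
  proof (rule std_gaussian_ibp)
    fix x :: "real ^ 'n"
    show "((\<lambda>s. (x + s *\<^sub>R axis k 1) $ i * cos (\<eta> \<bullet> (x + s *\<^sub>R axis k 1) + \<theta>)) has_real_derivative
      (if i = k then cos (\<eta> \<bullet> x + \<theta>) else 0) - \<eta> $ k * (x $ i * sin (\<eta> \<bullet> x + \<theta>))) (at 0)"
      by (auto intro!: derivative_eq_intros simp: inner_add_right inner_axis axis_nth)
  next
    show "integrable std_gaussian (\<lambda>x. (x \<bullet> axis k 1) * (x $ i * cos (\<eta> \<bullet> x + \<theta>)))"
      using int by (simp add: inner_axis mult_ac)
  qed (use int in blast)+
  moreover have "(LINT x|std_gaussian. (if i = k then cos (\<eta> \<bullet> x + \<theta>) else 0) - \<eta> $ k * (x $ i * sin (\<eta> \<bullet> x + \<theta>)))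
     = (if i = k then (LINT x|std_gaussian. cos (\<eta> \<bullet> x + \<theta>)) else 0) - \<eta> $ k * (LINT x|std_gaussian. x $ i * sin (\<eta> \<bullet> x + \<theta>))"
    using L2g_integrable[OF L] L2g_mult_integrable[OF Lx Ls] by (cases "i = k") simp_all
  moreover have "(x \<bullet> axis k 1) * (x $ i * cos (\<eta> \<bullet> x + \<theta>)) = x $ i * x $ k * cos (\<eta> \<bullet> x + \<theta>)" for x
    by (simp add: inner_axis)
  ultimately show ?thesis by simp
qed

text \<open>The same differential equation yields the Gaussian value, so both measures are compared
  without an explicit Fourier integral.\<close>

lemma expectation_cos_std_gaussian:
  "(LINT x|std_gaussian. cos (\<xi> \<bullet> x + \<theta>)) = exp (- (\<xi> \<bullet> \<xi>) / 2) * cos \<theta>"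
proof (rule expectation_cos[OF prob_space_std_gaussian sets_std_gaussian])
  show "integrable std_gaussian (\<lambda>x. x $ i)" "integrable std_gaussian (\<lambda>x. x $ i * x $ k)" for i k :: 'a
    by (intro rpoly_integrable rpoly_intros)+
  show "(LINT x|std_gaussian. x $ i) = 0" for i :: 'a
    using Herm_orth[OF component_Herm[of i] const_Herm[of 1]] by (simp add: ginner_def)
qed (rule std_gaussian_stein)

text \<open>The defining inequality tested on \<open>u\<^sub>0 + \<epsilon> (\<phi> - \<integral>\<phi>) e\<^sub>m\<close>; \<open>W\<close> is the squared norm of the symmetrized
  gradient of \<open>\<phi> e\<^sub>m\<close>.\<close>

lemma korn_test:
  fixes \<mu> :: "(real ^ 'n) measure" and \<phi> :: "real ^ 'n \<Rightarrow> real" and G :: "real ^ 'n \<Rightarrow> real ^ 'n"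
  assumes \<mu>: "prob_space \<mu>" "sets \<mu> = sets borel" "moment_assumption \<mu>"
    and ij: "i \<noteq> j" and K: "C_PK \<mu> \<le> ennreal K" "0 \<le> K"
    and \<phi>: "\<And>x. (\<phi> has_derivative (\<lambda>h. G x \<bullet> h)) (at x)" "\<And>x. \<bar>\<phi> x\<bar> \<le> B"
    and G: "G \<in> borel_measurable borel" "\<And>x k. \<bar>G x $ k\<bar> \<le> B'"
  shows "\<exists>W. \<forall>\<epsilon>. 3 + 2 * \<epsilon> * (LINT x|\<mu>. ((if m = i then x $ i * x $ j else 0) + (if m = j then 1 - (x $ i)\<^sup>2 else 0)) * \<phi> x)
    \<le> 2 * K * (3 / 2 + 2 * \<epsilon> * (LINT x|\<mu>. (if m = i then x $ j * G x $ i - x $ i * G x $ j / 2 else 0) - (if m = j then x $ i * G x $ i / 2 else 0)) + \<epsilon>\<^sup>2 * W)"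
proof -
  interpret prob_space \<mu> by fact
  note [measurable_cong] = \<mu>(2)
  have m_eq: "borel_measurable \<mu> = borel_measurable borel" by (rule measurable_cong_sets[OF \<mu>(2) refl])
  note [measurable] = G(1)
  have "continuous_on UNIV \<phi>"
    using has_derivative_continuous[OF \<phi>(1)] by (simp add: continuous_on_eq_continuous_at)
  then have \<phi>m [measurable]: "\<phi> \<in> borel_measurable borel" by (rule borel_measurable_continuous_onI)
  have M1: "has_bochner_integral \<mu> (\<lambda>x. x $ a) 0"
    and M2: "has_bochner_integral \<mu> (\<lambda>x. x $ a * x $ b) (if a = b then 1 else 0)"
    and M3: "has_bochner_integral \<mu> (\<lambda>x. x $ a * x $ b * x $ c) 0" for a b c
    using \<mu>(3) by (auto simp: moment_assumption_def)
  have M4: "has_bochner_integral \<mu> (\<lambda>x. ((x $ j)\<^sup>2 + (x $ i)\<^sup>2) * (x $ i)\<^sup>2) 4"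
    using \<mu>(3) ij by (auto simp: moment_assumption_def)
  define d where "d a = (if m = a then 1 else 0 :: real)" for a
  define q where "q x = d i * (x $ i * x $ j) + d j * (1 - (x $ i)\<^sup>2)" for x :: "real ^ 'n"
  define p where "p x = d i * (x $ j * G x $ i - x $ i * G x $ j / 2) - d j * (x $ i * G x $ i / 2)" for x
  have H1: "has_bochner_integral \<mu> (\<lambda>x. 1 :: real) 1"
    by (simp add: has_bochner_integral_iff prob_space)
  have H2: "has_bochner_integral \<mu> (\<lambda>x. 1 - (x $ i)\<^sup>2) 0"
    using has_bochner_integral_diff[OF H1 M2[of i i]] by (simp add: power2_eq_square)
  have Hij: "has_bochner_integral \<mu> (\<lambda>x. x $ i * x $ j) 0" using M2[of i j] ij by simp
  have Hq: "has_bochner_integral \<mu> q 0"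
    unfolding q_def[abs_def]
    using has_bochner_integral_add[OF has_bochner_integral_mult_right[OF Hij, of "d i"] has_bochner_integral_mult_right[OF H2, of "d j"]]
    by simp
  have i\<phi>: "integrable \<mu> \<phi>" by (rule integrable_const_bound[of _ B]) (use \<phi>(2) in \<open>auto simp: m_eq\<close>)
  have iq\<phi>: "integrable \<mu> (\<lambda>x. q x * \<phi> x)"
    using Hq by (intro integrable_mult_bounded[OF _ _ \<phi>(2)]) (auto simp: has_bochner_integral_iff m_eq)
  have ixG: "integrable \<mu> (\<lambda>x. x $ a * G x $ b)" for a b
    using M1[of a] by (intro integrable_mult_bounded[OF _ _ G(2)]) (auto simp: has_bochner_integral_iff m_eq)
  have int_p: "integrable \<mu> p" unfolding p_def[abs_def] using ixG by simp
  define w where "w x = \<phi> x - (LINT x|\<mu>. \<phi> x)" for x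
  \<comment> \<open>Centering keeps the test field in the class; it changes neither the derivative
    nor the pairing with \<open>q\<close>, which has mean zero.\<close>
  have Hw: "has_bochner_integral \<mu> w 0" unfolding w_def[abs_def]
    using i\<phi> by (simp add: has_bochner_integral_iff prob_space)
  define W where "W = (LINT x|\<mu>. (\<Sum>k\<in>UNIV. (G x $ k)\<^sup>2) / 2 + (G x $ m)\<^sup>2 / 2)"
  have GG: "integrable \<mu> (\<lambda>x. (G x $ k)\<^sup>2)" for k
  proof (rule integrable_const_bound[of _ "B'\<^sup>2"])
    have "(G x $ k)\<^sup>2 \<le> B'\<^sup>2" for x using power_mono[OF G(2)[of x k] abs_ge_zero, of 2] by simp
    then show "AE x in \<mu>. norm ((G x $ k)\<^sup>2) \<le> B'\<^sup>2" by simp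
  qed (simp add: m_eq)
  have main: "3 + 2 * \<epsilon> * (LINT x|\<mu>. q x * \<phi> x) \<le> 2 * K * (3 / 2 + 2 * \<epsilon> * (LINT x|\<mu>. p x) + \<epsilon>\<^sup>2 * W)" for \<epsilon>
  proof -
    define u :: "real ^ 'n \<Rightarrow> real ^ 'n" where
      "u x = (x $ i * x $ j) *\<^sub>R axis i 1 + (1 - (x $ i)\<^sup>2) *\<^sub>R axis j 1 + (\<epsilon> * w x) *\<^sub>R axis m 1" for x
    define u' where "u' x h = (x $ i * h $ j + h $ i * x $ j) *\<^sub>R axis i 1 + (- (2 * x $ i * h $ i)) *\<^sub>R axis j 1 + (\<epsilon> * (G x \<bullet> h)) *\<^sub>R (axis m 1 :: real ^ 'n)"
      for x h :: "real ^ 'n"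
    have nth: "((\<lambda>x :: real ^ 'n. x $ a) has_derivative (\<lambda>h. h $ a)) F" for a F
      by (rule bounded_linear.has_derivative[OF bounded_linear_vec_nth has_derivative_ident])
    have du: "(u has_derivative u' x) (at x)" for x
      unfolding u_def[abs_def] u'_def[abs_def] w_def
      by (auto intro!: derivative_eq_intros nth \<phi>(1) simp: fun_eq_iff algebra_simps)
    have u_grad: "sym_grad u x $ k $ l = (u' x (axis l 1) $ k + u' x (axis k 1) $ l) / 2" for x k l
      by (simp add: sym_grad_nth jacobian_nth[OF du])
    have mean: "has_bochner_integral \<mu> u 0"
      unfolding u_def[abs_def]
      using has_bochner_integral_add[OF has_bochner_integral_add[OF has_bochner_integral_scaleR_left[OF Hij, of "axis i 1"]
          has_bochner_integral_scaleR_left[OF H2, of "axis j 1"]] has_bochner_integral_scaleR_left[OF has_bochner_integral_mult_right[OF Hw, of \<epsilon>], of "axis m 1"]]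
      by simp
    define D where "D a b = (if a = b then 1 else 0 :: real)" for a b :: 'n
    have Dsum: "(\<Sum>b\<in>UNIV. D a b * f b) = f a" "(\<Sum>b\<in>UNIV. D b a * f b) = f a" for a and f :: "'n \<Rightarrow> real"
      by (simp_all add: D_def if_distrib[of "\<lambda>t. t * _"] cong: if_cong)
    \<comment> \<open>The symmetrized gradient of the unperturbed field: diagonal entry x_j at (i,
      i), and (x_i - 2 x_i) / 2 = - x_i / 2 at (i, j) and (j, i).\<close>
    define s0 where "s0 x k l = x $ j * (D i k * D i l) - (x $ i / 2) * (D i k * D j l + D j k * D i l)" for x :: "real ^ 'n" and k l
    define sw where "sw x k l = (D m k * G x $ l + D m l * G x $ k) / 2" for x k l
    have sgs: "sym_grad u x $ k $ l = s0 x k l + \<epsilon> * sw x k l" for x k l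
      unfolding u_grad u'_def s0_def sw_def by (simp add: inner_axis axis_nth D_def field_simps)
    have DD: "D i j = 0" "D j i = 0" "D a a = 1" for a using ij by (auto simp: D_def)
    have s0f: "(\<Sum>k\<in>UNIV. \<Sum>l\<in>UNIV. s0 x k l * f k l) = x $ j * f i i - x $ i / 2 * (f i j + f j i)" for x and f :: "'n \<Rightarrow> 'n \<Rightarrow> real"
    proof -
      have "(\<Sum>k\<in>UNIV. \<Sum>l\<in>UNIV. s0 x k l * f k l) = (\<Sum>k\<in>UNIV. \<Sum>l\<in>UNIV. x $ j * (D i k * (D i l * f k l))
          - x $ i / 2 * (D i k * (D j l * f k l)) - x $ i / 2 * (D j k * (D i l * f k l)))"
        by (intro sum.cong refl) (simp add: s0_def algebra_simps)
      then show ?thesis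
        by (simp only: sum_subtractf sum_distrib_left[symmetric] Dsum) (simp add: algebra_simps)
    qed
    have sw_sym: "sw x k l = sw x l k" for x k l by (simp add: sw_def)
    have s0_val: "s0 x i i = x $ j" "s0 x i j = - (x $ i / 2)" "s0 x j i = - (x $ i / 2)" for x
      by (simp_all add: s0_def DD)
    have q1: "(\<Sum>k\<in>UNIV. \<Sum>l\<in>UNIV. (s0 x k l)\<^sup>2) = (x $ j)\<^sup>2 + (x $ i)\<^sup>2 / 2" for x
      unfolding power2_eq_square s0f s0_val by (simp add: field_simps)
    have q2: "(\<Sum>k\<in>UNIV. \<Sum>l\<in>UNIV. s0 x k l * sw x k l) = p x" for x
      unfolding s0f by (simp add: sw_def p_def D_def d_def)
    have q3: "(\<Sum>k\<in>UNIV. \<Sum>l\<in>UNIV. (sw x k l)\<^sup>2) = (\<Sum>k\<in>UNIV. (G x $ k)\<^sup>2) / 2 + (G x $ m)\<^sup>2 / 2" for x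
    proof -
      have 1: "(\<Sum>k\<in>UNIV. \<Sum>l\<in>UNIV. D m k * (G x $ l * sw x k l)) = (\<Sum>l\<in>UNIV. G x $ l * sw x m l)"
        by (simp only: sum_distrib_left[symmetric] Dsum)
      have 2: "(\<Sum>k\<in>UNIV. \<Sum>l\<in>UNIV. D m l * (G x $ k * sw x k l)) = (\<Sum>k\<in>UNIV. G x $ k * sw x m k)"
        by (simp only: Dsum) (simp add: sw_sym[of x _ m])
      have 3: "(\<Sum>l\<in>UNIV. G x $ l * sw x m l) = (\<Sum>l\<in>UNIV. (G x $ l)\<^sup>2) / 2 + (G x $ m)\<^sup>2 / 2"
      proof -
        have "(\<Sum>l\<in>UNIV. G x $ l * sw x m l) = (\<Sum>l\<in>UNIV. (1 / 2) * (G x $ l)\<^sup>2 + (1 / 2) * (D m l * (G x $ m * G x $ l)))"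
          by (intro sum.cong refl) (simp add: sw_def D_def power2_eq_square field_simps)
        then show ?thesis
          by (simp only: sum.distrib sum_distrib_left[symmetric] Dsum) (simp add: power2_eq_square)
      qed
      have "(\<Sum>k\<in>UNIV. \<Sum>l\<in>UNIV. (sw x k l)\<^sup>2) = (\<Sum>k\<in>UNIV. \<Sum>l\<in>UNIV. (1 / 2) * (D m k * (G x $ l * sw x k l)) + (1 / 2) * (D m l * (G x $ k * sw x k l)))"
      proof (intro sum.cong refl)
        fix k l
        have "(sw x k l)\<^sup>2 = ((D m k * G x $ l + D m l * G x $ k) / 2) * sw x k l"
          by (simp add: power2_eq_square sw_def)
        then show "(sw x k l)\<^sup>2 = (1 / 2) * (D m k * (G x $ l * sw x k l)) + (1 / 2) * (D m l * (G x $ k * sw x k l))"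
          by (simp add: field_simps)
      qed
      also have "\<dots> = (\<Sum>l\<in>UNIV. (G x $ l)\<^sup>2) / 2 + (G x $ m)\<^sup>2 / 2"
        by (simp only: sum.distrib sum_distrib_left[symmetric, of "1 / 2"] 1 2 3) simp
      finally show ?thesis .
    qed
    define R where "R x = (x $ j)\<^sup>2 + (x $ i)\<^sup>2 / 2 + 2 * \<epsilon> * p x + \<epsilon>\<^sup>2 * ((\<Sum>k\<in>UNIV. (G x $ k)\<^sup>2) / 2 + (G x $ m)\<^sup>2 / 2)" for x
    have R: "(\<Sum>k\<in>UNIV. \<Sum>l\<in>UNIV. (sym_grad u x $ k $ l)\<^sup>2) = R x" for x
    proof -
      have "(\<Sum>k\<in>UNIV. \<Sum>l\<in>UNIV. (sym_grad u x $ k $ l)\<^sup>2) = (\<Sum>k\<in>UNIV. \<Sum>l\<in>UNIV. (s0 x k l)\<^sup>2 + 2 * \<epsilon> * (s0 x k l * sw x k l) + \<epsilon>\<^sup>2 * (sw x k l)\<^sup>2)"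
        unfolding sgs by (intro sum.cong refl) (simp add: power2_eq_square algebra_simps)
      then show ?thesis by (simp add: sum.distrib sum_distrib_left[symmetric] q1 q2 q3 R_def)
    qed
    have ix2: "integrable \<mu> (\<lambda>x. (x $ a)\<^sup>2)" "(LINT x|\<mu>. (x $ a)\<^sup>2) = 1" for a
      using M2[of a a] by (auto simp: has_bochner_integral_iff power2_eq_square)
    have iR: "integrable \<mu> R" unfolding R_def[abs_def] using ix2 int_p GG by simp
    have ER: "(LINT x|\<mu>. R x) = 3 / 2 + 2 * \<epsilon> * (LINT x|\<mu>. p x) + \<epsilon>\<^sup>2 * W"
      unfolding R_def[abs_def] W_def using ix2 int_p GG by simp
    have R0: "R x \<ge> 0" for x unfolding R[symmetric] by (intro sum_nonneg) simp
    have L2: "L2_sq_mat \<mu> (sym_grad u) = ennreal (LINT x|\<mu>. R x)"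
      unfolding L2_sq_mat_def R using iR R0 by (intro nn_integral_eq_integral) auto
    have uPK: "u \<in> PK_class \<mu>"
      unfolding PK_class_def using du mean L2 by (auto simp: differentiable_def)
    define u0 :: "real ^ 'n \<Rightarrow> real ^ 'n" where
      "u0 x = (x $ i * x $ j) *\<^sub>R axis i 1 + (1 - (x $ i)\<^sup>2) *\<^sub>R axis j 1" for x
    have u0m: "u0 x \<bullet> axis m 1 = q x" for x
      by (auto simp: u0_def q_def d_def inner_add_left inner_axis axis_nth)
    \<comment> \<open>The integrand is (x_i^2 + x_j^2) x_i^2 - 2 x_i^2 + 1, with expectation 4 - 2 +
      1.\<close>
    have u0u0: "has_bochner_integral \<mu> (\<lambda>x. u0 x \<bullet> u0 x) 3"
    proof -
      have "u0 x \<bullet> u0 x = (((x $ j)\<^sup>2 + (x $ i)\<^sup>2) * (x $ i)\<^sup>2 - 2 * (x $ i * x $ i)) + 1" for x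
        using ij by (simp add: u0_def inner_add_left inner_add_right inner_axis axis_nth power2_eq_square algebra_simps)
      then show ?thesis
        using has_bochner_integral_add[OF has_bochner_integral_diff[OF M4 has_bochner_integral_mult_right[OF M2[of i i], of 2]] H1]
        by simp
    qed
    have u0A: "has_bochner_integral \<mu> (\<lambda>x. u0 x \<bullet> (A *v x)) 0" for A :: "real ^ 'n ^ 'n"
    proof -
      have "u0 x \<bullet> (A *v x) = (\<Sum>l\<in>UNIV. A $ i $ l * (x $ i * x $ j * x $ l) + A $ j $ l * (x $ l - x $ i * x $ i * x $ l))" for x
        by (simp add: u0_def inner_add_left inner_axis' matrix_vector_mult_def sum.distrib sum_subtractf sum_distrib_left sum_distrib_right power2_eq_square algebra_simps)
      moreover have "has_bochner_integral \<mu> (\<lambda>x. \<Sum>l\<in>UNIV. A $ i $ l * (x $ i * x $ j * x $ l) + A $ j $ l * (x $ l - x $ i * x $ i * x $ l)) (\<Sum>l\<in>(UNIV :: 'n set). A $ i $ l * 0 + A $ j $ l * (0 - 0))"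
        by (intro has_bochner_integral_sum has_bochner_integral_add has_bochner_integral_mult_right has_bochner_integral_diff M1 M3)
      ultimately show ?thesis by simp
    qed
    have qw: "integrable \<mu> (\<lambda>x. q x * w x)" "(LINT x|\<mu>. q x * w x) = (LINT x|\<mu>. q x * \<phi> x)"
      using iq\<phi> Hq by (auto simp: w_def right_diff_distrib has_bochner_integral_iff)
    have lower: "ennreal (3 + 2 * \<epsilon> * (LINT x|\<mu>. q x * \<phi> x)) \<le> L2_sq_vec \<mu> (\<lambda>x. u x - a x)" if skew: "a \<in> skew_maps" for a
    proof -
      obtain A :: "real ^ 'n ^ 'n" where a: "a = (\<lambda>x. A *v x)" using skew unfolding skew_maps_def by blast
      \<comment> \<open>The square of the remainder \<open>v\<close> is nonnegative and discarded.
        What is left depends on \<open>A\<close> only through a term of expectation zero, so the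
        bound is uniform over the skew maps.\<close>
      define b where "b x = u0 x \<bullet> u0 x + 2 * \<epsilon> * (q x * w x) - 2 * (u0 x \<bullet> (A *v x))" for x
      have "integrable \<mu> b" unfolding b_def[abs_def]
        using u0u0 u0A[of A] qw by (auto simp: has_bochner_integral_iff)
      moreover have "(LINT x|\<mu>. b x) = 3 + 2 * \<epsilon> * (LINT x|\<mu>. q x * \<phi> x)"
        unfolding b_def[abs_def] using u0u0 u0A[of A] qw by (auto simp: has_bochner_integral_iff)
      moreover have "b x \<le> (norm (u x - a x))\<^sup>2" for x
      proof -
        define v where "v = (\<epsilon> * w x) *\<^sub>R axis m 1 - A *v x"
        have "u x - a x = u0 x + v" by (simp add: u_def u0_def v_def a)
        then have "(norm (u x - a x))\<^sup>2 = u0 x \<bullet> u0 x + 2 * (u0 x \<bullet> v) + v \<bullet> v"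
          by (simp add: dot_square_norm[symmetric] inner_add_left inner_add_right inner_commute)
        moreover have "u0 x \<bullet> v = \<epsilon> * (q x * w x) - u0 x \<bullet> (A *v x)"
          by (simp add: v_def inner_diff_right u0m)
        moreover have "v \<bullet> v \<ge> 0" by simp
        ultimately show ?thesis unfolding b_def by linarith
      qed
      then have "(\<integral>\<^sup>+x. ennreal (b x) \<partial>\<mu>) \<le> L2_sq_vec \<mu> (\<lambda>x. u x - a x)"
        unfolding L2_sq_vec_def by (intro nn_integral_mono ennreal_leI)
      ultimately show ?thesis using ennreal_integral_le_nn_integral[of \<mu> b] by (metis order_trans)
    qed
    have "0 \<le> (LINT x|\<mu>. R x)" using R0 by (intro integral_nonneg_AE) simp
    from C_PK_le_imp[OF uPK lower L2 this K] show ?thesis unfolding ER .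
  qed
  have qe: "q x = (if m = i then x $ i * x $ j else 0) + (if m = j then 1 - (x $ i)\<^sup>2 else 0)"
    and pe: "p x = (if m = i then x $ j * G x $ i - x $ i * G x $ j / 2 else 0) - (if m = j then x $ i * G x $ i / 2 else 0)" for x
    by (auto simp: q_def p_def d_def)
  show ?thesis using main unfolding qe pe by blast
qed

section \<open>Rigidity and conclusion\<close>

lemma linear_le_quadratic_imp_0:
  fixes c W :: real
  assumes "\<And>\<epsilon>. \<epsilon> * c \<le> \<epsilon>\<^sup>2 * W"
  shows "c = 0"
proof (rule ccontr)
  assume c: "c \<noteq> 0"
  define r where "r = \<bar>W\<bar> + 1"
  have r: "r > 0" "W < r" by (auto simp: r_def)
  have "c / r * c \<le> (c / r)\<^sup>2 * W" by (rule assms)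
  then have "c\<^sup>2 * r \<le> c\<^sup>2 * W" using r by (simp add: field_simps power2_eq_square)
  then show False using c r by simp
qed

lemma exists_other_index:
  assumes "CARD('n::finite) \<ge> 2"
  shows "\<exists>j :: 'n. j \<noteq> i"
proof (rule ccontr)
  assume "\<nexists>j :: 'n. j \<noteq> i"
  then have "(UNIV :: 'n set) = {i}" by auto
  from arg_cong[OF this, of card] have "CARD('n) = 1" by simp
  with assms show False by simp
qed

text \<open>With constant 1 the zeroth-order terms of the test inequality agree. The linear terms
  must then agree as well, since \<epsilon> may have either sign.\<close>

lemma C_PK_le_1_imp_stein:
  fixes \<mu> :: "(real ^ 'n) measure"
  assumes card: "CARD('n) \<ge> 2" and \<mu>: "prob_space \<mu>" "sets \<mu> = sets borel" "moment_assumption \<mu>"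
    and K: "C_PK \<mu> \<le> 1"
  shows "(LINT x|\<mu>. x $ i * x $ k * cos (\<eta> \<bullet> x + \<theta>)) - (if i = k then (LINT x|\<mu>. cos (\<eta> \<bullet> x + \<theta>)) else 0)
    = - (\<eta> $ k * (LINT x|\<mu>. x $ i * sin (\<eta> \<bullet> x + \<theta>)))"
proof -
  interpret prob_space \<mu> by fact
  have m_eq: "borel_measurable \<mu> = borel_measurable borel" by (rule measurable_cong_sets[OF \<mu>(2) refl])
  define \<phi> where "\<phi> x = cos (\<eta> \<bullet> x + \<theta>)" for x
  define G where "G x = - sin (\<eta> \<bullet> x + \<theta>) *\<^sub>R \<eta>" for x
  define I where "I a = (LINT x|\<mu>. x $ a * sin (\<eta> \<bullet> x + \<theta>))" for a
  have [measurable]: "\<phi> \<in> borel_measurable borel" unfolding \<phi>_def[abs_def] by measurable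
  have d\<phi>: "(\<phi> has_derivative (\<lambda>h. G x \<bullet> h)) (at x)" for x
    unfolding \<phi>_def[abs_def] G_def by (auto intro!: derivative_eq_intros simp: mult.commute)
  have b\<phi>: "\<bar>\<phi> x\<bar> \<le> 1" for x by (simp add: \<phi>_def)
  have Gm: "G \<in> borel_measurable borel" unfolding G_def[abs_def] by measurable
  have bG: "\<bar>G x $ a\<bar> \<le> norm \<eta>" for x a
  proof -
    have "\<bar>G x $ a\<bar> = \<bar>sin (\<eta> \<bullet> x + \<theta>)\<bar> * \<bar>\<eta> $ a\<bar>" by (simp add: G_def abs_mult)
    also have "\<dots> \<le> 1 * norm \<eta>" by (intro mult_mono component_le_norm_cart) auto
    finally show ?thesis by simp
  qed
  have test: "(LINT x|\<mu>. ((if m = a then x $ a * x $ b else 0) + (if m = b then 1 - (x $ a)\<^sup>2 else 0)) * \<phi> x)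
    = 2 * (LINT x|\<mu>. (if m = a then x $ b * G x $ a - x $ a * G x $ b / 2 else 0) - (if m = b then x $ a * G x $ a / 2 else 0))"
    (is "?Z = 2 * ?P") if ab: "a \<noteq> b" for a b m
  proof -
    obtain W where W: "\<And>\<epsilon>. 3 + 2 * \<epsilon> * ?Z \<le> 2 * 1 * (3 / 2 + 2 * \<epsilon> * ?P + \<epsilon>\<^sup>2 * W)"
      using korn_test[OF \<mu> ab _ _ d\<phi> b\<phi> Gm bG, of 1 m] K by auto
    have "\<epsilon> * (?Z - 2 * ?P) \<le> \<epsilon>\<^sup>2 * W" for \<epsilon>
      using W[of \<epsilon>] by (simp add: algebra_simps)
    from linear_le_quadratic_imp_0[OF this] show ?thesis by simp
  qed
  have M1: "integrable \<mu> (\<lambda>x. x $ a)" and M2: "integrable \<mu> (\<lambda>x. x $ a * x $ b)" for a b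
    using \<mu>(3) by (auto simp: moment_assumption_def has_bochner_integral_iff)
  have isin: "integrable \<mu> (\<lambda>x. x $ a * sin (\<eta> \<bullet> x + \<theta>))" for a
    by (rule integrable_mult_bounded[OF M1, of _ 1]) (auto simp: m_eq)
  have icos: "integrable \<mu> (\<lambda>x. x $ a * x $ b * \<phi> x)" for a b
    by (rule integrable_mult_bounded[OF M2, of _ 1]) (auto simp: m_eq \<phi>_def)
  have i\<phi>: "integrable \<mu> \<phi>"
    by (rule integrable_const_bound[of _ 1]) (auto simp: m_eq b\<phi>)
  have G: "x $ a * G x $ b = - (\<eta> $ b) * (x $ a * sin (\<eta> \<bullet> x + \<theta>))" for x a b
    by (simp add: G_def)
  show ?thesis
  proof (cases "i = k")
    case True
    \<comment> \<open>Perturbing along axis \<open>j\<close> isolates 1 - x_i^2, the diagonal case;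
      the dimension being at least 2 provides such a \<open>j\<close>.\<close>
    obtain j where j: "j \<noteq> i"
      using exists_other_index[OF card] by blast
    then have "(LINT x|\<mu>. (1 - (x $ i)\<^sup>2) * \<phi> x) = 2 * (LINT x|\<mu>. - (x $ i * G x $ i / 2))"
      using test[of i j j] by simp
    also have "(LINT x|\<mu>. (1 - (x $ i)\<^sup>2) * \<phi> x) = (LINT x|\<mu>. \<phi> x - x $ i * x $ i * \<phi> x)"
      by (simp add: left_diff_distrib power2_eq_square)
    finally show ?thesis using True isin i\<phi> icos by (simp add: G \<phi>_def[abs_def])
  next
    case False
    \<comment> \<open>The left side is symmetric in \<open>a\<close> and \<open>b\<close>. Comparing
      the two versions gives \<open>\<eta> $ a * I b = \<eta> $ b * I a\<close>, so both equal
      \<open>- (\<eta> $ b * I a)\<close>.\<close>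
    have *: "(LINT x|\<mu>. x $ a * x $ b * \<phi> x) = - 2 * \<eta> $ a * I b + \<eta> $ b * I a" if "a \<noteq> b" for a b
      using test[OF that, of a] that isin by (simp add: G I_def)
    have "(LINT x|\<mu>. x $ k * x $ i * \<phi> x) = (LINT x|\<mu>. x $ i * x $ k * \<phi> x)"
      by (simp add: mult_ac)
    then show ?thesis
      using *[of i k] *[of k i] False by (simp add: I_def \<phi>_def)
  qed
qed

text \<open>The test inequality without perturbation reads \<open>3 \<le> 3 * K\<close>.\<close>

lemma C_PK_ge_1:
  fixes \<mu> :: "(real ^ 'n) measure"
  assumes card: "CARD('n) \<ge> 2" and \<mu>: "prob_space \<mu>" "sets \<mu> = sets borel" "moment_assumption \<mu>"
  shows "C_PK \<mu> \<ge> 1"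
proof (rule ccontr)
  assume "\<not> C_PK \<mu> \<ge> 1"
  then obtain K where K: "C_PK \<mu> = ennreal K" "0 \<le> K" "K < 1"
    by (cases "C_PK \<mu>") auto
  obtain i j :: 'n where ij: "i \<noteq> j"
    using exists_other_index[OF card] by blast
  obtain W where W: "\<And>\<epsilon>. 3 + 2 * \<epsilon> * 0 \<le> 2 * K * (3 / 2 + 2 * \<epsilon> * 0 + \<epsilon>\<^sup>2 * W)"
    using korn_test[OF \<mu> ij, of K "\<lambda>_. 0" "\<lambda>_. 0" 0 0 i] K ij by auto
  show False using W[of 0] K by simp
qed

theorem corollary1:
  fixes \<mu> :: "(real ^ 'n) measure"
  assumes "CARD('n) \<ge> 2"
    and "prob_space \<mu>" and "sets \<mu> = sets borel"
    and "moment_assumption \<mu>"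
  shows "C_PK \<mu> \<ge> C_PK (std_gaussian :: (real ^ 'n) measure) \<and>
         (C_PK \<mu> = C_PK (std_gaussian :: (real ^ 'n) measure) \<longrightarrow> \<mu> = std_gaussian)"
proof (intro conjI impI)
  show "C_PK (std_gaussian :: (real ^ 'n) measure) \<le> C_PK \<mu>"
    by (rule order_trans[OF C_PK_std_gaussian_le_1 C_PK_ge_1[OF assms]])
  assume "C_PK \<mu> = C_PK (std_gaussian :: (real ^ 'n) measure)"
  then have le: "C_PK \<mu> \<le> 1" using C_PK_std_gaussian_le_1 by simp
  show "\<mu> = std_gaussian"
  proof (rule measure_eqI_trig[OF assms(2,3) prob_space_std_gaussian sets_std_gaussian])
    have x: "integrable \<mu> (\<lambda>x. x $ i)" "(LINT x|\<mu>. x $ i) = 0" "integrable \<mu> (\<lambda>x. x $ i * x $ k)" for i k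
      using assms(4) by (auto simp: moment_assumption_def has_bochner_integral_iff)
    show "(LINT x|\<mu>. cos (\<xi> \<bullet> x + \<theta>)) = (LINT x|std_gaussian. cos (\<xi> \<bullet> x + \<theta>))" for \<xi> \<theta>
      unfolding expectation_cos_std_gaussian
      by (rule expectation_cos[OF assms(2,3) x C_PK_le_1_imp_stein[OF assms le]])
  qed
qed

end
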